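(* Let $m,n\ge 1$, $q=\min\{m,n\}$, $1\le k\le q$, and let $F$ be a complex $m\times n$ matrix of rank $r$. Suppose that $\Phi$ is a strictly convex symmetric gauge function on $\mathbb{R}^q$. Then the minimizers of the problem $$\min\{\,\|F-X\|_\Phi \,:\, X\in\mathcal{I}_{m,n}^k\,\}$$ satisfy the following: (i) If $k<r$, then there is a unique minimizer if and only if $s_k(F)\neq s_{k+1}(F)$. In the case in which $s_k(F)=s_{k+1}(F)$, there are infinitely many minimizers, given as follows. Set $\ell_k=\#\{j : s_j(F)>s_k(F)\}$ and $e_k=\#\{j : s_j(F)=s_k(F)\}$. Given a singular value decomposition $F=V\Sigma W^*$, the minimizers are parametrized by $$U_{k,P}=V\begin{bmatrix} I_{\ell_k}&0&0\\0&P&0\\0&0&0_{m-\ell_k-e_k,\,n-\ell_k-e_k}\end{bmatrix}W^*,$$ where $P$ is an orthogonal projection in the $e_k\times e_k$ complex matrices of rank $k-\ell_k$. (ii) If $k=r$ and $F=U|F|$ is the canonical polar decomposition, then $U$ is the unique minimizer. (iii) If $r<k\le q$, then there are infinitely many minimizers. Given a singular value decomposition $F=V\Sigma W^*$, the minimizers are described by $$U_{k,S}=V\begin{bmatrix} I_r&0\\0&S\end{bmatrix}W^*,$$ where $S$ is an $(m-r)\times(n-r)$ partial isometry of rank $k-r$.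
   Context: A complex $m\times n$ matrix $X$ is a partial isometry if $\|Xf\|=\|f\|$ for all $f\in\ker(X)^\perp$; $\mathcal{I}_{m,n}^k$ denotes the set of $m\times n$ partial isometries of rank $k$. $s_1(F)\ge\dots\ge s_q(F)\ge 0$ are the singular values of $F$ (the $q$ largest eigenvalues of $|F|=(F^*F)^{1/2}$, with multiplicity). A singular value decomposition (SVD) of $F$ of rank $r$ is a factorization $F=V\Sigma W^*$ with $V$ an $m\times m$ unitary matrix, $W$ an $n\times n$ unitary matrix, and $\Sigma=\begin{bmatrix}\Sigma_r&0\\0&0_{m-r,n-r}\end{bmatrix}$, $\Sigma_r=\mathrm{diag}(s_1(F),\dots,s_r(F))$. The canonical polar decomposition of $F$ is the unique factorization $F=U|F|$ with $U$ a partial isometry and $\ker(U)=\ker(F)$. A symmetric gauge function is a norm $\Phi$ on $\mathbb{R}^q$ with $\Phi(x_1,\dots,x_q)=\Phi(|x_{\sigma(1)}|,\dots,|x_{\sigma(q)}|)$ for every permutation $\sigma$ of $\{1,\dots,q\}$; it defines the unitarily invariant norm $\|F\|_\Phi=\Phi(s_1(F),\dots,s_q(F))$. $\Phi$ is strictly convex if $\Phi(\lambda x+(1-\lambda)y)<1$ whenever $x\ne y$, $\Phi(x)=\Phi(y)=1$ and $\lambda\in(0,1)$. *)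

theory Defs
  imports
    "HOL-Analysis.L2_Norm"
    "HOL-Combinatorics.Permutations"
    "Jordan_Normal_Form.DL_Rank"
    "Jordan_Normal_Form.Matrix_Kernel"
    "Jordan_Normal_Form.Schur_Decomposition"
begin

definition mat_rank :: "complex mat \<Rightarrow> nat" where
  "mat_rank A = vec_space.rank (dim_row A) A"

definition vec_norm2 :: "complex vec \<Rightarrow> real" where
  "vec_norm2 v = L2_set (\<lambda>i. cmod (v $ i)) {..<dim_vec v}"

definition unitary_mat :: "nat \<Rightarrow> complex mat \<Rightarrow> bool" where
  "unitary_mat n V \<longleftrightarrow> V \<in> carrier_mat n n \<and>
     mat_adjoint V * V = 1\<^sub>m n \<and> V * mat_adjoint V = 1\<^sub>m n"

definition kernel_orth :: "complex mat \<Rightarrow> complex vec set" where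
  "kernel_orth X = {f \<in> carrier_vec (dim_col X). \<forall>g \<in> mat_kernel X. f \<bullet>c g = 0}"

definition partial_isometry :: "complex mat \<Rightarrow> bool" where
  "partial_isometry X \<longleftrightarrow> (\<forall>f \<in> kernel_orth X. vec_norm2 (X *\<^sub>v f) = vec_norm2 f)"

definition partial_isometries :: "nat \<Rightarrow> nat \<Rightarrow> nat \<Rightarrow> complex mat set" where
  "partial_isometries m n k = {X \<in> carrier_mat m n. partial_isometry X \<and> mat_rank X = k}"

definition orth_projections :: "nat \<Rightarrow> nat \<Rightarrow> complex mat set" where
  "orth_projections e k =
     {P \<in> carrier_mat e e. P * P = P \<and> mat_adjoint P = P \<and> mat_rank P = k}"

definition psd_mat :: "nat \<Rightarrow> complex mat \<Rightarrow> bool" where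
  "psd_mat n B \<longleftrightarrow> B \<in> carrier_mat n n \<and> mat_adjoint B = B \<and>
     (\<forall>v \<in> carrier_vec n. 0 \<le> Re ((B *\<^sub>v v) \<bullet>c v))"

text \<open>The positive semidefinite square root of \<open>F\<^sup>* F\<close>, which exists and is unique.\<close>

definition mat_abs :: "complex mat \<Rightarrow> complex mat" where
  "mat_abs F = (THE B. psd_mat (dim_col F) B \<and> B * B = mat_adjoint F * F)"

text \<open>\<open>sing_val F j\<close> is the \<open>j\<close>-th largest eigenvalue of \<open>\<bar>F\<bar>\<close>, counted with multiplicity.
  The index is one-based and is meant to satisfy \<open>1 \<le> j \<le> min (dim_row F) (dim_col F)\<close>.
  The eigenvalues of \<open>\<bar>F\<bar>\<close> are real, so \<open>Re\<close> only changes the type.\<close>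

definition sing_val :: "complex mat \<Rightarrow> nat \<Rightarrow> real" where
  "sing_val F j =
     rev (sorted_list_of_multiset (image_mset Re (proots (char_poly (mat_abs F))))) ! (j - 1)"

definition svd_sigma :: "complex mat \<Rightarrow> complex mat" where
  "svd_sigma F = (let r = mat_rank F in
     diag_block_mat [mat_diag r (\<lambda>i. complex_of_real (sing_val F (i + 1))),
                     0\<^sub>m (dim_row F - r) (dim_col F - r)])"

definition is_svd :: "complex mat \<Rightarrow> complex mat \<Rightarrow> complex mat \<Rightarrow> bool" where
  "is_svd F V W \<longleftrightarrow> unitary_mat (dim_row F) V \<and> unitary_mat (dim_col F) W \<and>
     F = V * svd_sigma F * mat_adjoint W"

definition canonical_polar :: "complex mat \<Rightarrow> complex mat \<Rightarrow> bool" where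
  "canonical_polar F U \<longleftrightarrow> U \<in> carrier_mat (dim_row F) (dim_col F) \<and>
     partial_isometry U \<and> mat_kernel U = mat_kernel F \<and> F = U * mat_abs F"

text \<open>A gauge function on \<open>\<real>\<^sup>q\<close> is a function on all vectors of which only the values
  on \<open>carrier_vec q\<close> matter.\<close>

definition norm_on :: "nat \<Rightarrow> (real vec \<Rightarrow> real) \<Rightarrow> bool" where
  "norm_on q \<Phi> \<longleftrightarrow>
     (\<forall>x \<in> carrier_vec q. 0 \<le> \<Phi> x \<and> (\<Phi> x = 0 \<longleftrightarrow> x = 0\<^sub>v q)) \<and>
     (\<forall>x \<in> carrier_vec q. \<forall>a. \<Phi> (a \<cdot>\<^sub>v x) = \<bar>a\<bar> * \<Phi> x) \<and>
     (\<forall>x \<in> carrier_vec q. \<forall>y \<in> carrier_vec q. \<Phi> (x + y) \<le> \<Phi> x + \<Phi> y)"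

definition symmetric_gauge :: "nat \<Rightarrow> (real vec \<Rightarrow> real) \<Rightarrow> bool" where
  "symmetric_gauge q \<Phi> \<longleftrightarrow> norm_on q \<Phi> \<and>
     (\<forall>x \<in> carrier_vec q. \<forall>\<sigma>. \<sigma> permutes {..<q} \<longrightarrow> \<Phi> x = \<Phi> (vec q (\<lambda>i. \<bar>x $ \<sigma> i\<bar>)))"

definition strictly_convex_gauge :: "nat \<Rightarrow> (real vec \<Rightarrow> real) \<Rightarrow> bool" where
  "strictly_convex_gauge q \<Phi> \<longleftrightarrow>
     (\<forall>x \<in> carrier_vec q. \<forall>y \<in> carrier_vec q. \<forall>t.
        x \<noteq> y \<longrightarrow> \<Phi> x = 1 \<longrightarrow> \<Phi> y = 1 \<longrightarrow> 0 < t \<longrightarrow> t < 1 \<longrightarrow>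
        \<Phi> (t \<cdot>\<^sub>v x + (1 - t) \<cdot>\<^sub>v y) < 1)"

definition gauge_norm :: "(real vec \<Rightarrow> real) \<Rightarrow> complex mat \<Rightarrow> real" where
  "gauge_norm \<Phi> F = \<Phi> (vec (min (dim_row F) (dim_col F)) (\<lambda>i. sing_val F (i + 1)))"

definition minimizers ::
    "(real vec \<Rightarrow> real) \<Rightarrow> nat \<Rightarrow> nat \<Rightarrow> nat \<Rightarrow> complex mat \<Rightarrow> complex mat set" where
  "minimizers \<Phi> m n k F =
     {X. is_arg_min (\<lambda>X. gauge_norm \<Phi> (F - X)) (\<lambda>X. X \<in> partial_isometries m n k) X}"

end

theory Submission
  imports Defs
begin

text \<open>
  Write \<open>q = min m n\<close> and let \<open>s\<^sub>1 \<ge> \<dots> \<ge> s\<^sub>q\<close> be the singular values of \<open>F\<close>. A partial isometry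
  \<open>X\<close> of rank \<open>k\<close> has \<open>k\<close> singular values \<open>1\<close> and the others are \<open>0\<close>.

  Lower bound. By the inequality of Mirsky (\<open>singular_value_perturbation\<close>) every sum of \<open>j\<close> of the
  numbers \<open>\<bar>s\<^sub>i(F) - s\<^sub>i(X)\<bar>\<close> is at most the sum of the \<open>j\<close> largest singular values of \<open>F - X\<close>. It
  follows from Lidskii's inequality for Hermitian matrices, applied to the dilations of \<open>F\<close> and
  \<open>X\<close>, whose eigenvalues are the singular values and their negatives. A symmetric gauge function
  is monotone under this weak majorization (\<open>gauge_weak_majorization\<close>), which bounds the norm of
  \<open>F - X\<close> from below by \<open>\<Phi>(\<bar>s\<^sub>i - 1\<bar> for i \<le> k, s\<^sub>i for i > k)\<close>. The bound is attained by
  \<open>X = V (I\<^sub>k \<oplus> 0) W\<^sup>*\<close> for every singular value decomposition \<open>F = V \<Sigma> W\<^sup>*\<close>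
  (\<open>aligned_minimizer\<close>).

  Equality. Strict convexity makes the gauge strictly monotone, so for a minimizer the two vectors
  agree up to order and in particular have the same sum of squares. Thus \<open>X\<close> is also optimal for the
  Frobenius norm, where optimality is the linear condition \<open>Re tr(X\<^sup>* F) = s\<^sub>1 + \<dots> + s\<^sub>k\<close>
  (\<open>minimizer_trace\<close>). In the singular bases, with \<open>Y = V\<^sup>* X W\<close> and the projections \<open>Q = Y\<^sup>* Y\<close>
  and \<open>R = Y Y\<^sup>*\<close>, the identity
  \<open>2 Re Y\<^sub>i\<^sub>i = Q\<^sub>i\<^sub>i + R\<^sub>i\<^sub>i - \<parallel>Y e\<^sub>i - R e\<^sub>i\<parallel>\<^sup>2\<close> turns this condition into a statement about the weights
  \<open>t\<^sub>i = (Q\<^sub>i\<^sub>i + R\<^sub>i\<^sub>i) / 2 \<in> [0, 1]\<close> of total mass at most \<open>k\<close>: they are \<open>1\<close> where \<open>s\<^sub>i > s\<^sub>k\<close> and \<open>0\<close>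
  where \<open>s\<^sub>i < s\<^sub>k\<close>, and \<open>Y e\<^sub>i = R e\<^sub>i\<close> where \<open>s\<^sub>i > 0\<close>. If \<open>s\<^sub>k > 0\<close>, the only freedom left in \<open>Y\<close>
  is a block on the indices with \<open>s\<^sub>i = s\<^sub>k\<close>, on which \<open>Y = R\<close> is a projection (\<open>tie_block_form\<close>);
  if \<open>s\<^sub>k = 0\<close>, it is a partial isometry on the indices beyond the rank of \<open>F\<close> (\<open>zero_block_form\<close>).

  Conversely, each such block is obtained from \<open>I\<^sub>k \<oplus> 0\<close> by a unitary change of the singular bases
  that preserves \<open>\<Sigma>\<close>, so that all these \<open>X\<close> are minimizers (\<open>rotated_minimizer\<close>). The assertions on
  uniqueness are read off from the ranks and sizes of the blocks.\<close>

section \<open>Adjoints, unitary matrices and diagonal blocks\<close>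

abbreviation adj :: "complex mat \<Rightarrow> complex mat" where
  "adj \<equiv> mat_adjoint"

lemma dim_adjoint [simp]:
  "dim_row (adj A) = dim_col A" "dim_col (adj A) = dim_row A"
  by (simp_all add: mat_adjoint_def)

lemma adjoint_carrier [simp]: "A \<in> carrier_mat m n \<Longrightarrow> adj A \<in> carrier_mat n m"
  by (auto intro: carrier_matI)

lemma index_adjoint [simp]:
  fixes A :: "complex mat"
  shows "i < dim_col A \<Longrightarrow> j < dim_row A \<Longrightarrow> adj A $$ (i, j) = cnj (A $$ (j, i))"
  by (simp add: mat_adjoint_def mat_of_rows_def)

lemma adjoint_adjoint [simp]:
  fixes A :: "complex mat"
  shows "adj (adj A) = A"
  by (rule eq_matI) auto

lemma adjoint_mult:
  fixes A :: "complex mat"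
  shows "dim_col A = dim_row B \<Longrightarrow> adj (A * B) = adj B * adj A"
  by (rule eq_matI) (auto simp: scalar_prod_def mult.commute intro!: sum.cong)

lemma adjoint_one [simp]: "adj (1\<^sub>m n :: complex mat) = 1\<^sub>m n"
  by (rule eq_matI) auto

text \<open>Associativity and cancellation conditioned on dimensions rather than on carriers: the simplifier
  can discharge these premises, and right-nested products reach a normal form.\<close>

lemma mult_assoc_dim:
  fixes A B C :: "complex mat"
  shows "dim_col A = dim_row B \<Longrightarrow> dim_col B = dim_row C \<Longrightarrow> A * B * C = A * (B * C)"
  by (rule assoc_mult_mat[of _ "dim_row A" "dim_row B" _ "dim_row C" _ "dim_col C"]) (auto)

lemma mult_minus_dim:
  fixes A B C :: "complex mat"
  shows "dim_col A = dim_row B \<Longrightarrow> dim_row B = dim_row C \<Longrightarrow> dim_col B = dim_col C \<Longrightarrow>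
    A * (B - C) = A * B - A * C"
    and "dim_col B = dim_row A \<Longrightarrow> dim_row B = dim_row C \<Longrightarrow> dim_col B = dim_col C \<Longrightarrow>
    (B - C) * A = B * A - C * A"
  by (rule mult_minus_distrib_mat[of _ "dim_row A" "dim_row B" _ "dim_col B"];
      auto intro: carrier_matI)
     (rule minus_mult_distrib_mat[of _ "dim_row B" "dim_row A" _ _ "dim_col A"];
      auto intro: carrier_matI)

lemma one_mult_dim [simp]:
  fixes A :: "complex mat"
  shows "dim_row A = n \<Longrightarrow> 1\<^sub>m n * A = A" "dim_col A = n \<Longrightarrow> A * 1\<^sub>m n = A"
  by (auto intro: left_mult_one_mat right_mult_one_mat)

lemma index_mult_sum:
  fixes A B :: "complex mat"
  assumes "i < dim_row A" "j < dim_col B" "dim_col A = dim_row B"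
  shows "(A * B) $$ (i, j) = (\<Sum>l\<in>{0..<dim_row B}. A $$ (i, l) * B $$ (l, j))"
  using assms by (simp add: scalar_prod_def)

lemma mult_vec_assoc_dim:
  fixes A B :: "complex mat"
  shows "dim_col A = dim_row B \<Longrightarrow> dim_col B = dim_vec v \<Longrightarrow> A * B *\<^sub>v v = A *\<^sub>v (B *\<^sub>v v)"
  by (rule assoc_mult_mat_vec[of _ "dim_row A" "dim_row B" _ "dim_vec v"]) (auto)

lemma unitaryD:
  assumes "unitary_mat n U"
  shows "U \<in> carrier_mat n n" "dim_row U = n" "dim_col U = n"
    "adj U * U = 1\<^sub>m n" "U * adj U = 1\<^sub>m n"
    "\<And>X. dim_row X = n \<Longrightarrow> adj U * (U * X) = X"
    "\<And>X. dim_row X = n \<Longrightarrow> U * (adj U * X) = X"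
proof -
  show *: "U \<in> carrier_mat n n" "dim_row U = n" "dim_col U = n"
    "adj U * U = 1\<^sub>m n" "U * adj U = 1\<^sub>m n"
    using assms by (auto simp: unitary_mat_def)
  show "adj U * (U * X) = X" if "dim_row X = n" for X
    using that * by (simp add: mult_assoc_dim[symmetric])
  show "U * (adj U * X) = X" if "dim_row X = n" for X
    using that * by (simp add: mult_assoc_dim[symmetric])
qed

text \<open>For square matrices a one-sided inverse is two-sided.\<close>

lemma unitaryI:
  assumes "U \<in> carrier_mat n n" "adj U * U = 1\<^sub>m n"
  shows "unitary_mat n U"
  using assms mat_mult_left_right_inverse[of "adj U" n U]
  by (auto simp: unitary_mat_def)

lemma unitary_one: "unitary_mat n (1\<^sub>m n)"
  by (rule unitaryI) auto

lemma unitary_adjoint: "unitary_mat n U \<Longrightarrow> unitary_mat n (adj U)"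
  by (auto simp: unitary_mat_def)

lemma unitary_mult:
  assumes "unitary_mat n U" "unitary_mat n V"
  shows "unitary_mat n (U * V)"
  using unitaryD[OF assms(1)] unitaryD[OF assms(2)]
  by (intro unitaryI) (simp_all add: adjoint_mult mult_assoc_dim)

definition bdiag :: "complex mat \<Rightarrow> complex mat \<Rightarrow> complex mat" where
  "bdiag A B = four_block_mat A (0\<^sub>m (dim_row A) (dim_col B)) (0\<^sub>m (dim_row B) (dim_col A)) B"

lemma dim_bdiag [simp]:
  "dim_row (bdiag A B) = dim_row A + dim_row B" "dim_col (bdiag A B) = dim_col A + dim_col B"
  by (simp_all add: bdiag_def)

lemma index_bdiag:
  "i < dim_row A + dim_row B \<Longrightarrow> j < dim_col A + dim_col B \<Longrightarrow> bdiag A B $$ (i, j) =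
    (if i < dim_row A then if j < dim_col A then A $$ (i, j) else 0
     else if j < dim_col A then 0 else B $$ (i - dim_row A, j - dim_col A))"
  by (auto simp: bdiag_def)

lemma bdiag_carrier: "A \<in> carrier_mat a b \<Longrightarrow> B \<in> carrier_mat c d \<Longrightarrow>
    bdiag A B \<in> carrier_mat (a + c) (b + d)"
  by (auto intro: carrier_matI)

lemma bdiag_mult:
  assumes "dim_col A = dim_row C" "dim_col B = dim_row D"
  shows "bdiag A B * bdiag C D = bdiag (A * C) (B * D)"
proof -
  have "bdiag A B * bdiag C D = four_block_mat
     (A * C + 0\<^sub>m (dim_row A) (dim_col B) * 0\<^sub>m (dim_row D) (dim_col C))
     (A * 0\<^sub>m (dim_row C) (dim_col D) + 0\<^sub>m (dim_row A) (dim_col B) * D)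
     (0\<^sub>m (dim_row B) (dim_col A) * C + B * 0\<^sub>m (dim_row D) (dim_col C))
     (0\<^sub>m (dim_row B) (dim_col A) * 0\<^sub>m (dim_row C) (dim_col D) + B * D)"
    unfolding bdiag_def
    by (rule mult_four_block_mat[of _ "dim_row A" "dim_col A" _ "dim_col B" _ "dim_row B" _ _ "dim_col C" _ "dim_col D"])
       (use assms in auto)
  also have "\<dots> = bdiag (A * C) (B * D)"
    unfolding bdiag_def using assms by (intro cong_four_block_mat) auto
  finally show ?thesis .
qed

lemma bdiag_adjoint: "adj (bdiag A B) = bdiag (adj A) (adj B)"
  by (rule eq_matI) (auto simp: index_bdiag)

lemma bdiag_one: "bdiag (1\<^sub>m a) (1\<^sub>m b) = 1\<^sub>m (a + b)"
  by (rule eq_matI) (auto simp: index_bdiag)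

lemma bdiag_unitary:
  assumes "unitary_mat a U" "unitary_mat b V"
  shows "unitary_mat (a + b) (bdiag U V)"
  using unitaryD[OF assms(1)] unitaryD[OF assms(2)]
  by (intro unitaryI) (simp_all add: bdiag_adjoint bdiag_mult bdiag_one bdiag_carrier)

lemma bdiag_inject:
  assumes "bdiag A B = bdiag C D" "dim_row A = dim_row C" "dim_col A = dim_col C"
    "dim_row B = dim_row D" "dim_col B = dim_col D"
  shows "A = C" "B = D"
proof -
  have *: "bdiag A B $$ (i, j) = bdiag C D $$ (i, j)" for i j using assms(1) by simp
  show "A = C"
  proof (rule eq_matI)
    fix i j assume "i < dim_row C" "j < dim_col C"
    then show "A $$ (i, j) = C $$ (i, j)" using *[of i j] assms(2-) by (simp add: index_bdiag)
  qed (use assms in auto)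
  show "B = D"
  proof (rule eq_matI)
    fix i j assume "i < dim_row D" "j < dim_col D"
    then show "B $$ (i, j) = D $$ (i, j)"
      using *[of "dim_row C + i" "dim_col C + j"] assms(2-) by (simp add: index_bdiag)
  qed (use assms in auto)
qed

definition rdiag :: "nat \<Rightarrow> nat \<Rightarrow> (nat \<Rightarrow> real) \<Rightarrow> complex mat" where
  "rdiag m n d = mat m n (\<lambda>(i, j). if i = j then complex_of_real (d i) else 0)"

lemma rdiag_carrier [simp]: "rdiag m n d \<in> carrier_mat m n"
  by (simp add: rdiag_def)

lemma dim_rdiag [simp]: "dim_row (rdiag m n d) = m" "dim_col (rdiag m n d) = n"
  by (simp_all add: rdiag_def)

lemma index_rdiag [simp]:
  "i < m \<Longrightarrow> j < n \<Longrightarrow> rdiag m n d $$ (i, j) = (if i = j then complex_of_real (d i) else 0)"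
  by (simp add: rdiag_def)

lemma rdiag_cong: "(\<And>i. i < m \<Longrightarrow> i < n \<Longrightarrow> d i = e i) \<Longrightarrow> rdiag m n d = rdiag m n e"
  by (rule eq_matI) auto

lemma rdiag_adjoint [simp]: "adj (rdiag m n d) = rdiag n m d"
  by (rule eq_matI) auto

lemma mult_rdiag_index:
  assumes "dim_col A = m" "i < dim_row A" "j < n"
  shows "(A * rdiag m n d) $$ (i, j) = (if j < m then A $$ (i, j) * complex_of_real (d j) else 0)"
proof -
  have "(A * rdiag m n d) $$ (i, j) = (\<Sum>l\<in>{0..<m}. A $$ (i, l) * rdiag m n d $$ (l, j))"
    using assms index_mult_sum[of i A j "rdiag m n d"] by simp
  also have "\<dots> = (\<Sum>l\<in>{0..<m}. if l = j then A $$ (i, j) * complex_of_real (d j) else 0)"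
    using assms by (intro sum.cong) auto
  also have "\<dots> = (if j < m then A $$ (i, j) * complex_of_real (d j) else 0)"
    by (subst sum.delta) auto
  finally show ?thesis .
qed

lemma rdiag_mult: "rdiag m n d * rdiag n p e = rdiag m p (\<lambda>i. if i < n then d i * e i else 0)"
  by (rule eq_matI) (auto simp: mult_rdiag_index simp del: index_mult_mat(1))

lemma rdiag_minus: "rdiag m n d - rdiag m n e = rdiag m n (\<lambda>i. d i - e i)"
  by (rule eq_matI) auto

lemma rdiag_one: "rdiag n n (\<lambda>i. 1) = 1\<^sub>m n"
  by (rule eq_matI) auto

lemma rdiag_inject: "rdiag m n d = rdiag m n e \<Longrightarrow> i < m \<Longrightarrow> i < n \<Longrightarrow> d i = e i"
  by (metis index_rdiag of_real_eq_iff)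

lemma bdiag_rdiag:
  "bdiag (rdiag a a d) (rdiag b c e) =
    rdiag (a + b) (a + c) (\<lambda>i. if i < a then d i else e (i - a))"
  by (rule eq_matI) (auto simp: index_bdiag)

section \<open>Inner products\<close>

definition sqn :: "complex vec \<Rightarrow> real" where
  "sqn v = (\<Sum>i<dim_vec v. (cmod (v $ i))\<^sup>2)"

lemma sqn_nonneg [simp]: "0 \<le> sqn v"
  by (simp add: sqn_def sum_nonneg)

lemma cscalar_sum:
  fixes v w :: "complex vec"
  shows "v \<bullet>c w = (\<Sum>i<dim_vec w. v $ i * cnj (w $ i))"
  by (simp add: scalar_prod_def atLeast0LessThan)

lemma cscalar_self: "v \<bullet>c v = complex_of_real (sqn v)"
  unfolding cscalar_sum sqn_def of_real_sum
  by (intro sum.cong refl) (simp add: complex_norm_square[symmetric])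

lemma sqn_eq_0: "sqn v = 0 \<longleftrightarrow> v = 0\<^sub>v (dim_vec v)"
  by (auto simp: sqn_def sum_nonneg_eq_0_iff vec_eq_iff)

lemma vec_norm2_sq: "vec_norm2 v = sqrt (sqn v)"
  by (simp add: vec_norm2_def sqn_def L2_set_def)

lemma vec_norm2_eq: "vec_norm2 v = vec_norm2 w \<longleftrightarrow> sqn v = sqn w"
  by (simp add: vec_norm2_sq)

lemma cscalar_sym:
  fixes v w :: "complex vec"
  assumes "dim_vec v = dim_vec w"
  shows "cnj (v \<bullet>c w) = w \<bullet>c v"
  using assms unfolding cscalar_sum by (simp add: mult.commute)

lemma cscalar_adjoint:
  fixes A :: "complex mat"
  assumes "dim_col A = dim_vec v" "dim_row A = dim_vec w"
  shows "(A *\<^sub>v v) \<bullet>c w = v \<bullet>c (adj A *\<^sub>v w)"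
proof -
  have "(A *\<^sub>v v) \<bullet>c w = (\<Sum>i<dim_vec w. \<Sum>j<dim_vec v. A $$ (i, j) * v $ j * cnj (w $ i))"
    using assms unfolding cscalar_sum
    by (auto simp: scalar_prod_def atLeast0LessThan sum_distrib_right intro!: sum.cong)
  also have "\<dots> = (\<Sum>j<dim_vec v. \<Sum>i<dim_vec w. A $$ (i, j) * v $ j * cnj (w $ i))"
    by (rule sum.swap)
  also have "\<dots> = v \<bullet>c (adj A *\<^sub>v w)"
    using assms unfolding cscalar_sum
    by (auto simp: scalar_prod_def atLeast0LessThan sum_distrib_left mult_ac intro!: sum.cong)
  finally show ?thesis .
qed

lemma sqn_mult:
  fixes A :: "complex mat"
  assumes "dim_col A = dim_vec v"
  shows "complex_of_real (sqn (A *\<^sub>v v)) = ((adj A * A) *\<^sub>v v) \<bullet>c v"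
proof -
  have "((adj A * A) *\<^sub>v v) \<bullet>c v = (adj A *\<^sub>v (A *\<^sub>v v)) \<bullet>c v"
    using assms by (simp add: mult_vec_assoc_dim)
  also have "\<dots> = (A *\<^sub>v v) \<bullet>c (A *\<^sub>v v)"
    using assms by (subst cscalar_adjoint) auto
  finally show ?thesis by (simp add: cscalar_self)
qed

lemma one_mult_vec_dim [simp]: "dim_vec v = n \<Longrightarrow> 1\<^sub>m n *\<^sub>v v = (v :: complex vec)"
  by (auto intro: one_mult_mat_vec)

lemma sqn_unitary:
  assumes "unitary_mat n U" "dim_vec v = n"
  shows "sqn (U *\<^sub>v v) = sqn v"
proof -
  have "complex_of_real (sqn (U *\<^sub>v v)) = v \<bullet>c v"
    using sqn_mult[of U v] unitaryD[OF assms(1)] assms(2) by simp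
  then show ?thesis by (simp add: cscalar_self)
qed

lemma entry_mult_adjoint_self:
  fixes A :: "complex mat"
  assumes "i < dim_col A"
  shows "(adj A * A) $$ (i, i) = complex_of_real (sqn (col A i))"
  using assms by (simp add: cscalar_self[symmetric] cscalar_sum scalar_prod_def atLeast0LessThan mult.commute)

lemma entry_adjoint_mult:
  fixes A B :: "complex mat"
  assumes "i < dim_col A" "j < dim_col B" "dim_row A = dim_row B"
  shows "(adj A * B) $$ (i, j) = col B j \<bullet>c col A i"
  using assms by (simp add: cscalar_sum scalar_prod_def atLeast0LessThan mult.commute)

section \<open>The spectral theorem\<close>

lemma unitary_with_first_col:
  assumes v: "v \<in> carrier_vec n" "v \<noteq> 0\<^sub>v n"
  obtains U c where "unitary_mat n U" "col U 0 = c \<cdot>\<^sub>v v"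
proof -
  interpret cof_vec_space n "TYPE(complex)" .
  note bc = basis_completion[OF v]
  define ws where "ws = gram_schmidt n (basis_completion v)"
  note gs = gram_schmidt_result(2-4)[OF bc(2,4,5) ws_def]
  have ws: "corthogonal ws" "set ws \<subseteq> carrier_vec n" "length ws = n"
    using gs bc(6) by simp_all
  have n: "0 < n" 
  proof (rule ccontr)
    assume "\<not> 0 < n"
    then have "v = 0\<^sub>v n" using v(1) by auto
    with v(2) show False by simp
  qed
  obtain b where b: "basis_completion v = v # b"
    using bc(6,7) n by (cases "basis_completion v") auto
  have "hd ws = v"
    unfolding ws_def b by (rule gram_schmidt_hd[OF v(1)])
  with ws(3) n have ws0: "ws ! 0 = v"
    by (cases ws) auto
  have dim: "dim_vec (ws ! j) = n" if "j < n" for j using ws(2,3) nth_mem[of j ws] that by (intro carrier_vecD) blast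
  have orth: "ws ! i \<bullet>c ws ! j = 0 \<longleftrightarrow> i \<noteq> j" if "i < n" "j < n" for i j
    using corthogonalD[OF ws(1)] ws(3) that by auto
  have pos: "sqn (ws ! j) > 0" if "j < n" for j
    using orth[OF that that] sqn_nonneg[of "ws ! j"] by (auto simp: cscalar_self less_le)
  \<comment> \<open>Gram-Schmidt yields orthogonal columns; they remain to be normalized.\<close>
  define U where "U = mat n n (\<lambda>(i, j). ws ! j $ i / complex_of_real (sqrt (sqn (ws ! j))))"
  have Uc: "U \<in> carrier_mat n n" by (simp add: U_def)
  have colU: "col U j = complex_of_real (1 / sqrt (sqn (ws ! j))) \<cdot>\<^sub>v (ws ! j)" if "j < n" for j
    using that dim[OF that] by (auto simp: U_def)
  have "adj U * U = 1\<^sub>m n"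
  proof (rule eq_matI)
    fix i j assume "i < dim_row (1\<^sub>m n :: complex mat)" "j < dim_col (1\<^sub>m n :: complex mat)"
    then have ij: "i < n" "j < n" by auto
    have "(adj U * U) $$ (i, j) = col U j \<bullet>c col U i"
      using ij Uc by (intro entry_adjoint_mult) auto
    also have "\<dots> = (ws ! j \<bullet>c ws ! i) / complex_of_real (sqrt (sqn (ws ! j)) * sqrt (sqn (ws ! i)))"
      using ij dim by (simp add: colU cscalar_sum sum_divide_distrib mult_ac)
    also have "\<dots> = (1\<^sub>m n) $$ (i, j)"
    proof (cases "i = j")
      case True
      then show ?thesis using pos[OF ij(1)] ij by (simp add: cscalar_self)
    qed (use orth[OF ij(2,1)] ij in simp)
    finally show "(adj U * U) $$ (i, j) = (1\<^sub>m n) $$ (i, j)" .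
  qed (use Uc in auto)
  with Uc have "unitary_mat n U" by (intro unitaryI)
  moreover have "col U 0 = complex_of_real (1 / sqrt (sqn (ws ! 0))) \<cdot>\<^sub>v v"
    using colU[OF n] by (simp add: ws0)
  ultimately show thesis using that by blast
qed

text \<open>Deflation: an eigenvector is completed to an orthonormal basis, in which a Hermitian matrix
  splits off a block of size one. The prescribed list of eigenvalues fixes their order.\<close>

lemma hermitian_diagonalization_list:
  assumes "A \<in> carrier_mat n n" "adj A = A"
    "char_poly A = (\<Prod>e\<leftarrow>es. [:- e, 1:])" "length es = n"
  shows "\<exists>U. unitary_mat n U \<and> A = U * mat_diag n (\<lambda>i. es ! i) * adj U"
  using assms
proof (induction es arbitrary: A n)
  case Nil
  have "A = 1\<^sub>m 0 * mat_diag 0 (\<lambda>i. [] ! i) * adj (1\<^sub>m 0)"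
    using Nil by (intro eq_matI) auto
  then show ?case using Nil unitary_one[of 0] by auto
next
  case (Cons e es)
  then obtain k where n: "n = Suc k" and k: "length es = k" by auto
  note A = Cons.prems(1)
  have "poly (char_poly A) e = 0" using Cons.prems(3) by simp
  then obtain v where "eigenvector A v e"
    using eigenvalue_root_char_poly[OF A] by (auto simp: eigenvalue_def)
  then have v: "v \<in> carrier_vec n" "v \<noteq> 0\<^sub>v n" "A *\<^sub>v v = e \<cdot>\<^sub>v v"
    using A by (auto simp: eigenvector_def)
  obtain U c where U: "unitary_mat n U" "col U 0 = c \<cdot>\<^sub>v v"
    using unitary_with_first_col[OF v(1,2)] .
  note uU = unitaryD[OF U(1)]
  define B where "B = adj U * A * U"
  have B: "B \<in> carrier_mat n n" using A uU by (auto simp: B_def)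
  have Bh: "adj B = B"
    using A uU Cons.prems(2) by (simp add: B_def adjoint_mult mult_assoc_dim)
  have "A *\<^sub>v col U 0 = e \<cdot>\<^sub>v col U 0"
    using v A unfolding U(2) by (simp add: mult_mat_vec[of _ n n] smult_smult_assoc mult.commute)
  then have "col (A * U) 0 = e \<cdot>\<^sub>v col U 0" using A uU(1) n by (subst col_mult2[of _ n n _ n]) auto
  then have "col B 0 = adj U *\<^sub>v (e \<cdot>\<^sub>v col U 0)"
    using A uU n unfolding B_def
    by (simp add: mult_assoc_dim col_mult2[of _ n n _ n])
  also have "\<dots> = e \<cdot>\<^sub>v col (adj U * U) 0"
  proof -
    have "0 < n" using n by simp
    then have "col (adj U * U) 0 = adj U *\<^sub>v col U 0"
      using uU(1) by (intro col_mult2[of _ n n _ n]) simp_all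
    moreover have "adj U *\<^sub>v (e \<cdot>\<^sub>v col U 0) = e \<cdot>\<^sub>v (adj U *\<^sub>v col U 0)"
      by (rule mult_mat_vec[of _ n n]) (use uU(1,2) in \<open>simp_all add: carrier_vecI\<close>)
    ultimately show ?thesis by simp
  qed
  finally have col0: "col B 0 = e \<cdot>\<^sub>v unit_vec n 0" using uU n by simp
  have B0: "B $$ (i, 0) = (if i = 0 then e else 0)" if "i < n" for i
    using arg_cong[OF col0, of "\<lambda>x. x $ i"] that B n by auto
  have B0': "B $$ (0, j) = 0" if "0 < j" "j < n" for j
  proof -
    have "B $$ (0, j) = adj B $$ (0, j)" by (simp add: Bh)
    also have "\<dots> = cnj (B $$ (j, 0))" using that B by (intro index_adjoint) auto
    finally show ?thesis using B0[of j] that by simp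
  qed
  define C where "C = mat k k (\<lambda>(i, j). B $$ (Suc i, Suc j))"
  define E where "E = mat 1 1 (\<lambda>_. e)"
  have C: "C \<in> carrier_mat k k" and E: "E \<in> carrier_mat 1 1" by (auto simp: C_def E_def)
  have BC: "B = bdiag E C"
  proof (rule eq_matI)
    fix i j assume "i < dim_row (bdiag E C)" "j < dim_col (bdiag E C)"
    then have "i < n" "j < n" using n by (auto simp: C_def E_def)
    then show "B $$ (i, j) = bdiag E C $$ (i, j)"
      using B0 B0' n by (cases i; cases j) (auto simp: index_bdiag C_def E_def)
  qed (use B n in \<open>auto simp: C_def E_def\<close>)
  have "adj C = C"
  proof (rule eq_matI)
    fix i j assume ij: "i < dim_row C" "j < dim_col C"
    have "adj B $$ (Suc i, Suc j) = cnj (B $$ (Suc j, Suc i))"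
      using ij B n by (intro index_adjoint) (auto simp: C_def)
    then show "adj C $$ (i, j) = C $$ (i, j)"
      using ij by (simp add: Bh) (simp add: C_def)
  qed (auto simp: C_def)
  moreover have "char_poly C = (\<Prod>e\<leftarrow>es. [:- e, 1:])"
  proof -
    have "char_poly A = char_poly B"
      by (rule char_poly_similar, unfold similar_mat_def, rule exI[of _ U],
          rule exI[of _ "adj U"], rule similar_mat_witI[of _ _ n])
         (use A B uU in \<open>auto simp: B_def mult_assoc_dim\<close>)
    also have "\<dots> = char_poly E * char_poly C"
      using char_poly_four_block_zeros_col[OF E _ C, of "0\<^sub>m 1 k"] E C
      unfolding BC bdiag_def by simp
    also have "char_poly E = [:- e, 1:]"
      by (simp add: E_def char_poly_defs det_def sign_def)
    finally have "[:- e, 1:] * char_poly C = [:- e, 1:] * (\<Prod>e\<leftarrow>es. [:- e, 1:])"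
      using Cons.prems(3) by simp
    then show ?thesis by (simp only: mult_cancel_left) auto
  qed
  ultimately obtain T where T: "unitary_mat k T" "C = T * mat_diag k (\<lambda>i. es ! i) * adj T"
    using Cons.IH[OF C _ _ k] by auto
  note uT = unitaryD[OF T(1)]
  define S where "S = U * bdiag (1\<^sub>m 1) T"
  have D: "mat_diag n (\<lambda>i. (e # es) ! i) = bdiag E (mat_diag k (\<lambda>i. es ! i))"
    by (rule eq_matI) (auto simp: n index_bdiag E_def mat_diag_def nth_Cons')
  have b: "bdiag (1\<^sub>m 1) T * bdiag E (mat_diag k (\<lambda>i. es ! i)) * adj (bdiag (1\<^sub>m 1) T) = B"
    using uT E by (simp add: BC T(2) bdiag_adjoint bdiag_mult mat_diag_def)
  have "unitary_mat n S"
    unfolding S_def using bdiag_unitary[OF unitary_one T(1), of 1] U(1) n by (intro unitary_mult) auto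
  moreover have "A = S * mat_diag n (\<lambda>i. (e # es) ! i) * adj S"
  proof -
    have dims: "dim_row E = 1" "dim_col E = 1" using E by auto
    have "S * mat_diag n (\<lambda>i. (e # es) ! i) * adj S = U * B * adj U"
      unfolding b[symmetric] D S_def using uU uT n dims
      by (simp add: adjoint_mult mult_assoc_dim mat_diag_def)
    also have "\<dots> = A" using uU A by (simp add: B_def mult_assoc_dim)
    finally show ?thesis by simp
  qed
  ultimately show ?case by blast
qed

text \<open>The list of roots is sorted before the diagonalization, so the eigenvalues come out in decreasing
  order; they are real as the diagonal of a Hermitian matrix.\<close>

lemma hermitian_diagonalization:
  assumes A: "A \<in> carrier_mat n n" and h: "adj A = A"
  obtains U d where "unitary_mat n U" "A = U * rdiag n n d * adj U"
    "\<And>i j. i \<le> j \<Longrightarrow> j < n \<Longrightarrow> d j \<le> d i"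
proof -
  obtain as where as: "char_poly A = (\<Prod>a\<leftarrow>as. [:- a, 1:])" "length as = n"
    using char_poly_factorized[OF A] by auto
  define es where "es = rev (sort_key Re as)"
  have "mset (map (\<lambda>a. [:- a, 1:]) es) = mset (map (\<lambda>a. [:- a, 1:]) as)"
    by (simp add: es_def)
  then have "char_poly A = (\<Prod>a\<leftarrow>es. [:- a, 1:])"
    unfolding as(1) by (metis prod_mset_prod_list)
  moreover have len: "length es = n" by (simp add: es_def as)
  ultimately obtain U where U: "unitary_mat n U" "A = U * mat_diag n (\<lambda>i. es ! i) * adj U"
    using hermitian_diagonalization_list[OF A h] by blast
  note uU = unitaryD[OF U(1)]
  let ?D = "mat_diag n (\<lambda>i. es ! i)"
  have "?D = adj U * A * U"
    unfolding U(2) using uU by (simp add: mult_assoc_dim mat_diag_def)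
  then have "adj ?D = ?D"
    using uU A h by (simp add: adjoint_mult mult_assoc_dim)
  then have real: "es ! i = complex_of_real (Re (es ! i))" if "i < n" for i
    using that index_adjoint[of i ?D i] by (simp add: mat_diag_def complex_eq_iff)
  define d where "d i = Re (es ! i)" for i
  have "?D = rdiag n n d"
    by (rule eq_matI) (use real in \<open>auto simp: mat_diag_def d_def\<close>)
  moreover have "d j \<le> d i" if "i \<le> j" "j < n" for i j
  proof -
    have "sorted (map Re (sort_key Re as))" by simp
    then have "map Re (sort_key Re as) ! (n - Suc j) \<le> map Re (sort_key Re as) ! (n - Suc i)"
      by (rule sorted_nth_mono) (use that as in auto)
    then show ?thesis using that as by (simp add: d_def es_def rev_nth)
  qed
  ultimately show thesis using that U by metis
qed

section \<open>Existence of singular value decompositions\<close>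

lemma trace_mult_comm:
  fixes A B :: "complex mat"
  assumes "A \<in> carrier_mat m n" "B \<in> carrier_mat n m"
  shows "(\<Sum>i<m. (A * B) $$ (i, i)) = (\<Sum>j<n. (B * A) $$ (j, j))"
proof -
  have "(\<Sum>i<m. (A * B) $$ (i, i)) = (\<Sum>i<m. \<Sum>j<n. A $$ (i, j) * B $$ (j, i))"
    using assms by (auto simp: scalar_prod_def atLeast0LessThan intro!: sum.cong)
  also have "\<dots> = (\<Sum>j<n. \<Sum>i<m. A $$ (i, j) * B $$ (j, i))" by (rule sum.swap)
  also have "\<dots> = (\<Sum>j<n. (B * A) $$ (j, j))"
    using assms by (auto simp: scalar_prod_def atLeast0LessThan mult.commute intro!: sum.cong)
  finally show ?thesis .
qed

lemma trace_conj_rdiag: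
  assumes "unitary_mat n U"
  shows "(\<Sum>i<n. (U * rdiag n n d * adj U) $$ (i, i)) = complex_of_real (\<Sum>i<n. d i)"
proof -
  note u = unitaryD[OF assms]
  have "(\<Sum>i<n. (U * rdiag n n d * adj U) $$ (i, i)) =
      (\<Sum>i<n. (adj U * (U * rdiag n n d)) $$ (i, i))"
    by (rule trace_mult_comm) (use u in auto)
  also have "\<dots> = (\<Sum>i<n. complex_of_real (d i))"
    using u by (intro sum.cong) auto
  finally show ?thesis by simp
qed

lemma conj_rdiag_inject:
  assumes "unitary_mat m V" "unitary_mat n W"
    "V * rdiag m n d * adj W = V * rdiag m n e * adj W" "i < m" "i < n"
  shows "d i = e i"
proof -
  note uV = unitaryD[OF assms(1)] and uW = unitaryD[OF assms(2)]
  have "adj V * (V * rdiag m n d * adj W) * W =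
      adj V * (V * rdiag m n e * adj W) * W" by (simp add: assms(3))
  then have "rdiag m n d = rdiag m n e" using uV uW by (simp add: mult_assoc_dim)
  then show ?thesis using assms(4,5) by (rule rdiag_inject)
qed

lemma decreasing_zero_one:
  fixes d :: "nat \<Rightarrow> real"
  assumes "\<And>i j. i \<le> j \<Longrightarrow> j < n \<Longrightarrow> d j \<le> d i" "\<And>i. i < n \<Longrightarrow> d i = 0 \<or> d i = 1"
  obtains j where "j \<le> n" "\<And>i. i < n \<Longrightarrow> d i = (if i < j then 1 else 0)"
proof (cases "\<exists>i<n. d i = 0")
  case True
  define j where "j = (LEAST i. i < n \<and> d i = 0)"
  have j: "j < n" "d j = 0" using LeastI_ex[of "\<lambda>i. i < n \<and> d i = 0"] True by (auto simp: j_def)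
  have "d i = (if i < j then 1 else 0)" if "i < n" for i
  proof (cases "i < j")
    case True
    then have "d i \<noteq> 0" using not_less_Least[of i "\<lambda>i. i < n \<and> d i = 0"] that by (auto simp: j_def)
    then show ?thesis using assms(2)[OF that] True by auto
  next
    case False
    then have "d i \<le> 0" using assms(1)[of j i] that j by simp
    then show ?thesis using assms(2)[OF that] False by auto
  qed
  with j show thesis by (intro that[of j]) auto
next
  case False
  then show thesis using assms(2) by (intro that[of n]) auto
qed

lemma sum_zero_one: "j \<le> n \<Longrightarrow> (\<Sum>i<n. if i < j then 1 else 0 :: real) = real j"
proof -
  assume "j \<le> n"
  then have "(\<Sum>i<n. if i < j then 1 else 0 :: real) = (\<Sum>i<j. 1)"
    by (intro sum.mono_neutral_cong_right) auto
  then show ?thesis by simp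
qed

text \<open>The spectral decomposition of the projection \<open>T T\<^sup>*\<close> provides an orthonormal basis
  of the orthogonal complement of the range of \<open>T\<close>.\<close>

lemma isometry_extension:
  assumes T: "T \<in> carrier_mat m r" "adj T * T = 1\<^sub>m r"
  obtains V where "unitary_mat m V" "r \<le> m" "\<And>i j. i < m \<Longrightarrow> j < r \<Longrightarrow> V $$ (i, j) = T $$ (i, j)"
proof -
  let ?P = "T * adj T"
  have P: "?P \<in> carrier_mat m m" "adj ?P = ?P"
    using T by (auto simp: adjoint_mult intro: carrier_matI)
  obtain S d where S: "unitary_mat m S" "?P = S * rdiag m m d * adj S"
    and dec: "\<And>i j. i \<le> j \<Longrightarrow> j < m \<Longrightarrow> d j \<le> d i"
    using hermitian_diagonalization[OF P] by blast
  note uS = unitaryD[OF S(1)]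
  have "?P * ?P = T * (adj T * T) * adj T"
    using T(1) by (simp add: mult_assoc_dim)
  then have "?P * ?P = ?P" using T by simp
  moreover have "?P * ?P = S * rdiag m m (\<lambda>i. d i * d i) * adj S"
    unfolding S(2) using uS
    by (simp add: mult_assoc_dim mult_assoc_dim[of "rdiag m m d", symmetric] rdiag_mult)
       (simp add: mult_assoc_dim cong: rdiag_cong)
  ultimately have "d i * d i = d i" if "i < m" for i
    using conj_rdiag_inject[OF S(1) S(1), of "\<lambda>i. d i * d i" d i] S(2) that by simp
  then have "d i = 0 \<or> d i = 1" if "i < m" for i using that by (metis mult_cancel_right1)
  then obtain j where j: "j \<le> m" "\<And>i. i < m \<Longrightarrow> d i = (if i < j then 1 else 0)"
    using decreasing_zero_one[of m d] dec by blast
  have "complex_of_real (\<Sum>i<m. d i) = (\<Sum>i<m. ?P $$ (i, i))"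
    using trace_conj_rdiag[OF S(1), of d] S(2) by simp
  also have "\<dots> = (\<Sum>i<r. (adj T * T) $$ (i, i))"
    by (rule trace_mult_comm) (use T in auto)
  also have "\<dots> = of_nat r" using T(2) by simp
  finally have "(\<Sum>i<m. d i) = real r" by (metis of_real_eq_iff of_real_of_nat_eq)
  moreover have "(\<Sum>i<m. d i) = real j" using j sum_zero_one[OF j(1)] by simp
  ultimately have jr: "j = r" by simp
  have PS: "?P * S = S * rdiag m m d" unfolding S(2) using uS by (simp add: mult_assoc_dim)
  have TS: "col S l \<bullet>c col T i = 0" if "r \<le> l" "l < m" "i < r" for l i
  proof -
    have "adj (adj T * S) * (adj T * S) = adj S * (?P * S)"
      using T(1) uS by (simp add: adjoint_mult mult_assoc_dim)
    also have "\<dots> = rdiag m m d" unfolding PS using uS by simp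
    finally have "complex_of_real (sqn (col (adj T * S) l)) = complex_of_real (d l)"
      using entry_mult_adjoint_self[of l "adj T * S"] uS that by simp
    then have "sqn (col (adj T * S) l) = 0" using j(2)[of l] that jr by simp
    then have "col (adj T * S) l = 0\<^sub>v r" using T(1) uS by (subst (asm) sqn_eq_0) auto
    then have "(adj T * S) $$ (i, l) = 0"
      using that T(1) uS index_col[of i "adj T * S" l] by (simp del: index_mult_mat(1))
    then show ?thesis using entry_adjoint_mult[of i T l S] T(1) uS that by simp
  qed
  define V where "V = mat m m (\<lambda>(i, l). if l < r then T $$ (i, l) else S $$ (i, l))"
  have V: "V \<in> carrier_mat m m" by (simp add: V_def)
  have colV: "col V l = (if l < r then col T l else col S l)" if "l < m" for l
    using that T(1) uS by (auto simp: V_def)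
  have "adj V * V = 1\<^sub>m m"
  proof (rule eq_matI)
    fix i l assume "i < dim_row (1\<^sub>m m :: complex mat)" "l < dim_col (1\<^sub>m m :: complex mat)"
    then have il: "i < m" "l < m" by auto
    have e: "(adj V * V) $$ (i, l) = col V l \<bullet>c col V i"
      using il V by (intro entry_adjoint_mult) auto
    have TT: "col T l \<bullet>c col T i = (if i = l then 1 else 0)" if "i < r" "l < r"
      using entry_adjoint_mult[of i T l T] T that by simp
    have SS: "col S l \<bullet>c col S i = (if i = l then 1 else 0)"
      using entry_adjoint_mult[of i S l S] uS il by simp
    have TS': "col T l \<bullet>c col S i = 0" if "l < r" "r \<le> i"
      using TS[of i l] that il cscalar_sym[of "col S i" "col T l"] T(1) uS by simp
    show "(adj V * V) $$ (i, l) = (1\<^sub>m m) $$ (i, l)"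
      unfolding e using il TT SS TS[of l i] TS' jr by (auto simp: colV)
  qed (use V in auto)
  with V have "unitary_mat m V" by (intro unitaryI)
  then show thesis using that[of V] j jr by (auto simp: V_def)
qed

text \<open>The columns of \<open>F W\<close> are orthogonal, and their squared norms are the eigenvalues of \<open>F\<^sup>* F\<close>. The
  nonzero ones, normalized, are the first columns of \<open>V\<close>.\<close>

theorem svd_exists:
  assumes F: "F \<in> carrier_mat m n"
  obtains V W s where "unitary_mat m V" "unitary_mat n W" "F = V * rdiag m n s * adj W"
    "decseq s" "\<And>i. 0 \<le> s i" "\<And>i. min m n \<le> i \<Longrightarrow> s i = 0"
proof -
  let ?G = "adj F * F"
  have G: "?G \<in> carrier_mat n n" "adj ?G = ?G"
    using F by (auto simp: adjoint_mult intro: carrier_matI)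
  obtain W d where W: "unitary_mat n W" "?G = W * rdiag n n d * adj W"
    and dec: "\<And>i j. i \<le> j \<Longrightarrow> j < n \<Longrightarrow> d j \<le> d i"
    using hermitian_diagonalization[OF G] by blast
  note uW = unitaryD[OF W(1)]
  define X where "X = F * W"
  have X: "X \<in> carrier_mat m n" using F uW by (auto simp: X_def)
  have "adj X * X = adj W * (?G * W)"
    using F uW by (simp add: X_def adjoint_mult mult_assoc_dim)
  also have "\<dots> = rdiag n n d" unfolding W(2) using uW by (simp add: mult_assoc_dim)
  finally have XX: "adj X * X = rdiag n n d" .
  have dX: "d i = sqn (col X i)" if "i < n" for i
  proof -
    have "complex_of_real (d i) = complex_of_real (sqn (col X i))"
      using entry_mult_adjoint_self[of i X] X that XX by simp
    then show ?thesis by (simp only: of_real_eq_iff)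
  qed
  then have d0: "0 \<le> d i" if "i < n" for i using that by simp
  define e where "e i = (if d i = 0 then 0 else 1 :: real)" for i
  have e01: "e i = 0 \<or> e i = 1" for i by (simp add: e_def)
  \<comment> \<open>The positive eigenvalues form an initial segment; \<open>e\<close> is its indicator.\<close>
  have e_dec: "e j \<le> e i" if "i \<le> j" "j < n" for i j
    using dec[OF that] d0[of j] d0[of i] that by (auto simp: e_def)
  obtain r where r: "r \<le> n" "\<And>i. i < n \<Longrightarrow> e i = (if i < r then 1 else 0)"
  proof (rule decreasing_zero_one[of n e])
    show "e j \<le> e i" if "i \<le> j" "j < n" for i j using that by (rule e_dec)
    show "e i = 0 \<or> e i = 1" for i by (rule e01)
  qed blast
  have dr: "d i > 0 \<longleftrightarrow> i < r" if "i < n" for i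
    using r(2)[OF that] d0[OF that] by (auto simp: e_def split: if_splits)
  define T where "T = mat m r (\<lambda>(i, j). X $$ (i, j) / complex_of_real (sqrt (d j)))"
  have T: "T \<in> carrier_mat m r" by (simp add: T_def)
  have "adj T * T = 1\<^sub>m r"
  proof (rule eq_matI)
    fix i j assume "i < dim_row (1\<^sub>m r :: complex mat)" "j < dim_col (1\<^sub>m r :: complex mat)"
    then have ij: "i < r" "j < r" by auto
    have "(adj T * T) $$ (i, j) =
        (adj X * X) $$ (i, j) / complex_of_real (sqrt (d i) * sqrt (d j))"
      using ij r T X by (simp add: scalar_prod_def T_def sum_divide_distrib)
    also have "\<dots> = (1\<^sub>m r) $$ (i, j)"
      unfolding XX using ij r dr[of i] by (auto simp: of_real_mult[symmetric] simp del: of_real_mult)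
    finally show "(adj T * T) $$ (i, j) = (1\<^sub>m r) $$ (i, j)" .
  qed (use T in auto)
  from isometry_extension[OF T this] obtain V where V: "unitary_mat m V" "r \<le> m"
    "\<And>i j. i < m \<Longrightarrow> j < r \<Longrightarrow> V $$ (i, j) = T $$ (i, j)" by blast
  note uV = unitaryD[OF V(1)]
  define s where "s i = (if i < r then sqrt (d i) else 0)" for i
  have "X = V * rdiag m n s"
  proof (rule eq_matI)
    fix i j assume "i < dim_row (V * rdiag m n s)" "j < dim_col (V * rdiag m n s)"
    then have ij: "i < m" "j < n" using uV by auto
    show "X $$ (i, j) = (V * rdiag m n s) $$ (i, j)"
    proof (cases "j < r")
      case True
      then have "(V * rdiag m n s) $$ (i, j) = T $$ (i, j) * complex_of_real (sqrt (d j))"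
        using ij uV V by (subst mult_rdiag_index) (auto simp: s_def)
      then show ?thesis using True ij dr[of j] by (simp add: T_def)
    next
      case False
      then have "sqn (col X j) = 0" using dX dr ij d0[of j] by (auto simp: less_le)
      then have "col X j = 0\<^sub>v m" using X by (subst (asm) sqn_eq_0) auto
      then have "X $$ (i, j) = 0"
        using ij X by (auto dest!: arg_cong[where f = "\<lambda>x. x $ i"])
      then show ?thesis using False ij uV by (subst mult_rdiag_index) (auto simp: s_def)
    qed
  qed (use X uV in auto)
  moreover have "F = X * adj W"
    using F uW by (simp add: X_def mult_assoc_dim)
  ultimately have "F = V * rdiag m n s * adj W" by simp
  moreover have s0: "0 \<le> s i" for i using d0[of i] r by (simp add: s_def)
  moreover have "decseq s"
    unfolding decseq_def
  proof (intro allI impI)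
    fix i j :: nat assume "i \<le> j"
    then show "s j \<le> s i"
      using dec[of i j] r(1) s0[of i] by (cases "j < r") (auto simp: s_def)
  qed
  moreover have "s i = 0" if "min m n \<le> i" for i using that r V(2) by (auto simp: s_def)
  ultimately show thesis using that V(1) W(1) by blast
qed

section \<open>Singular values and rank of a diagonalized matrix\<close>

lemma psd_conj:
  assumes "psd_mat n B" "unitary_mat n W"
  shows "psd_mat n (adj W * B * W)"
proof -
  note u = unitaryD[OF assms(2)]
  have B: "B \<in> carrier_mat n n" "adj B = B" using assms(1) by (auto simp: psd_mat_def)
  have "0 \<le> Re (((adj W * B * W) *\<^sub>v v) \<bullet>c v)" if v: "v \<in> carrier_vec n" for v
  proof -
    have "((adj W * B * W) *\<^sub>v v) \<bullet>c v = (adj W *\<^sub>v (B *\<^sub>v (W *\<^sub>v v))) \<bullet>c v"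
      using u B v by (simp add: mult_vec_assoc_dim)
    also have "\<dots> = (B *\<^sub>v (W *\<^sub>v v)) \<bullet>c (W *\<^sub>v v)"
      using u B v by (subst cscalar_adjoint) auto
    finally show ?thesis
      using assms(1) u v by (auto simp: psd_mat_def intro!: carrier_vecI)
  qed
  moreover have "adj (adj W * B * W) = adj W * B * W"
    using u B by (simp add: adjoint_mult mult_assoc_dim)
  moreover have "adj W * B * W \<in> carrier_mat n n"
    using u B by (auto intro: carrier_matI)
  ultimately show ?thesis by (simp add: psd_mat_def)
qed

lemma rdiag_mult_vec:
  assumes v: "v \<in> carrier_vec n" and i: "i < m" "i < n"
  shows "(rdiag m n d *\<^sub>v v) $ i = complex_of_real (d i) * v $ i"
proof -
  have "(rdiag m n d *\<^sub>v v) $ i = (\<Sum>j\<in>{0..<n}. rdiag m n d $$ (i, j) * v $ j)"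
    using v i by (simp add: scalar_prod_def row_def del: index_rdiag)
  also have "\<dots> = (\<Sum>j\<in>{0..<n}. if j = i then complex_of_real (d i) * v $ i else 0)"
    using i by (intro sum.cong) auto
  also have "\<dots> = complex_of_real (d i) * v $ i" using i by simp
  finally show ?thesis .
qed

lemma rdiag_form:
  assumes "v \<in> carrier_vec n"
  shows "Re ((rdiag n n d *\<^sub>v v) \<bullet>c v) = (\<Sum>i<n. d i * (cmod (v $ i))\<^sup>2)"
proof -
  have "(rdiag n n d *\<^sub>v v) \<bullet>c v = (\<Sum>i<n. complex_of_real (d i) * v $ i * cnj (v $ i))"
    using assms by (auto simp: cscalar_sum rdiag_mult_vec simp del: index_mult_mat_vec intro!: sum.cong)
  also have "\<dots> = (\<Sum>i<n. complex_of_real (d i * (cmod (v $ i))\<^sup>2))"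
    by (intro sum.cong refl) (simp only: of_real_mult complex_norm_square mult.assoc)
  also have "Re \<dots> = (\<Sum>i<n. d i * (cmod (v $ i))\<^sup>2)"
    by (simp only: of_real_sum[symmetric] Re_complex_of_real)
  finally show ?thesis .
qed

lemma psd_rdiag:
  assumes "\<And>i. i < n \<Longrightarrow> 0 \<le> d i"
  shows "psd_mat n (rdiag n n d)"
  using assms by (auto simp: psd_mat_def rdiag_form intro!: sum_nonneg)

text \<open>If \<open>C\<^sup>2 = diag(e\<^sup>2)\<close>, then \<open>y = (C - e\<^sub>i) u\<^sub>i\<close> satisfies \<open>C y = - e\<^sub>i y\<close>, which is only possible
  for \<open>y = 0\<close> when \<open>C\<close> is positive semidefinite.\<close>

lemma psd_sqrt_rdiag_unique:
  assumes C: "psd_mat n C" and sq: "C * C = rdiag n n (\<lambda>i. (e i)\<^sup>2)"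
    and e: "\<And>i. i < n \<Longrightarrow> 0 \<le> e i"
  shows "C = rdiag n n e"
proof -
  have Cc: "C \<in> carrier_mat n n" "adj C = C" using C by (auto simp: psd_mat_def)
  have colC: "col C i = complex_of_real (e i) \<cdot>\<^sub>v unit_vec n i" if i: "i < n" for i
  proof -
    define u where "u = (unit_vec n i :: complex vec)"
    define y where "y = C *\<^sub>v u - complex_of_real (e i) \<cdot>\<^sub>v u"
    have u: "u \<in> carrier_vec n" by (simp add: u_def)
    have y: "y \<in> carrier_vec n" using u Cc by (auto simp: y_def)
    have "col (C * C) i = complex_of_real ((e i)\<^sup>2) \<cdot>\<^sub>v u"
      using i unfolding sq by (intro eq_vecI) (auto simp: u_def)
    moreover have Cu: "C *\<^sub>v u = col C i"
      using i Cc by (intro eq_vecI) (auto simp: u_def)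
    moreover have "col (C * C) i = C *\<^sub>v col C i"
      using Cc i by (intro col_mult2[of _ n n _ n])
    ultimately have CCu: "C *\<^sub>v (C *\<^sub>v u) = complex_of_real ((e i)\<^sup>2) \<cdot>\<^sub>v u"
      by simp
    have "C *\<^sub>v y = C *\<^sub>v (C *\<^sub>v u) - complex_of_real (e i) \<cdot>\<^sub>v (C *\<^sub>v u)"
      using Cc u unfolding y_def
      by (simp add: mult_minus_distrib_mat_vec[of _ n n] mult_mat_vec[of _ n n])
    then have Cy: "C *\<^sub>v y = complex_of_real (- e i) \<cdot>\<^sub>v y"
      unfolding CCu y_def using Cc u
      by (intro eq_vecI) (auto simp: algebra_simps power2_eq_square simp del: index_mult_mat_vec)
    have "0 \<le> Re ((C *\<^sub>v y) \<bullet>c y)" using C y by (auto simp: psd_mat_def)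
    then have "0 \<le> - e i * sqn y" unfolding Cy using y by (simp add: cscalar_self)
    moreover have "sqn y = 0" if "e i = 0"
    proof -
      have "y = C *\<^sub>v u" using that Cc u by (auto simp: y_def intro!: eq_vecI simp del: index_mult_mat_vec)
      then have "complex_of_real (sqn y) = (C *\<^sub>v (C *\<^sub>v u)) \<bullet>c u"
        using sqn_mult[of C u] Cc u by (simp add: mult_vec_assoc_dim)
      then show ?thesis unfolding CCu using that u by simp
    qed
    ultimately have "sqn y = 0"
      using e[OF i] sqn_nonneg[of y] by (cases "e i = 0") (auto simp: mult_le_0_iff)
    then have "y = 0\<^sub>v n" using y by (simp add: sqn_eq_0)
    show ?thesis
    proof (rule eq_vecI)
      fix j assume "j < dim_vec (complex_of_real (e i) \<cdot>\<^sub>v unit_vec n i :: complex vec)"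
      then have j: "j < n" by simp
      have "y $ j = 0" using \<open>y = 0\<^sub>v n\<close> j by simp
      then show "col C i $ j = (complex_of_real (e i) \<cdot>\<^sub>v unit_vec n i) $ j"
        unfolding y_def Cu using j Cc by (simp add: u_def)
    qed (use Cc in auto)
  qed
  show ?thesis
  proof (rule eq_matI)
    fix i j assume "i < dim_row (rdiag n n e)" "j < dim_col (rdiag n n e)"
    then show "C $$ (i, j) = rdiag n n e $$ (i, j)"
      using arg_cong[OF colC[of j], of "\<lambda>x. x $ i"] Cc by auto
  qed (use Cc in auto)
qed

text \<open>\<open>W diag(\<bar>d\<^sub>i\<bar>) W\<^sup>*\<close> is a positive semidefinite square root of \<open>F\<^sup>* F\<close>; conjugation by \<open>W\<close> reduces
  uniqueness to the diagonal case.\<close>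

lemma mat_abs_rdiag:
  assumes "unitary_mat m V" "unitary_mat n W" "F = V * rdiag m n d * adj W"
  shows "mat_abs F = W * rdiag n n (\<lambda>i. if i < m then \<bar>d i\<bar> else 0) * adj W"
proof -
  note uV = unitaryD[OF assms(1)] and uW = unitaryD[OF assms(2)]
  define e where "e i = (if i < m then \<bar>d i\<bar> else 0)" for i
  have dim: "dim_col F = n" unfolding assms(3) using uW by simp
  have FF: "adj F * F = W * (rdiag n n (\<lambda>i. (e i)\<^sup>2) * adj W)"
  proof -
    have "adj F * F = W * (rdiag n m d * (rdiag m n d * adj W))"
      unfolding assms(3) using uV uW by (simp add: adjoint_mult mult_assoc_dim)
    also have "\<dots> = W * (rdiag n m d * rdiag m n d * adj W)"
      using uW by (simp add: mult_assoc_dim)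
    also have "rdiag n m d * rdiag m n d = rdiag n n (\<lambda>i. (e i)\<^sup>2)"
      unfolding rdiag_mult by (rule rdiag_cong) (auto simp: e_def power2_eq_square)
    finally show ?thesis .
  qed
  have ee: "rdiag n n e * (rdiag n n e * X) = rdiag n n (\<lambda>i. (e i)\<^sup>2) * X" if "dim_row X = n" for X
    using that by (simp add: mult_assoc_dim[symmetric] rdiag_mult power2_eq_square cong: rdiag_cong)
  show ?thesis
    unfolding mat_abs_def dim
  proof (rule the_equality, intro conjI)
    have "psd_mat n (adj (adj W) * rdiag n n e * adj W)"
      by (rule psd_conj[OF psd_rdiag unitary_adjoint[OF assms(2)]]) (simp add: e_def)
    then show "psd_mat n (W * rdiag n n (\<lambda>i. if i < m then \<bar>d i\<bar> else 0) * adj W)"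
      by (simp add: e_def[abs_def])
    show "W * rdiag n n (\<lambda>i. if i < m then \<bar>d i\<bar> else 0) * adj W *
        (W * rdiag n n (\<lambda>i. if i < m then \<bar>d i\<bar> else 0) * adj W) = adj F * F"
      unfolding FF e_def[symmetric] using uW by (simp add: mult_assoc_dim ee)
    fix B assume B: "psd_mat n B \<and> B * B = adj F * F"
    then have Bc: "B \<in> carrier_mat n n" by (simp add: psd_mat_def)
    define C where "C = adj W * B * W"
    have "C * C = adj W * (B * B) * W"
      unfolding C_def using uW Bc by (simp add: mult_assoc_dim)
    also have "\<dots> = rdiag n n (\<lambda>i. (e i)\<^sup>2)"
      unfolding conjunct2[OF B] FF using uW by (simp add: mult_assoc_dim)
    finally have CC: "C * C = rdiag n n (\<lambda>i. (e i)\<^sup>2)" .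
    have "psd_mat n C" unfolding C_def using psd_conj[OF conjunct1[OF B] assms(2)] .
    then have "C = rdiag n n e" by (rule psd_sqrt_rdiag_unique[OF _ CC]) (simp add: e_def)
    moreover have "B = W * C * adj W"
      unfolding C_def using uW Bc by (simp add: mult_assoc_dim)
    ultimately show "B = W * rdiag n n (\<lambda>i. if i < m then \<bar>d i\<bar> else 0) * adj W"
      by (simp add: e_def[abs_def])
  qed
qed

text \<open>The singular values depend only on the multiset of absolute values of the diagonal entries, so any
  decreasing rearrangement \<open>f\<close> of them lists the singular values.\<close>

lemma sing_val_eqI:
  assumes "unitary_mat m V" "unitary_mat n W" "F = V * rdiag m n d * adj W"
    and "mset (map f [0..<n]) = mset (map (\<lambda>i. if i < m then \<bar>d i\<bar> else 0) [0..<n])"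
    and "\<And>i j. i \<le> j \<Longrightarrow> j < n \<Longrightarrow> f j \<le> f i" and "i < n"
  shows "sing_val F (Suc i) = f i"
proof -
  note uW = unitaryD[OF assms(2)]
  define e where "e i = (if i < m then \<bar>d i\<bar> else 0)" for i
  have abs: "mat_abs F = W * rdiag n n e * adj W"
    unfolding e_def using mat_abs_rdiag[OF assms(1-3)] .
  have "char_poly (mat_abs F) = char_poly (rdiag n n e)"
    by (rule char_poly_similar, unfold similar_mat_def, rule exI[of _ W],
        rule exI[of _ "adj W"], rule similar_mat_witI[of _ _ n])
       (use uW in \<open>auto simp: abs intro: carrier_matI\<close>)
  also have "\<dots> = (\<Prod>a\<leftarrow>diag_mat (rdiag n n e). [:- a, 1:])"
    by (rule char_poly_upper_triangular[of _ n]) (auto simp: upper_triangular_def)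
  also have "diag_mat (rdiag n n e) = map (\<lambda>i. complex_of_real (e i)) [0..<n]"
    by (auto simp: diag_mat_def)
  finally have cp: "char_poly (mat_abs F) = (\<Prod>a\<leftarrow>map (\<lambda>i. complex_of_real (e i)) [0..<n]. [:- a, 1:])" .
  have pr: "proots (\<Prod>a\<leftarrow>as. [:- a, 1:]) = mset as" for as :: "complex list"
  proof (induction as)
    case (Cons a as)
    have "(\<Prod>a\<leftarrow>as. [:- a, 1:]) \<noteq> 0" by (auto simp: prod_list_zero_iff)
    with Cons show ?case by (simp add: proots_mult del: mult_pCons_left)
  qed simp
  have "image_mset Re (proots (char_poly (mat_abs F))) = mset (map e [0..<n])"
    unfolding cp pr by (simp add: multiset.map_comp o_def)
  also have "\<dots> = mset (map f [0..<n])" unfolding e_def assms(4) ..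
  finally have "sorted_list_of_multiset (image_mset Re (proots (char_poly (mat_abs F)))) =
      sort (map f [0..<n])" by (simp only: sorted_list_of_multiset_mset)
  moreover have "sort (map f [0..<n]) = rev (map f [0..<n])"
  proof (rule properties_for_sort)
    show "sorted (rev (map f [0..<n]))"
      unfolding sorted_iff_nth_mono using assms(5) by (auto simp: rev_nth)
  qed simp
  ultimately show ?thesis using assms(6) by (simp add: sing_val_def)
qed

lemma sorting_permutation:
  fixes g :: "nat \<Rightarrow> real"
  obtains p where "p permutes {..<n}" "\<And>i j. i \<le> j \<Longrightarrow> j < n \<Longrightarrow> g (p j) \<le> g (p i)"
proof -
  have "mset (rev (sort (map g [0..<n]))) = mset (map g [0..<n])" by simp
  from mset_eq_permutation[OF this] obtain p where p: "p permutes {..<n}"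
    "permute_list p (map g [0..<n]) = rev (sort (map g [0..<n]))" by auto
  have gp: "g (p i) = rev (sort (map g [0..<n])) ! i" if "i < n" for i
    using that permutes_in_image[OF p(1), of i] by (simp add: p(2)[symmetric] permute_list_def)
  have "g (p j) \<le> g (p i)" if "i \<le> j" "j < n" for i j
  proof -
    have "sort (map g [0..<n]) ! (n - Suc j) \<le> sort (map g [0..<n]) ! (n - Suc i)"
      by (rule sorted_nth_mono) (use that in auto)
    then show ?thesis using that by (simp add: gp rev_nth)
  qed
  with p(1) show thesis using that by blast
qed

text \<open>For diagonal entries of arbitrary sign and order; this applies to \<open>F - X\<close>, where \<open>s\<^sub>i - 1\<close> occurs.\<close>

lemma sing_val_perm:
  assumes "unitary_mat m V" "unitary_mat n W" "F = V * rdiag m n d * adj W"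
  obtains p where "p permutes {..<min m n}" "\<And>i. i < min m n \<Longrightarrow> sing_val F (Suc i) = \<bar>d (p i)\<bar>"
proof -
  obtain p where p: "p permutes {..<min m n}"
    "\<And>i j. i \<le> j \<Longrightarrow> j < min m n \<Longrightarrow> \<bar>d (p j)\<bar> \<le> \<bar>d (p i)\<bar>"
    using sorting_permutation[of "min m n" "\<lambda>i. \<bar>d i\<bar>"] by blast
  define e where "e i = (if i < m then \<bar>d i\<bar> else 0)" for i
  have pn: "p permutes {..<n}" by (rule permutes_subset[OF p(1)]) auto
  have "image_mset (\<lambda>i. e (p i)) (mset_set {..<n}) = image_mset e (image_mset p (mset_set {..<n}))"
    by (simp add: multiset.map_comp o_def)
  also have "image_mset p (mset_set {..<n}) = mset_set {..<n}"
    by (rule permutes_image_mset[OF pn])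
  finally have ms: "mset (map (\<lambda>i. e (p i)) [0..<n]) = mset (map e [0..<n])"
    by (simp add: atLeast0LessThan)
  have pi: "p i < min m n \<longleftrightarrow> i < min m n" for i
    using permutes_in_image[OF p(1), of i] by simp
  have pid: "p i = i" if "\<not> i < min m n" for i using permutes_not_in[OF p(1), of i] that by simp
  have mono: "e (p j) \<le> e (p i)" if "i \<le> j" "j < n" for i j
  proof (cases "j < m")
    case True
    then show ?thesis using p(2)[of i j] pi[of i] pi[of j] that by (simp add: e_def)
  next
    case False
    then have "p j = j" by (intro pid) auto
    then have "e (p j) = 0" using False by (simp add: e_def)
    then show ?thesis by (simp add: e_def)
  qed
  have "sing_val F (Suc i) = \<bar>d (p i)\<bar>" if "i < min m n" for i
  proof -
    have "sing_val F (Suc i) = e (p i)"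
      by (rule sing_val_eqI[OF assms _ mono]) (use ms that in \<open>auto simp: e_def[abs_def]\<close>)
    then show ?thesis using pi[of i] that by (simp add: e_def)
  qed
  with p(1) show thesis using that by blast
qed

lemma sing_val_decreasing:
  assumes "unitary_mat m V" "unitary_mat n W" "F = V * rdiag m n d * adj W"
    and "\<And>i j. i \<le> j \<Longrightarrow> j < min m n \<Longrightarrow> d j \<le> d i" "\<And>i. i < min m n \<Longrightarrow> 0 \<le> d i" "i < min m n"
  shows "sing_val F (Suc i) = d i"
proof -
  define e where "e i = (if i < m then \<bar>d i\<bar> else 0)" for i
  have "sing_val F (Suc i) = e i"
    by (rule sing_val_eqI[OF assms(1-3)]) (use assms(4-6) in \<open>auto simp: e_def\<close>)
  then show ?thesis using assms(5,6) by (simp add: e_def)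
qed

text \<open>\<open>T\<close> is injective and \<open>C\<close> is surjective, hence \<open>T C\<close> has the same range as \<open>T\<close>, of dimension \<open>r\<close>.\<close>

lemma rank_factorization:
  assumes T: "T \<in> carrier_mat m r" "adj T * T = 1\<^sub>m r"
    and C: "C \<in> carrier_mat r n" and D: "D \<in> carrier_mat n r" "C * D = 1\<^sub>m r"
  shows "mat_rank (T * C) = r"
proof -
  interpret vec_space "TYPE(complex)" m .
  have inj: "v = 0\<^sub>v r" if "v \<in> carrier_vec r" "T *\<^sub>v v = 0\<^sub>v m" for v
  proof -
    have "v = adj T *\<^sub>v (T *\<^sub>v v)"
      using that(1) T by (simp add: mult_vec_assoc_dim[symmetric])
    also have "\<dots> = 0\<^sub>v r" unfolding that(2) using T by (intro eq_vecI) auto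
    finally show ?thesis .
  qed
  have dist: "distinct (cols T)"
    unfolding distinct_conv_nth
  proof (intro allI impI)
    fix i j assume "i < length (cols T)" "j < length (cols T)" "i \<noteq> j"
    then have ij: "i < r" "j < r" "i \<noteq> j" using T by auto
    show "cols T ! i \<noteq> cols T ! j"
    proof
      assume "cols T ! i = cols T ! j"
      then have "col T i = col T j" using ij T by simp
      then have "(adj T * T) $$ (i, j) = (adj T * T) $$ (i, i)"
        using ij T(1) entry_adjoint_mult[of i T j T] entry_adjoint_mult[of i T i T]
        by (simp del: index_mult_mat(1))
      then show False using ij unfolding T(2) by simp
    qed
  qed
  have "lin_indpt (set (cols T))"
  proof
    assume dep: "lin_dep (set (cols T))"
    from lin_depE[OF T(1) dep dist] obtain v where "v \<in> carrier_vec r" "v \<noteq> 0\<^sub>v r" "T *\<^sub>v v = 0\<^sub>v m" .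
    then show False using inj[of v] by simp
  qed
  then have "rank T = r" by (rule lin_indpt_full_rank[OF T(1) dist])
  have range: "T *\<^sub>v x = (T * C) *\<^sub>v (D *\<^sub>v x)" if "x \<in> carrier_vec r" for x
  proof -
    have "(T * C) *\<^sub>v (D *\<^sub>v x) = T *\<^sub>v ((C * D) *\<^sub>v x)"
      using that T C D(1) by (simp add: mult_vec_assoc_dim)
    then show ?thesis using that by (simp add: D(2))
  qed
  have TC: "T * C \<in> carrier_mat m n" using T C by auto
  have "col_space (T * C) = col_space T"
    unfolding col_space_eq[OF T(1)] col_space_eq[OF TC]
  proof (rule Collect_cong, rule conj_cong)
    fix y
    show "(\<exists>x\<in>carrier_vec (dim_col (T * C)). T * C *\<^sub>v x = y) \<longleftrightarrow> (\<exists>x\<in>carrier_vec (dim_col T). T *\<^sub>v x = y)"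
    proof
      assume "\<exists>x\<in>carrier_vec (dim_col (T * C)). T * C *\<^sub>v x = y"
      then obtain x where "x \<in> carrier_vec n" "T * C *\<^sub>v x = y" using C by auto
      then show "\<exists>x\<in>carrier_vec (dim_col T). T *\<^sub>v x = y"
        using T C by (intro bexI[of _ "C *\<^sub>v x"]) (auto simp: mult_vec_assoc_dim)
    next
      assume "\<exists>x\<in>carrier_vec (dim_col T). T *\<^sub>v x = y"
      then obtain x where "x \<in> carrier_vec r" "T *\<^sub>v x = y" using T by auto
      then show "\<exists>x\<in>carrier_vec (dim_col (T * C)). T * C *\<^sub>v x = y"
        using C D range[of x] by (intro bexI[of _ "D *\<^sub>v x"]) auto
    qed
  qed (use T in auto)
  then have "rank (T * C) = rank T" unfolding rank_def col_space_def by simp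
  then show ?thesis using \<open>rank T = r\<close> T by (simp add: mat_rank_def)
qed

lemma mat_rank_rdiag:
  assumes V: "unitary_mat m V" and W: "unitary_mat n W"
    and "\<And>i. i < min m n \<Longrightarrow> d i \<noteq> 0 \<longleftrightarrow> i < r" "r \<le> min m n"
  shows "mat_rank (V * rdiag m n d * adj W) = r"
proof -
  note uV = unitaryD[OF V] and uW = unitaryD[OF W]
  define T where "T = V * rdiag m r (\<lambda>i. 1)"
  define C where "C = rdiag r n d * adj W"
  define D where "D = W * rdiag n r (\<lambda>i. 1 / d i)"
  have c: "T \<in> carrier_mat m r" "C \<in> carrier_mat r n" "D \<in> carrier_mat n r"
    using uV uW by (auto simp: T_def C_def D_def intro: carrier_matI)
  have "adj T * T = rdiag r m (\<lambda>i. 1) * rdiag m r (\<lambda>i. 1)"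
    unfolding T_def using uV by (simp add: adjoint_mult mult_assoc_dim)
  also have "\<dots> = 1\<^sub>m r" unfolding rdiag_mult rdiag_one[symmetric]
    by (rule rdiag_cong) (use assms(4) in auto)
  finally have T: "adj T * T = 1\<^sub>m r" .
  have "C * D = rdiag r n d * rdiag n r (\<lambda>i. 1 / d i)"
    unfolding C_def D_def using uW by (simp add: mult_assoc_dim)
  also have "\<dots> = 1\<^sub>m r" unfolding rdiag_mult rdiag_one[symmetric]
    by (rule rdiag_cong) (use assms(3,4) in auto)
  finally have CD: "C * D = 1\<^sub>m r" .
  have "rdiag m r (\<lambda>i. 1) * rdiag r n d = rdiag m n d"
    unfolding rdiag_mult by (rule rdiag_cong) (use assms(3) in auto)
  then have "T * C = V * rdiag m n d * adj W"
    unfolding T_def C_def using uV uW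
    by (simp add: mult_assoc_dim mult_assoc_dim[of "rdiag m r (\<lambda>i. 1)" "rdiag r n d", symmetric])
  then show ?thesis using rank_factorization[OF c(1) T c(2,3) CD] by simp
qed

text \<open>Zero-based singular values, extended by zero to a decreasing sequence on all of \<open>\<nat>\<close>.\<close>

definition sv :: "complex mat \<Rightarrow> nat \<Rightarrow> real" where
  "sv F i = (if i < min (dim_row F) (dim_col F) then sing_val F (Suc i) else 0)"

lemma sv_eq:
  assumes "unitary_mat m V" "unitary_mat n W" "F = V * rdiag m n s * adj W"
    "\<And>i j. i \<le> j \<Longrightarrow> j < min m n \<Longrightarrow> s j \<le> s i" "\<And>i. i < min m n \<Longrightarrow> 0 \<le> s i" "i < min m n"
  shows "sv F i = s i"
proof -
  have "dim_row F = m" "dim_col F = n"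
    unfolding assms(3) using unitaryD[OF assms(1)] unitaryD[OF assms(2)] by auto
  then show ?thesis using sing_val_decreasing[OF assms] assms(6) by (simp add: sv_def)
qed

lemma svd_sv:
  assumes F: "F \<in> carrier_mat m n"
  obtains V W where "unitary_mat m V" "unitary_mat n W" "F = V * rdiag m n (sv F) * adj W"
    and "decseq (sv F)" "\<And>i. 0 \<le> sv F i" "\<And>i. sv F i \<noteq> 0 \<longleftrightarrow> i < mat_rank F" "mat_rank F \<le> min m n"
proof -
  obtain V W s where svd: "unitary_mat m V" "unitary_mat n W" "F = V * rdiag m n s * adj W"
    and s: "decseq s" "\<And>i. 0 \<le> s i" "\<And>i. min m n \<le> i \<Longrightarrow> s i = 0"
    by (rule svd_exists[OF F], rule that)
  have "sv F i = s i" for i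
  proof (cases "i < min m n")
    case True
    then show ?thesis by (intro sv_eq[OF svd decseqD[OF s(1)] s(2)])
  next
    case False
    then show ?thesis using s(3)[of i] F by (auto simp: sv_def)
  qed
  then have eq: "sv F = s" by (rule ext)
  define e where "e i = (if s i = 0 then 0 else 1 :: real)" for i
  obtain r where r: "r \<le> min m n" "\<And>i. i < min m n \<Longrightarrow> e i = (if i < r then 1 else 0)"
  proof (rule decreasing_zero_one[of "min m n" e])
    show "e j \<le> e i" if "i \<le> j" for i j
      using s(2)[of j] decseqD[OF s(1) that] by (auto simp: e_def)
    show "e i = 0 \<or> e i = 1" for i by (auto simp: e_def)
  qed blast
  have sr: "s i \<noteq> 0 \<longleftrightarrow> i < r" for i
    using r(1) r(2)[of i] s(3)[of i] by (cases "i < min m n") (auto simp: e_def split: if_splits)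
  have rank: "mat_rank F = r" unfolding svd(3) by (rule mat_rank_rdiag[OF svd(1,2)]) (use sr r(1) in auto)
  show thesis by (rule that[unfolded eq rank, OF svd s(1,2) sr r(1)])
qed

lemma
  assumes "F \<in> carrier_mat m n"
  shows decseq_sv: "decseq (sv F)" and sv_nonneg: "0 \<le> sv F i"
    and sv_nonzero_iff: "sv F i \<noteq> 0 \<longleftrightarrow> i < mat_rank F"
    and mat_rank_le: "mat_rank F \<le> min m n"
proof -
  have "decseq (sv F) \<and> (\<forall>i. 0 \<le> sv F i) \<and> (\<forall>i. sv F i \<noteq> 0 \<longleftrightarrow> i < mat_rank F) \<and>
      mat_rank F \<le> min m n"
    by (rule svd_sv[OF assms]) simp
  then show "decseq (sv F)" "0 \<le> sv F i" "sv F i \<noteq> 0 \<longleftrightarrow> i < mat_rank F" "mat_rank F \<le> min m n"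
    by simp_all
qed

lemma diag_block_mat_Cons: "diag_block_mat (A # As) = bdiag A (diag_block_mat As)"
  by (simp add: bdiag_def Let_def)

lemma diag_block_mat_bdiag: "diag_block_mat [A, B] = bdiag A B"
  unfolding diag_block_mat_Cons[of A "[B]"] diag_block_mat_singleton ..

lemma is_svd_iff:
  assumes F: "F \<in> carrier_mat m n"
  shows "is_svd F V W \<longleftrightarrow> unitary_mat m V \<and> unitary_mat n W \<and>
    F = V * rdiag m n (sv F) * adj W"
proof -
  define r where "r = mat_rank F"
  have r: "r \<le> m" "r \<le> n" using mat_rank_le[OF F] by (auto simp: r_def)
  have "svd_sigma F = bdiag (rdiag r r (\<lambda>i. sing_val F (Suc i))) (rdiag (m - r) (n - r) (\<lambda>i. 0))"
  proof -
    have "mat_diag r (\<lambda>i. complex_of_real (sing_val F (i + 1))) = rdiag r r (\<lambda>i. sing_val F (Suc i))"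
      by (rule eq_matI) (auto simp: mat_diag_def)
    moreover have "0\<^sub>m (m - r) (n - r) = rdiag (m - r) (n - r) (\<lambda>i. 0)"
      by (rule eq_matI) auto
    ultimately show ?thesis
      unfolding svd_sigma_def r_def[symmetric] Let_def carrier_matD[OF F]
      unfolding diag_block_mat_bdiag by simp
  qed
  also have "\<dots> = rdiag m n (\<lambda>i. if i < r then sing_val F (Suc i) else 0)"
    using r by (simp add: bdiag_rdiag)
  also have "\<dots> = rdiag m n (sv F)"
  proof (rule rdiag_cong)
    fix i assume "i < m" "i < n"
    then have "sv F i = sing_val F (Suc i)"
      by (simp add: sv_def carrier_matD[OF F])
    then show "(if i < r then sing_val F (Suc i) else 0) = sv F i"
      using sv_nonzero_iff[OF F, of i] unfolding r_def by auto
  qed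
  finally have eq: "svd_sigma F = rdiag m n (sv F)" .
  show ?thesis
    unfolding is_svd_def carrier_matD[OF F] eq ..
qed

section \<open>Partial isometries\<close>

text \<open>The partial identity \<open>I\<^sub>k \<oplus> 0\<close>, the normal form of partial isometries of rank \<open>k\<close> under unitary
  equivalence.\<close>

definition pid :: "nat \<Rightarrow> nat \<Rightarrow> nat \<Rightarrow> complex mat" where
  "pid m n k = rdiag m n (\<lambda>i. if i < k then 1 else 0)"

lemma dim_pid [simp]: "dim_row (pid m n k) = m" "dim_col (pid m n k) = n"
  by (simp_all add: pid_def)

text \<open>The vector \<open>f - X\<^sup>* X f\<close> lies in the kernel of \<open>X\<close>, so \<open>f\<close> in its orthogonal complement satisfies
  \<open>\<langle>f, f\<rangle> = \<langle>f, X\<^sup>* X f\<rangle>\<close>.\<close>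

lemma partial_isometryI:
  assumes X: "X \<in> carrier_mat m n" and eq: "X * (adj X * X) = X"
  shows "partial_isometry X"
  unfolding partial_isometry_def vec_norm2_eq
proof
  fix f assume f: "f \<in> kernel_orth X"
  then have fc: "f \<in> carrier_vec n" using X by (simp add: kernel_orth_def)
  define Y where "Y = adj X * X"
  have Y: "Y \<in> carrier_mat n n" "dim_row Y = n" "dim_col Y = n" using X by (auto simp: Y_def intro: carrier_matI)
  define g where "g = f - Y *\<^sub>v f"
  have g: "g \<in> carrier_vec n" using fc Y by (auto simp: g_def)
  have "X *\<^sub>v g = X *\<^sub>v f - (X * Y) *\<^sub>v f"
    unfolding g_def using X Y fc by (simp add: mult_minus_distrib_mat_vec[of _ m n] assoc_mult_mat_vec[of _ m n _ n])
  also have "\<dots> = 0\<^sub>v m" using X fc eq by (simp add: Y_def)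
  finally have "g \<in> mat_kernel X" using X g by (intro mat_kernelI)
  then have "f \<bullet>c g = 0" using f by (simp add: kernel_orth_def)
  moreover have "f \<bullet>c g = f \<bullet>c f - f \<bullet>c (Y *\<^sub>v f)"
    using fc Y by (simp add: cscalar_sum g_def algebra_simps sum_subtractf)
  moreover have "f \<bullet>c (Y *\<^sub>v f) = cnj (complex_of_real (sqn (X *\<^sub>v f)))"
    using sqn_mult[of X f] X Y fc cscalar_sym[of "Y *\<^sub>v f" f] by (simp add: Y_def)
  ultimately show "sqn (X *\<^sub>v f) = sqn f"
    by (simp add: cscalar_self)
qed

text \<open>A right singular vector for a nonzero singular value is orthogonal to the kernel, so \<open>X\<close>
  preserves its norm; but the norm of its image is the singular value.\<close>

lemma partial_isometry_sv:
  assumes X: "X \<in> carrier_mat m n" and pi: "partial_isometry X" and i: "i < mat_rank X"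
  shows "sv X i = 1"
proof -
  obtain A B where AB: "unitary_mat m A" "unitary_mat n B" "X = A * rdiag m n (sv X) * adj B"
    by (rule svd_sv[OF X], rule that)
  note uA = unitaryD[OF AB(1)] and uB = unitaryD[OF AB(2)]
  have im: "i < m" "i < n" using i mat_rank_le[OF X] by auto
  define D where "D = rdiag m n (sv X)"
  have D: "dim_row D = m" "dim_col D = n" "D \<in> carrier_mat m n" by (simp_all add: D_def)
  have XD: "X = A * D * adj B" using AB(3) by (simp only: D_def)
  have XB: "X * B = A * D" unfolding XD using uA uB D by (simp add: mult_assoc_dim)
  have AX: "adj A * X = D * adj B" unfolding XD using uA uB D by (simp add: mult_assoc_dim)
  have D_row: "(D *\<^sub>v v) $ i = complex_of_real (sv X i) * v $ i" if "v \<in> carrier_vec n" for v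
    unfolding D_def by (rule rdiag_mult_vec[OF that im])
  have b: "col B i \<in> carrier_vec n" using uB by (auto intro: carrier_vecI)
  have "col B i \<in> kernel_orth X"
    unfolding kernel_orth_def
  proof (intro CollectI conjI ballI)
    show "col B i \<in> carrier_vec (dim_col X)" using b X by simp
    fix g assume "g \<in> mat_kernel X"
    then have g: "g \<in> carrier_vec n" "X *\<^sub>v g = 0\<^sub>v m" using X by (auto simp: mat_kernel)
    have "D *\<^sub>v (adj B *\<^sub>v g) = adj A *\<^sub>v (X *\<^sub>v g)"
      using arg_cong[OF AX, of "\<lambda>Z. Z *\<^sub>v g"] uA uB X D g(1) by (simp add: mult_vec_assoc_dim)
    also have "\<dots> = 0\<^sub>v m" unfolding g(2) using uA by (intro eq_vecI) auto
    finally have "(D *\<^sub>v (adj B *\<^sub>v g)) $ i = 0" using im by simp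
    moreover have "adj B *\<^sub>v g \<in> carrier_vec n" using uB by (auto intro: carrier_vecI)
    ultimately have "complex_of_real (sv X i) * (adj B *\<^sub>v g) $ i = 0" by (simp only: D_row)
    then have "(adj B *\<^sub>v g) $ i = 0" using sv_nonzero_iff[OF X, of i] i by simp
    moreover have "(adj B *\<^sub>v g) $ i = g \<bullet>c col B i"
      using uB g(1) im by (simp add: cscalar_sum scalar_prod_def atLeast0LessThan mult.commute)
    ultimately have "cnj (g \<bullet>c col B i) = 0" by simp
    then show "col B i \<bullet>c g = 0" using cscalar_sym[of g "col B i"] g(1) uB(2) by simp
  qed
  with pi have "sqn (X *\<^sub>v col B i) = sqn (col B i)" by (simp add: partial_isometry_def vec_norm2_eq)
  moreover have "complex_of_real (sqn (col B i)) = 1"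
    using entry_mult_adjoint_self[of i B] uB im by simp
  then have "sqn (col B i) = 1" by (simp only: of_real_eq_1_iff)
  moreover have "complex_of_real (sqn (X *\<^sub>v col B i)) = complex_of_real ((sv X i)\<^sup>2)"
  proof -
    have "X *\<^sub>v col B i = col (A * D) i"
      using XB X uB im by (metis col_mult2)
    then have "complex_of_real (sqn (X *\<^sub>v col B i)) = (adj (A * D) * (A * D)) $$ (i, i)"
      using entry_mult_adjoint_self[of i "A * D"] D im by simp
    also have "adj (A * D) * (A * D) = rdiag n m (sv X) * rdiag m n (sv X)"
      using uA D by (simp add: adjoint_mult mult_assoc_dim) (simp add: D_def)
    also have "\<dots> $$ (i, i) = complex_of_real ((sv X i)\<^sup>2)"
      unfolding rdiag_mult using im by (simp add: power2_eq_square)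
    finally show ?thesis .
  qed
  then have "sqn (X *\<^sub>v col B i) = (sv X i)\<^sup>2" by (simp only: of_real_eq_iff)
  ultimately show ?thesis using sv_nonneg[OF X, of i] by (simp add: power2_eq_1_iff)
qed

lemma partial_isometriesE:
  assumes "X \<in> partial_isometries m n k"
  obtains A B where "unitary_mat m A" "unitary_mat n B" "X = A * pid m n k * adj B"
    "k \<le> min m n"
proof -
  have X: "X \<in> carrier_mat m n" "partial_isometry X" "mat_rank X = k"
    using assms by (auto simp: partial_isometries_def)
  obtain A B where AB: "unitary_mat m A" "unitary_mat n B" "X = A * rdiag m n (sv X) * adj B"
    by (rule svd_sv[OF X(1)], rule that)
  have "rdiag m n (sv X) = pid m n k"
    unfolding pid_def
  proof (rule rdiag_cong)
    fix i show "sv X i = (if i < k then 1 else 0)"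
      using partial_isometry_sv[OF X(1,2), of i] sv_nonzero_iff[OF X(1), of i] X(3) by auto
  qed
  with AB(3) have "X = A * pid m n k * adj B" by (simp only:)
  with AB(1,2) mat_rank_le[OF X(1)] X(3) show thesis by (intro that) auto
qed

lemma conj_rdiag_carrier:
  assumes "unitary_mat m A" "unitary_mat n B"
  shows "A * rdiag m n d * adj B \<in> carrier_mat m n"
  using unitaryD[OF assms(1)] unitaryD[OF assms(2)] by (auto intro: carrier_matI)

lemma conj_pid_absorb:
  assumes A: "unitary_mat m A" and B: "unitary_mat n B" and k: "k \<le> min m n"
  defines "X \<equiv> A * pid m n k * adj B"
  shows "X * (adj X * X) = X"
proof -
  note uA = unitaryD[OF A] and uB = unitaryD[OF B]
  have "pid m n k * adj (pid m n k) * pid m n k = pid m n k"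
    using k unfolding pid_def rdiag_adjoint rdiag_mult by (intro rdiag_cong) auto
  moreover have "pid m n k * (adj (pid m n k) * (pid m n k * adj B)) =
      (pid m n k * adj (pid m n k) * pid m n k) * adj B"
    using uB by (simp add: mult_assoc_dim)
  ultimately show ?thesis
    unfolding X_def using uA uB by (simp add: adjoint_mult mult_assoc_dim)
qed

lemma partial_isometriesI:
  assumes A: "unitary_mat m A" and B: "unitary_mat n B" and k: "k \<le> min m n"
  shows "A * pid m n k * adj B \<in> partial_isometries m n k"
proof -
  define X where "X = A * pid m n k * adj B"
  have X: "X \<in> carrier_mat m n" unfolding X_def pid_def by (rule conj_rdiag_carrier[OF A B])
  have "X * (adj X * X) = X" unfolding X_def by (rule conj_pid_absorb[OF A B k])
  then have "partial_isometry X" by (rule partial_isometryI[OF X])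
  moreover have "mat_rank X = k"
    unfolding X_def pid_def by (rule mat_rank_rdiag[OF A B]) (use k in auto)
  ultimately show ?thesis using X by (simp add: partial_isometries_def X_def)
qed

lemma partial_isometries_absorb:
  assumes "X \<in> partial_isometries m n k"
  shows "X * (adj X * X) = X"
proof -
  obtain A B where A: "unitary_mat m A" and B: "unitary_mat n B"
    and X: "X = A * pid m n k * adj B" and k: "k \<le> min m n"
    by (rule partial_isometriesE[OF assms])
  show ?thesis unfolding X by (rule conj_pid_absorb[OF A B k])
qed

section \<open>Eigenvalue inequalities for Hermitian matrices\<close>

definition form :: "complex mat \<Rightarrow> complex vec \<Rightarrow> real" where
  "form A x = Re ((A *\<^sub>v x) \<bullet>c x)"

lemma form_add:
  assumes "A \<in> carrier_mat n n" "B \<in> carrier_mat n n" "x \<in> carrier_vec n"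
  shows "form (A + B) x = form A x + form B x"
  using assms by (simp add: form_def add_mult_distrib_mat_vec[of _ n n] cscalar_sum
    distrib_right sum.distrib)

lemma form_conj_rdiag:
  assumes U: "unitary_mat n U" and x: "x \<in> carrier_vec n"
  shows "form (U * rdiag n n d * adj U) x = (\<Sum>i<n. d i * (cmod ((adj U *\<^sub>v x) $ i))\<^sup>2)"
proof -
  note u = unitaryD[OF U]
  have "((U * rdiag n n d * adj U) *\<^sub>v x) \<bullet>c x =
      (U *\<^sub>v (rdiag n n d *\<^sub>v (adj U *\<^sub>v x))) \<bullet>c x"
    using u x by (simp add: mult_vec_assoc_dim)
  also have "\<dots> = (rdiag n n d *\<^sub>v (adj U *\<^sub>v x)) \<bullet>c (adj U *\<^sub>v x)"
    using u x by (subst cscalar_adjoint) auto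
  finally show ?thesis
    unfolding form_def using u x by (subst rdiag_form[symmetric]) (auto intro: carrier_vecI)
qed

text \<open>The first \<open>i + 1\<close> eigenvectors of \<open>A\<close> span a subspace that meets the orthogonal complement of
  the first \<open>i\<close> eigenvectors of \<open>B\<close>; a unit vector \<open>x\<close> in the intersection satisfies
  \<open>a\<^sub>i \<le> \<langle>A x, x\<rangle> \<le> \<langle>B x, x\<rangle> \<le> b\<^sub>i\<close>.\<close>

lemma weyl_monotone:
  assumes U: "unitary_mat n U" and a: "\<And>i j. i \<le> j \<Longrightarrow> j < n \<Longrightarrow> a j \<le> a i"
    and V: "unitary_mat n V" and b: "\<And>i j. i \<le> j \<Longrightarrow> j < n \<Longrightarrow> b j \<le> b i"
    and le: "\<And>x. x \<in> carrier_vec n \<Longrightarrow>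
      form (U * rdiag n n a * adj U) x \<le> form (V * rdiag n n b * adj V) x"
    and i: "i < n"
  shows "a i \<le> b i"
proof -
  note uU = unitaryD[OF U] and uV = unitaryD[OF V]
  define M where "M = mat n n (\<lambda>(p, l). if p < i then (adj V * U) $$ (p, l)
    else if p = i then 0 else if p = l then 1 else 0 :: complex)"
  have M: "M \<in> carrier_mat n n" by (simp add: M_def)
  \<comment> \<open>Row \<open>i\<close> vanishes, so \<open>M\<close> is singular; its other rows express the two subspace conditions.\<close>
  have "transpose_mat M *\<^sub>v unit_vec n i = 0\<^sub>v n"
    using i by (intro eq_vecI) (auto simp: M_def)
  then have "det (transpose_mat M) = 0"
    using det_0_iff_vec_prod_zero_field[of "transpose_mat M" n] M i
    by (metis transpose_carrier_mat unit_vec_carrier unit_vec_nonzero)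
  then have "det M = 0" using det_transpose[OF M] by simp
  then obtain c where c: "c \<in> carrier_vec n" "c \<noteq> 0\<^sub>v n" "M *\<^sub>v c = 0\<^sub>v n"
    using det_0_iff_vec_prod_zero_field[OF M] by blast
  have c0: "c $ p = 0" if "i < p" "p < n" for p
  proof -
    have "(M *\<^sub>v c) $ p = (\<Sum>l\<in>{0..<n}. M $$ (p, l) * c $ l)"
      using that c(1) M by (simp add: scalar_prod_def row_def)
    also have "\<dots> = (\<Sum>l\<in>{0..<n}. if l = p then c $ p else 0)"
      using that by (intro sum.cong) (auto simp: M_def)
    also have "\<dots> = c $ p" using that by simp
    finally show ?thesis using c(3) that by simp
  qed
  define x where "x = U *\<^sub>v c"
  have x: "x \<in> carrier_vec n" using uU by (auto simp: x_def intro: carrier_vecI)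
  have Ux: "adj U *\<^sub>v x = c"
    unfolding x_def using uU c(1) by (simp add: mult_vec_assoc_dim[symmetric])
  define d where "d = adj V *\<^sub>v x"
  have d: "d \<in> carrier_vec n" using uV by (auto simp: d_def intro: carrier_vecI)
  have d0: "d $ p = 0" if "p < i" for p
  proof -
    have p: "p < n" using that i by simp
    have "d = (adj V * U) *\<^sub>v c"
      unfolding d_def x_def using uU uV c(1) by (simp add: mult_vec_assoc_dim)
    then have "d $ p = (\<Sum>l\<in>{0..<n}. (adj V * U) $$ (p, l) * c $ l)"
      using p c uU uV by (simp add: scalar_prod_def[of _ c] row_def del: index_mult_mat(1))
    also have "\<dots> = (\<Sum>l\<in>{0..<n}. M $$ (p, l) * c $ l)"
      using that p by (intro sum.cong) (auto simp: M_def)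
    also have "\<dots> = (M *\<^sub>v c) $ p" using p c(1) M by (simp add: scalar_prod_def row_def)
    finally show ?thesis using c(3) p by simp
  qed
  have sq: "sqn d = sqn c" "sqn c > 0"
  proof -
    have "sqn d = sqn x" unfolding d_def using x by (intro sqn_unitary[OF unitary_adjoint[OF V]]) auto
    then show "sqn d = sqn c" using sqn_unitary[OF U, of c] c(1) by (simp add: x_def)
    show "sqn c > 0" using c(1,2) sqn_eq_0[of c] sqn_nonneg[of c] by (simp add: less_le)
  qed
  have "a i * sqn c = (\<Sum>p<n. a i * (cmod (c $ p))\<^sup>2)"
    using c(1) by (simp add: sqn_def sum_distrib_left)
  also have "\<dots> \<le> (\<Sum>p<n. a p * (cmod (c $ p))\<^sup>2)"
  proof (rule sum_mono)
    fix p assume "p \<in> {..<n}"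
    then show "a i * (cmod (c $ p))\<^sup>2 \<le> a p * (cmod (c $ p))\<^sup>2"
      using a[of p i] c0[of p] i by (cases "p \<le> i") (auto intro: mult_right_mono)
  qed
  also have "\<dots> = form (U * rdiag n n a * adj U) x"
    using form_conj_rdiag[OF U x] Ux by simp
  also have "\<dots> \<le> form (V * rdiag n n b * adj V) x" by (rule le[OF x])
  also have "\<dots> = (\<Sum>p<n. b p * (cmod (d $ p))\<^sup>2)"
    using form_conj_rdiag[OF V x] by (simp add: d_def)
  also have "\<dots> \<le> (\<Sum>p<n. b i * (cmod (d $ p))\<^sup>2)"
  proof (rule sum_mono)
    fix p assume "p \<in> {..<n}"
    then show "b p * (cmod (d $ p))\<^sup>2 \<le> b i * (cmod (d $ p))\<^sup>2"
      using b[of i p] d0[of p] by (cases "i \<le> p") (auto intro: mult_right_mono)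
  qed
  also have "\<dots> = b i * sqn c"
    unfolding sq(1)[symmetric] using d by (simp add: sqn_def sum_distrib_left)
  finally show ?thesis using sq(2) by simp
qed

lemma conj_rdiag_hermitian:
  assumes "unitary_mat n U"
  shows "adj (U * rdiag n n d * adj U) = U * rdiag n n d * adj U"
  using unitaryD[OF assms] by (simp add: adjoint_mult mult_assoc_dim)

lemma adjoint_add:
  fixes A :: "complex mat"
  shows "A \<in> carrier_mat m n \<Longrightarrow> B \<in> carrier_mat m n \<Longrightarrow> adj (A + B) = adj A + adj B"
  by (rule eq_matI) auto

text \<open>The argument of Li and Mathias: with \<open>t = c\<^sub>j\<close> the \<open>j\<close>-th eigenvalue of the perturbation
  \<open>C = B - A\<close> and \<open>P\<close> the positive part of \<open>C - t\<close>, one has \<open>A \<le> A + P\<close> and \<open>B \<le> A + P + t\<close>.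
  The eigenvalues of \<open>A + P\<close> are separated from those of \<open>A\<close> by at most the trace of \<open>P\<close> in total.\<close>

theorem lidskii:
  assumes U: "unitary_mat n U" and a: "\<And>i j. i \<le> j \<Longrightarrow> j < n \<Longrightarrow> a j \<le> a i"
    and V: "unitary_mat n V" and b: "\<And>i j. i \<le> j \<Longrightarrow> j < n \<Longrightarrow> b j \<le> b i"
    and W: "unitary_mat n W" and c: "\<And>i j. i \<le> j \<Longrightarrow> j < n \<Longrightarrow> c j \<le> c i"
    and eq: "V * rdiag n n b * adj V =
      U * rdiag n n a * adj U + W * rdiag n n c * adj W"
    and J: "J \<subseteq> {..<n}"
  shows "(\<Sum>i\<in>J. b i - a i) \<le> (\<Sum>i<card J. c i)"
proof (cases "card J = 0")
  case True
  then have "J = {}" using J finite_subset[OF J] by simp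
  then show ?thesis by simp
next
  case False
  define A where "A = U * rdiag n n a * adj U"
  define j where "j = card J"
  have j: "0 < j" "j \<le> n" using False card_mono[OF _ J] by (auto simp: j_def)
  define t where "t = c (j - 1)"
  define P where "P = W * rdiag n n (\<lambda>i. max (c i - t) 0) * adj W"
  have A: "A \<in> carrier_mat n n" "adj A = A"
    unfolding A_def using conj_rdiag_carrier[OF U U] conj_rdiag_hermitian[OF U] by simp_all
  have P: "P \<in> carrier_mat n n" "adj P = P"
    unfolding P_def using conj_rdiag_carrier[OF W W] conj_rdiag_hermitian[OF W] by simp_all
  have "adj (A + P) = A + P" using A P by (simp add: adjoint_add)
  from hermitian_diagonalization[OF _ this] A P obtain S d where S: "unitary_mat n S"
    "A + P = S * rdiag n n d * adj S" and d: "\<And>i j. i \<le> j \<Longrightarrow> j < n \<Longrightarrow> d j \<le> d i"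
    by (metis add_carrier_mat)
  have formP: "0 \<le> form P x" if "x \<in> carrier_vec n" for x
    unfolding P_def using that by (simp add: form_conj_rdiag[OF W] sum_nonneg)
  \<comment> \<open>from \<open>A \<le> A + P\<close>\<close>
  have ad: "a i \<le> d i" if "i < n" for i
  proof (rule weyl_monotone[OF U _ S(1) _ _ that])
    fix x :: "complex vec" assume x: "x \<in> carrier_vec n"
    show "form (U * rdiag n n a * adj U) x \<le> form (S * rdiag n n d * adj S) x"
      unfolding A_def[symmetric] S(2)[symmetric] using form_add[OF A(1) P(1) x] formP[OF x] by simp
  qed (use a d in auto)
  \<comment> \<open>from \<open>B \<le> A + P + t\<close>\<close>
  have bd: "b i \<le> d i + t" if "i < n" for i
  proof (rule weyl_monotone[OF V _ S(1) _ _ that])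
    fix x :: "complex vec" assume x: "x \<in> carrier_vec n"
    have "form (W * rdiag n n c * adj W) x \<le> form P x + t * sqn x"
    proof -
      have "t * sqn x = t * sqn (adj W *\<^sub>v x)"
        using sqn_unitary[OF unitary_adjoint[OF W], of x] x by simp
      also have "\<dots> = (\<Sum>i<n. t * (cmod ((adj W *\<^sub>v x) $ i))\<^sup>2)"
        using unitaryD[OF W] by (simp add: sqn_def sum_distrib_left)
      finally have "form P x + t * sqn x =
          (\<Sum>i<n. (max (c i - t) 0 + t) * (cmod ((adj W *\<^sub>v x) $ i))\<^sup>2)"
        unfolding P_def by (simp add: form_conj_rdiag[OF W x] sum.distrib distrib_right)
      moreover have "form (W * rdiag n n c * adj W) x \<le> \<dots>"
        unfolding form_conj_rdiag[OF W x] by (intro sum_mono mult_right_mono) auto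
      ultimately show ?thesis by simp
    qed
    moreover have "form (S * rdiag n n (\<lambda>i. d i + t) * adj S) x = form (A + P) x + t * sqn x"
    proof -
      have "t * sqn x = t * sqn (adj S *\<^sub>v x)"
        using sqn_unitary[OF unitary_adjoint[OF S(1)], of x] x by simp
      also have "\<dots> = (\<Sum>i<n. t * (cmod ((adj S *\<^sub>v x) $ i))\<^sup>2)"
        using unitaryD[OF S(1)] by (simp add: sqn_def sum_distrib_left)
      finally show ?thesis
        unfolding S(2) by (simp add: form_conj_rdiag[OF S(1) x] sum.distrib distrib_right)
    qed
    ultimately show "form (V * rdiag n n b * adj V) x \<le>
        form (S * rdiag n n (\<lambda>i. d i + t) * adj S) x"
      unfolding eq A_def[symmetric]
      using form_add[OF A(1) P(1) x] form_add[OF A(1) conj_rdiag_carrier[OF W W] x] by simp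
  qed (use b d in auto)
  have "complex_of_real (\<Sum>i<n. d i) = (\<Sum>i<n. (A + P) $$ (i, i))"
    unfolding S(2) trace_conj_rdiag[OF S(1)] ..
  also have "\<dots> = (\<Sum>i<n. A $$ (i, i)) + (\<Sum>i<n. P $$ (i, i))"
    using A P by (simp add: sum.distrib)
  also have "\<dots> = complex_of_real ((\<Sum>i<n. a i) + (\<Sum>i<n. max (c i - t) 0))"
    unfolding A_def P_def trace_conj_rdiag[OF U] trace_conj_rdiag[OF W] by simp
  finally have "(\<Sum>i<n. d i) = (\<Sum>i<n. a i) + (\<Sum>i<n. max (c i - t) 0)"
    by (simp only: of_real_eq_iff)
  moreover have "(\<Sum>i<n. max (c i - t) 0) = (\<Sum>i<j. c i - t)"
  proof (rule sum.mono_neutral_cong_right)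
    show "\<forall>i\<in>{..<n} - {..<j}. max (c i - t) 0 = 0"
      using c[of "j - 1"] j by (auto simp: t_def)
    show "max (c i - t) 0 = c i - t" if "i \<in> {..<j}" for i
      using c[of i "j - 1"] j that by (auto simp: t_def)
  qed (use j in auto)
  ultimately have tr: "(\<Sum>i<n. d i - a i) = (\<Sum>i<j. c i) - real j * t"
    by (simp add: sum_subtractf)
  have "(\<Sum>i\<in>J. b i - a i) \<le> (\<Sum>i\<in>J. (d i - a i) + t)"
    using bd J by (intro sum_mono) (force simp: algebra_simps)
  also have "\<dots> = (\<Sum>i\<in>J. d i - a i) + real j * t" by (simp add: sum.distrib j_def)
  also have "(\<Sum>i\<in>J. d i - a i) \<le> (\<Sum>i<n. d i - a i)"
    using ad J by (intro sum_mono2) auto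
  finally show ?thesis using tr by (simp add: j_def)
qed

section \<open>Perturbation of singular values\<close>

text \<open>Matrices of this shape multiply by pointwise arithmetic on the four sequences.\<close>

definition rblock :: "nat \<Rightarrow> (nat \<Rightarrow> real) \<Rightarrow> (nat \<Rightarrow> real) \<Rightarrow> (nat \<Rightarrow> real) \<Rightarrow> (nat \<Rightarrow> real) \<Rightarrow> complex mat" where
  "rblock n a b c d = four_block_mat (rdiag n n a) (rdiag n n b) (rdiag n n c) (rdiag n n d)"

lemma rblock_carrier: "rblock n a b c d \<in> carrier_mat (n + n) (n + n)"
  by (simp add: rblock_def)

lemma dim_rblock [simp]: "dim_row (rblock n a b c d) = n + n" "dim_col (rblock n a b c d) = n + n"
  by (simp_all add: rblock_def)

lemma rdiag_add: "rdiag m n d + rdiag m n e = rdiag m n (\<lambda>i. d i + e i)"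
  by (rule eq_matI) auto

lemma rblock_mult:
  "rblock n a b c d * rblock n a' b' c' d' =
    rblock n (\<lambda>i. a i * a' i + b i * c' i) (\<lambda>i. a i * b' i + b i * d' i)
      (\<lambda>i. c i * a' i + d i * c' i) (\<lambda>i. c i * b' i + d i * d' i)"
proof -
  have "rdiag n n f * rdiag n n g = rdiag n n (\<lambda>i. f i * g i)" for f g
    unfolding rdiag_mult by (rule rdiag_cong) auto
  then show ?thesis
    unfolding rblock_def
    by (subst mult_four_block_mat[of _ n n _ n _ n _ _ n _ n]) (simp_all add: rdiag_add)
qed

lemma rblock_diag:
  "rblock n f (\<lambda>i. 0) (\<lambda>i. 0) g = rdiag (n + n) (n + n) (\<lambda>i. if i < n then f i else g (i - n))"
  by (rule eq_matI) (auto simp: rblock_def)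

lemma rblock_adjoint: "adj (rblock n a b c d) = rblock n a c b d"
  by (rule eq_matI) (auto simp: rblock_def)

lemma rblock_cong:
  "(\<And>i. a i = a' i) \<Longrightarrow> (\<And>i. b i = b' i) \<Longrightarrow> (\<And>i. c i = c' i) \<Longrightarrow> (\<And>i. d i = d' i) \<Longrightarrow>
    rblock n a b c d = rblock n a' b' c' d'"
  by presburger

text \<open>The dilation is first diagonalized with the negative eigenvalues in the wrong order;
  a permutation of the eigenvectors corrects this.\<close>

lemma permute_diagonalization:
  assumes U: "unitary_mat n U" and p: "p permutes {..<n}"
  obtains U' where "unitary_mat n U'"
    "U * rdiag n n d * adj U = U' * rdiag n n (\<lambda>i. d (p i)) * adj U'"
proof -
  note u = unitaryD[OF U]
  define U' where "U' = mat n n (\<lambda>(i, j). U $$ (i, p j))"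
  have U': "U' \<in> carrier_mat n n" by (simp add: U'_def)
  have pn: "p i < n" if "i < n" for i using permutes_in_image[OF p, of i] that by simp
  have colU': "col U' i = col U (p i)" if "i < n" for i
    using that pn[OF that] u(2,3) by (intro eq_vecI) (auto simp: U'_def)
  have "adj U' * U' = 1\<^sub>m n"
  proof (rule eq_matI)
    fix i j assume "i < dim_row (1\<^sub>m n :: complex mat)" "j < dim_col (1\<^sub>m n :: complex mat)"
    then have ij: "i < n" "j < n" by auto
    have "(adj U' * U') $$ (i, j) = col U (p j) \<bullet>c col U (p i)"
      using ij U' entry_adjoint_mult[of i U' j U'] by (simp add: colU' del: index_mult_mat(1))
    also have "\<dots> = (adj U * U) $$ (p i, p j)"
      using ij pn u(2,3) entry_adjoint_mult[of "p i" U "p j" U] by (simp del: index_mult_mat(1))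
    also have "\<dots> = 1\<^sub>m n $$ (i, j)"
      unfolding u(4) using ij pn permutes_inj[OF p] by (auto dest: injD)
    finally show "(adj U' * U') $$ (i, j) = 1\<^sub>m n $$ (i, j)" .
  qed (use U' in auto)
  with U' have "unitary_mat n U'" by (intro unitaryI)
  moreover have "U * rdiag n n d * adj U = U' * rdiag n n (\<lambda>i. d (p i)) * adj U'"
  proof (rule eq_matI)
    fix i j assume "i < dim_row (U' * rdiag n n (\<lambda>i. d (p i)) * adj U')"
      "j < dim_col (U' * rdiag n n (\<lambda>i. d (p i)) * adj U')"
    then have ij: "i < n" "j < n" using U' by auto
    have entry: "(X * rdiag n n f * adj X) $$ (i, j) =
        (\<Sum>l<n. X $$ (i, l) * complex_of_real (f l) * cnj (X $$ (j, l)))" if X: "X \<in> carrier_mat n n" for X f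
    proof -
      have "(X * rdiag n n f * adj X) $$ (i, j) =
          (\<Sum>l\<in>{0..<n}. (X * rdiag n n f) $$ (i, l) * adj X $$ (l, j))"
        using ij X by (simp add: scalar_prod_def[of _ "col _ _"] row_def del: index_mult_mat(1))
          (simp add: scalar_prod_def)
      also have "\<dots> = (\<Sum>l<n. X $$ (i, l) * complex_of_real (f l) * cnj (X $$ (j, l)))"
        unfolding atLeast0LessThan using ij X
        by (intro sum.cong refl) (simp add: mult_rdiag_index del: index_mult_mat(1))
      finally show ?thesis .
    qed
    have "(U * rdiag n n d * adj U) $$ (i, j) =
        (\<Sum>l<n. U $$ (i, p l) * complex_of_real (d (p l)) * cnj (U $$ (j, p l)))"
      unfolding entry[OF u(1)] by (rule sum.permute[OF p, unfolded o_def])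
    also have "\<dots> = (U' * rdiag n n (\<lambda>i. d (p i)) * adj U') $$ (i, j)"
      unfolding entry[OF U'] using ij by (intro sum.cong) (auto simp: U'_def)
    finally show "(U * rdiag n n d * adj U) $$ (i, j) =
      (U' * rdiag n n (\<lambda>i. d (p i)) * adj U') $$ (i, j)" .
  qed (use U' u(2,3) in auto)
  ultimately show thesis using that by blast
qed

text \<open>The Hermitian dilation of \<open>F\<close> has the singular values of \<open>F\<close> and their negatives as eigenvalues,
  with eigenvectors \<open>(v\<^sub>i, w\<^sub>i)\<close> and \<open>(v\<^sub>i, - w\<^sub>i)\<close>.\<close>

definition dilation :: "complex mat \<Rightarrow> complex mat" where
  "dilation F = four_block_mat (0\<^sub>m (dim_row F) (dim_row F)) F (adj F) (0\<^sub>m (dim_col F) (dim_col F))"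

lemma four_block_conj:
  assumes V: "V \<in> carrier_mat n n" and W: "W \<in> carrier_mat n n" and S: "S \<in> carrier_mat n n"
  shows "bdiag V W * dilation S * adj (bdiag V W) = dilation (V * S * adj W)"
proof -
  have d: "dim_row V = n" "dim_col V = n" "dim_row W = n" "dim_col W = n" "dim_row S = n" "dim_col S = n"
    using assms by auto
  have "bdiag V W * dilation S =
      four_block_mat (0\<^sub>m n n) (V * S) (W * adj S) (0\<^sub>m n n)"
    unfolding bdiag_def dilation_def d
    by (subst mult_four_block_mat[of _ n n _ n _ n _ _ n _ n]) (use assms in \<open>auto intro: cong_four_block_mat\<close>)
  also have "\<dots> * bdiag (adj V) (adj W) =
      four_block_mat (0\<^sub>m n n) (V * S * adj W) (W * adj S * adj V) (0\<^sub>m n n)"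
    unfolding bdiag_def dim_adjoint d
    by (subst mult_four_block_mat[of _ n n _ n _ n _ _ n _ n]) (use assms in \<open>auto intro: cong_four_block_mat\<close>)
  also have "\<dots> = dilation (V * S * adj W)"
    unfolding dilation_def by (simp add: d adjoint_mult mult_assoc_dim)
  finally show ?thesis by (simp add: bdiag_adjoint)
qed

text \<open>In the singular bases the dilation is \<open>[[0, \<Sigma>], [\<Sigma>, 0]]\<close>, and the symmetric unitary \<open>K\<close> with blocks
  \<open>\<plusminus> 1 / sqrt 2\<close> exchanges it with \<open>\<Sigma> \<oplus> (- \<Sigma>)\<close>.\<close>

lemma dilation_diagonalization:
  assumes V: "unitary_mat n V" and W: "unitary_mat n W"
    and f: "\<And>i j. i \<le> j \<Longrightarrow> j < n \<Longrightarrow> f j \<le> f i" "\<And>i. i < n \<Longrightarrow> 0 \<le> f i"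
    and g: "g = (\<lambda>i. if i < n then f i else - f (2 * n - 1 - i))"
  obtains U where "unitary_mat (n + n) U"
    "dilation (V * rdiag n n f * adj W) = U * rdiag (n + n) (n + n) g * adj U"
    "\<And>i j. i \<le> j \<Longrightarrow> j < n + n \<Longrightarrow> g j \<le> g i"
proof -
  define h where "h = (1 / sqrt 2 :: real)"
  have h: "h * h = 1 / 2" by (simp add: h_def)
  have hy: "h * y * h = y / 2" for y
  proof -
    have "h * y * h = y * (h * h)" by (simp only: mult_ac)
    then show ?thesis unfolding h by simp
  qed
  have hy': "h * (y * h) = y / 2" for y using hy[of y] by (simp only: mult.assoc)
  define K where "K = rblock n (\<lambda>i. h) (\<lambda>i. h) (\<lambda>i. h) (\<lambda>i. - h)"
  have K: "K \<in> carrier_mat (n + n) (n + n)" by (simp add: K_def rblock_carrier)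
  have Kh: "adj K = K" by (simp add: K_def rblock_adjoint)
  have "K * K = 1\<^sub>m (n + n)"
    by (simp add: K_def rblock_mult h rblock_diag rdiag_one)
  then have Ku: "unitary_mat (n + n) K" using K Kh by (intro unitaryI) auto
  define D where "D = rdiag (n + n) (n + n) (\<lambda>i. if i < n then f i else - f (i - n))"
  have D: "D = rblock n f (\<lambda>i. 0) (\<lambda>i. 0) (\<lambda>i. - f i)" by (simp add: D_def rblock_diag)
  have "K * D * adj K = rblock n (\<lambda>i. 0) f f (\<lambda>i. 0)"
    unfolding Kh unfolding D K_def rblock_mult
    by (rule rblock_cong) (simp_all add: hy hy')
  also have "\<dots> = dilation (rdiag n n f)"
    unfolding rblock_def dilation_def
    by (intro cong_four_block_mat eq_matI) auto
  finally have KD: "K * D * adj K = dilation (rdiag n n f)" .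
  define Q where "Q = bdiag V W * K"
  have bu: "unitary_mat (n + n) (bdiag V W)" by (rule bdiag_unitary[OF V W])
  have Q: "unitary_mat (n + n) Q" unfolding Q_def by (rule unitary_mult[OF bu Ku])
  have QD: "dilation (V * rdiag n n f * adj W) = Q * D * adj Q"
  proof -
    have "Q * D * adj Q = bdiag V W * (K * D * adj K) * adj (bdiag V W)"
      unfolding Q_def using unitaryD[OF bu] K
      by (simp add: D_def adjoint_mult mult_assoc_dim)
    then show ?thesis
      unfolding KD using four_block_conj[OF unitaryD(1)[OF V] unitaryD(1)[OF W], of "rdiag n n f"]
      by simp
  qed
  \<comment> \<open>Reversal of the second half, which sorts the eigenvalues \<open>- f\<^sub>0 \<le> - f\<^sub>1 \<le> \<dots>\<close> decreasingly.\<close>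
  define p where "p i = (if n \<le> i \<and> i < n + n then 3 * n - 1 - i else i)" for i
  have p: "p permutes {..<n + n}"
  proof (rule bij_imp_permutes)
    show "bij_betw p {..<n + n} {..<n + n}"
    proof (rule bij_betw_byWitness[where f' = p])
      have pp: "p (p i) = i \<and> p i < n + n" if "i < n + n" for i
      proof (cases "n \<le> i")
        case True
        then have "p i = 3 * n - 1 - i" "n \<le> 3 * n - 1 - i" "3 * n - 1 - i < n + n"
          using that by (auto simp: p_def)
        moreover have "3 * n - 1 - (3 * n - 1 - i) = i" using that by simp
        ultimately show ?thesis by (simp add: p_def)
      qed (use that in \<open>simp add: p_def\<close>)
      then show "\<forall>i\<in>{..<n + n}. p (p i) = i" "\<forall>i\<in>{..<n + n}. p (p i) = i"
        "p ` {..<n + n} \<subseteq> {..<n + n}" "p ` {..<n + n} \<subseteq> {..<n + n}"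
        by auto
    qed
    show "p i = i" if "i \<notin> {..<n + n}" for i using that by (auto simp: p_def)
  qed
  obtain U where U: "unitary_mat (n + n) U"
    "Q * D * adj Q = U * rdiag (n + n) (n + n) (\<lambda>i. if p i < n then f (p i) else - f (p i - n)) * adj U"
    by (rule permute_diagonalization[OF Q p, of "\<lambda>i. if i < n then f i else - f (i - n)"],
        rule that, unfold D_def)
  have "rdiag (n + n) (n + n) (\<lambda>i. if p i < n then f (p i) else - f (p i - n)) = rdiag (n + n) (n + n) g"
  proof (rule rdiag_cong)
    fix i assume "i < n + n"
    moreover have "3 * n - 1 - i - n = 2 * n - 1 - i" by simp
    moreover have "\<not> 3 * n - 1 - i < n" using \<open>i < n + n\<close> by linarith
    ultimately show "(if p i < n then f (p i) else - f (p i - n)) = g i"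
      by (auto simp: p_def g)
  qed
  moreover have "g j \<le> g i" if "i \<le> j" "j < n + n" for i j
  proof (cases "j < n")
    case True
    then show ?thesis using f(1)[OF that(1)] that(1) by (simp add: g)
  next
    case False
    have "0 \<le> f (2 * n - 1 - j)" by (rule f(2)) (use False that in linarith)
    moreover have "0 \<le> f i" if "i < n" using that by (rule f(2))
    moreover have "f (2 * n - 1 - i) \<le> f (2 * n - 1 - j)" if "\<not> i < n"
      by (rule f(1)) (use that \<open>i \<le> j\<close> \<open>j < n + n\<close> in linarith)+
    ultimately show ?thesis using False by (auto simp: g)
  qed
  ultimately show thesis using that[OF U(1)] QD U(2) by simp
qed

text \<open>An index \<open>i\<close> with \<open>f\<^sub>i \<ge> x\<^sub>i\<close> is represented by the \<open>i\<close>-th largest eigenvalue of the dilations,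
  the other ones by the \<open>i\<close>-th smallest eigenvalue, for which the difference has the opposite sign.\<close>

lemma singular_value_perturbation_square:
  assumes V: "unitary_mat n V" "unitary_mat n W" and A: "unitary_mat n A" "unitary_mat n B"
    and C: "unitary_mat n C" "unitary_mat n D"
    and f: "decseq f" "\<And>i. 0 \<le> f i" and x: "decseq x" "\<And>i. 0 \<le> x i" and g: "decseq g" "\<And>i. 0 \<le> g i"
    and eq: "V * rdiag n n f * adj W - A * rdiag n n x * adj B = C * rdiag n n g * adj D"
    and J: "J \<subseteq> {..<n}"
  shows "(\<Sum>i\<in>J. \<bar>f i - x i\<bar>) \<le> (\<Sum>i<card J. g i)"
proof -
  define dl where "dl s = (\<lambda>i. if i < n then s i else - s (2 * n - 1 - i))" for s :: "nat \<Rightarrow> real"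
  have df: "f j \<le> f i" and dx: "x j \<le> x i" and dg: "g j \<le> g i"
    if "i \<le> j" "j < n" for i j
    using decseqD[OF f(1) that(1)] decseqD[OF x(1) that(1)] decseqD[OF g(1) that(1)] .
  have nnf: "0 \<le> f i" and nnx: "0 \<le> x i" and nng: "0 \<le> g i" if "i < n" for i
    using f(2) x(2) g(2) .
  define F where "F = V * rdiag n n f * adj W"
  define X where "X = A * rdiag n n x * adj B"
  define G where "G = C * rdiag n n g * adj D"
  have cF: "F \<in> carrier_mat n n" unfolding F_def by (rule conj_rdiag_carrier[OF V])
  have cX: "X \<in> carrier_mat n n" unfolding X_def by (rule conj_rdiag_carrier[OF A])
  obtain P where P: "unitary_mat (n + n) P" "dilation F = P * rdiag (n + n) (n + n) (dl f) * adj P"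
    "\<And>i j. i \<le> j \<Longrightarrow> j < n + n \<Longrightarrow> dl f j \<le> dl f i"
    by (rule dilation_diagonalization[OF V df nnf dl_def], assumption+, rule that, unfold F_def)
  obtain Q where Q: "unitary_mat (n + n) Q" "dilation X = Q * rdiag (n + n) (n + n) (dl x) * adj Q"
    "\<And>i j. i \<le> j \<Longrightarrow> j < n + n \<Longrightarrow> dl x j \<le> dl x i"
    by (rule dilation_diagonalization[OF A dx nnx dl_def], assumption+, rule that, unfold X_def)
  obtain R where R: "unitary_mat (n + n) R" "dilation G = R * rdiag (n + n) (n + n) (dl g) * adj R"
    "\<And>i j. i \<le> j \<Longrightarrow> j < n + n \<Longrightarrow> dl g j \<le> dl g i"
    by (rule dilation_diagonalization[OF C dg nng dl_def], assumption+, rule that, unfold G_def)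
  have "dilation F = dilation X + dilation (F - X)"
    using cF cX by (intro eq_matI) (auto simp: dilation_def)
  then have dil: "P * rdiag (n + n) (n + n) (dl f) * adj P =
      Q * rdiag (n + n) (n + n) (dl x) * adj Q + R * rdiag (n + n) (n + n) (dl g) * adj R"
    unfolding P(2)[symmetric] Q(2)[symmetric] R(2)[symmetric]
    using eq by (simp add: F_def X_def G_def)
  define \<tau> where "\<tau> i = (if x i \<le> f i then i else 2 * n - 1 - i)" for i
  have fin: "finite J" using finite_subset[OF J] by simp
  have inj: "inj_on \<tau> J"
  proof (rule inj_onI)
    fix i j assume "i \<in> J" "j \<in> J" "\<tau> i = \<tau> j"
    moreover have "i < n" "j < n" using \<open>i \<in> J\<close> \<open>j \<in> J\<close> J by auto
    ultimately show "i = j" by (auto simp: \<tau>_def split: if_splits)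
  qed
  have sub: "\<tau> ` J \<subseteq> {..<n + n}" using J by (auto simp: \<tau>_def)
  have "(\<Sum>i\<in>J. \<bar>f i - x i\<bar>) = (\<Sum>i\<in>J. dl f (\<tau> i) - dl x (\<tau> i))"
  proof (rule sum.cong)
    fix i assume "i \<in> J"
    then have "i < n" using J by auto
    then have "2 * n - 1 - (2 * n - 1 - i) = i" "\<not> 2 * n - 1 - i < n" by auto
    then show "\<bar>f i - x i\<bar> = dl f (\<tau> i) - dl x (\<tau> i)"
      using \<open>i < n\<close> by (auto simp: dl_def \<tau>_def)
  qed simp
  also have "\<dots> = (\<Sum>i\<in>\<tau> ` J. dl f i - dl x i)"
    using inj by (simp add: sum.reindex)
  also have "\<dots> \<le> (\<Sum>i<card (\<tau> ` J). dl g i)"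
    by (rule lidskii[OF Q(1,3) P(1,3) R(1,3) dil sub])
  also have "card (\<tau> ` J) = card J" by (rule card_image[OF inj])
  also have "(\<Sum>i<card J. dl g i) = (\<Sum>i<card J. g i)"
    using card_mono[OF _ J] by (intro sum.cong) (auto simp: dl_def)
  finally show ?thesis .
qed

text \<open>The inequality of Mirsky, in the form of a weak majorization. Padding with zeros to a square
  matrix only adds singular values \<open>0\<close>, which the sequence \<open>sv\<close> already contains.\<close>

theorem singular_value_perturbation:
  assumes F: "F \<in> carrier_mat m n" and X: "X \<in> carrier_mat m n" and J: "J \<subseteq> {..<min m n}"
  shows "(\<Sum>i\<in>J. \<bar>sv F i - sv X i\<bar>) \<le> (\<Sum>i<card J. sv (F - X) i)"
proof -
  define N where "N = max m n"
  define pad where "pad Y = bdiag Y (0\<^sub>m (N - m) (N - n))" for Y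
  have svd: "\<exists>V W. unitary_mat N V \<and> unitary_mat N W \<and> pad Y = V * rdiag N N (sv Y) * adj W"
    if Y: "Y \<in> carrier_mat m n" for Y
  proof -
    obtain V W where V: "unitary_mat m V" and W: "unitary_mat n W"
      and eq: "Y = V * rdiag m n (sv Y) * adj W"
      by (rule svd_sv[OF Y], rule that)
    note uV = unitaryD[OF V] and uW = unitaryD[OF W]
    define V' where "V' = bdiag V (1\<^sub>m (N - m))"
    define W' where "W' = bdiag W (1\<^sub>m (N - n))"
    have NN: "m + (N - m) = N" "n + (N - n) = N" by (auto simp: N_def)
    have V': "unitary_mat N V'" "unitary_mat N W'"
      using bdiag_unitary[OF V unitary_one[of "N - m"]] bdiag_unitary[OF W unitary_one[of "N - n"]]
      unfolding V'_def W'_def NN .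
    have z: "sv Y i = 0" if "\<not> i < min m n" for i
      using that mat_rank_le[OF Y] sv_nonzero_iff[OF Y, of i] by auto
    have "rdiag N N (sv Y) = bdiag (rdiag m n (sv Y)) (0\<^sub>m (N - m) (N - n))"
    proof (rule eq_matI)
      fix i j assume "i < dim_row (bdiag (rdiag m n (sv Y)) (0\<^sub>m (N - m) (N - n)))"
        "j < dim_col (bdiag (rdiag m n (sv Y)) (0\<^sub>m (N - m) (N - n)))"
      then show "rdiag N N (sv Y) $$ (i, j) = bdiag (rdiag m n (sv Y)) (0\<^sub>m (N - m) (N - n)) $$ (i, j)"
        using z[of i] NN by (auto simp: index_bdiag)
    qed (use NN in auto)
    then have "V' * rdiag N N (sv Y) * adj W' =
        bdiag (V * rdiag m n (sv Y) * adj W) (0\<^sub>m (N - m) (N - n))"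
      unfolding V'_def W'_def using uV uW by (simp add: bdiag_adjoint bdiag_mult)
    also have "\<dots> = pad Y" unfolding pad_def eq[symmetric] ..
    finally show ?thesis using V' by metis
  qed
  have FX: "F - X \<in> carrier_mat m n" using F X by auto
  obtain V W where V: "unitary_mat N V" "unitary_mat N W" "pad F = V * rdiag N N (sv F) * adj W"
    using svd[OF F] by metis
  obtain A B where A: "unitary_mat N A" "unitary_mat N B" "pad X = A * rdiag N N (sv X) * adj B"
    using svd[OF X] by metis
  obtain C D where C: "unitary_mat N C" "unitary_mat N D"
    "pad (F - X) = C * rdiag N N (sv (F - X)) * adj D"
    using svd[OF FX] by metis
  have "pad F - pad X = pad (F - X)"
    unfolding pad_def using F X by (intro eq_matI) (auto simp: index_bdiag)
  then have eq: "V * rdiag N N (sv F) * adj W - A * rdiag N N (sv X) * adj B =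
      C * rdiag N N (sv (F - X)) * adj D"
    unfolding V(3) A(3) C(3) .
  have "J \<subseteq> {..<N}" using J by (auto simp: N_def less_max_iff_disj dest!: subsetD)
  then show ?thesis
    by (rule singular_value_perturbation_square[OF V(1,2) A(1,2) C(1,2) decseq_sv[OF F] sv_nonneg[OF F]
      decseq_sv[OF X] sv_nonneg[OF X] decseq_sv[OF FX] sv_nonneg[OF FX] eq])
qed

text \<open>Both sides are the squared Frobenius norm: the left side is seen by the majorization, the right
  side is a quadratic form in the entries.\<close>

lemma sum_sv_squares:
  assumes F: "F \<in> carrier_mat m n"
  shows "complex_of_real (\<Sum>i<min m n. (sv F i)\<^sup>2) = (\<Sum>i<n. (adj F * F) $$ (i, i))"
proof -
  obtain V W where V: "unitary_mat m V" and W: "unitary_mat n W"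
    and eq: "F = V * rdiag m n (sv F) * adj W"
    by (rule svd_sv[OF F], rule that)
  note uV = unitaryD[OF V] and uW = unitaryD[OF W]
  define s where "s = sv F"
  have "adj F * F = adj (V * rdiag m n s * adj W) * (V * rdiag m n s * adj W)"
    using eq unfolding s_def by (simp only:)
  also have "\<dots> = W * (rdiag n m s * rdiag m n s) * adj W"
    using uV uW by (simp add: adjoint_mult mult_assoc_dim)
  also have "rdiag n m s * rdiag m n s = rdiag n n (\<lambda>i. if i < min m n then (s i)\<^sup>2 else 0)"
    unfolding rdiag_mult by (rule rdiag_cong) (auto simp: power2_eq_square)
  finally have "(\<Sum>i<n. (adj F * F) $$ (i, i)) =
      complex_of_real (\<Sum>i<n. if i < min m n then (s i)\<^sup>2 else 0)"
    using trace_conj_rdiag[OF W] by (simp only:)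
  also have "(\<Sum>i<n. if i < min m n then (s i)\<^sup>2 else 0) = (\<Sum>i<min m n. (s i)\<^sup>2)"
    by (rule sum.mono_neutral_cong_right) auto
  finally show ?thesis by (simp add: s_def)
qed

section \<open>Strictly convex symmetric gauge functions\<close>

definition gauge :: "(real vec \<Rightarrow> real) \<Rightarrow> nat \<Rightarrow> (nat \<Rightarrow> real) \<Rightarrow> real" where
  "gauge \<Phi> q x = \<Phi> (vec q x)"

lemma gauge_cong: "(\<And>i. i < q \<Longrightarrow> x i = y i) \<Longrightarrow> gauge \<Phi> q x = gauge \<Phi> q y"
  unfolding gauge_def by (rule arg_cong[where f = \<Phi>]) auto

lemma gauge_perm:
  assumes "symmetric_gauge q \<Phi>" "p permutes {..<q}"
  shows "gauge \<Phi> q (\<lambda>i. \<bar>x (p i)\<bar>) = gauge \<Phi> q x"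
proof -
  have "p i < q" if "i < q" for i using permutes_in_image[OF assms(2), of i] that by simp
  then have "vec q (\<lambda>i. \<bar>vec q x $ p i\<bar>) = vec q (\<lambda>i. \<bar>x (p i)\<bar>)" by auto
  moreover have "\<forall>x\<in>carrier_vec q. \<forall>\<sigma>. \<sigma> permutes {..<q} \<longrightarrow> \<Phi> x = \<Phi> (vec q (\<lambda>i. \<bar>x $ \<sigma> i\<bar>))"
    using assms(1) unfolding symmetric_gauge_def by (rule conjunct2)
  then have "\<Phi> (vec q x) = \<Phi> (vec q (\<lambda>i. \<bar>vec q x $ p i\<bar>))"
    using assms(2) vec_carrier by blast
  ultimately show ?thesis by (simp add: gauge_def)
qed

lemma gauge_abs:
  assumes "symmetric_gauge q \<Phi>"
  shows "gauge \<Phi> q (\<lambda>i. \<bar>x i\<bar>) = gauge \<Phi> q x"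
  using gauge_perm[OF assms permutes_id, of x] by simp

lemma gauge_scale:
  assumes "symmetric_gauge q \<Phi>"
  shows "gauge \<Phi> q (\<lambda>i. c * x i) = \<bar>c\<bar> * gauge \<Phi> q x"
proof -
  have "vec q (\<lambda>i. c * x i) = c \<cdot>\<^sub>v vec q x" by auto
  moreover have "norm_on q \<Phi>" using assms unfolding symmetric_gauge_def by (rule conjunct1)
  ultimately show ?thesis by (simp add: gauge_def norm_on_def)
qed

text \<open>Strict convexity is assumed on the unit sphere; homogeneity carries it to spheres of any radius.\<close>

lemma gauge_convex_less:
  assumes sym: "symmetric_gauge q \<Phi>" and conv: "strictly_convex_gauge q \<Phi>"
    and eq: "gauge \<Phi> q x = gauge \<Phi> q y" and ne: "i < q" "x i \<noteq> y i" and t: "0 < t" "t < 1"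
  shows "gauge \<Phi> q (\<lambda>i. t * x i + (1 - t) * y i) < gauge \<Phi> q y"
proof -
  define c where "c = gauge \<Phi> q y"
  have nonneg: "0 \<le> gauge \<Phi> q z" and zero: "gauge \<Phi> q z = 0 \<longleftrightarrow> vec q z = 0\<^sub>v q" for z
    using conjunct1[OF sym[unfolded symmetric_gauge_def]] by (auto simp: gauge_def norm_on_def)
  have "c \<noteq> 0"
  proof
    assume "c = 0"
    then have "gauge \<Phi> q y = 0" "gauge \<Phi> q x = 0" using eq by (simp_all add: c_def)
    then have "vec q x = 0\<^sub>v q" "vec q y = 0\<^sub>v q" by (simp_all only: zero)
    then have "vec q x $ i = vec q y $ i" by simp
    then show False using ne by simp
  qed
  then have c: "0 < c" using nonneg[of y] by (simp add: c_def)
  define x' y' where "x' = vec q (\<lambda>i. 1 / c * x i)" and "y' = vec q (\<lambda>i. 1 / c * y i)"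
  have "\<Phi> x' = 1" "\<Phi> y' = 1"
    using gauge_scale[OF sym, of "1 / c" x] gauge_scale[OF sym, of "1 / c" y] c eq
    by (auto simp: x'_def y'_def gauge_def c_def)
  moreover have "x' \<noteq> y'"
  proof
    assume "x' = y'"
    then have "x' $ i = y' $ i" by simp
    then show False using ne c by (simp add: x'_def y'_def)
  qed
  moreover have "x' \<in> carrier_vec q" "y' \<in> carrier_vec q" by (auto simp: x'_def y'_def)
  ultimately have "\<Phi> (t \<cdot>\<^sub>v x' + (1 - t) \<cdot>\<^sub>v y') < 1"
    using conv t unfolding strictly_convex_gauge_def by blast
  also have "t \<cdot>\<^sub>v x' + (1 - t) \<cdot>\<^sub>v y' = vec q (\<lambda>i. 1 / c * (t * x i + (1 - t) * y i))"
    by (intro eq_vecI) (auto simp: x'_def y'_def algebra_simps add_divide_distrib diff_divide_distrib)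
  finally have "1 / c * gauge \<Phi> q (\<lambda>i. t * x i + (1 - t) * y i) < 1"
    using gauge_scale[OF sym, of "1 / c" "\<lambda>i. t * x i + (1 - t) * y i"] c by (simp add: gauge_def)
  then show ?thesis using c by (simp add: c_def field_simps)
qed

text \<open>Changing the sign of an entry preserves the gauge, and a smaller entry is a convex combination of
  the two signs.\<close>

lemma gauge_decrease_coordinate:
  assumes sym: "symmetric_gauge q \<Phi>" and conv: "strictly_convex_gauge q \<Phi>"
    and i: "i < q" and a: "0 \<le> a" "a < y i"
  shows "gauge \<Phi> q (y(i := a)) < gauge \<Phi> q y"
proof -
  define z where "z = y(i := - y i)"
  have z: "gauge \<Phi> q z = gauge \<Phi> q y"
  proof -
    have "(\<lambda>j. \<bar>z j\<bar>) = (\<lambda>j. \<bar>y j\<bar>)" by (auto simp: z_def)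
    then show ?thesis using gauge_abs[OF sym, of z] gauge_abs[OF sym, of y] by simp
  qed
  define t where "t = (1 - a / y i) / 2"
  have "gauge \<Phi> q (\<lambda>j. t * z j + (1 - t) * y j) < gauge \<Phi> q y"
    by (rule gauge_convex_less[OF sym conv z i]) (use a in \<open>auto simp: z_def t_def field_simps\<close>)
  moreover have "(\<lambda>j. t * z j + (1 - t) * y j) = y(i := a)"
    using a by (auto simp: z_def t_def field_simps)
  ultimately show ?thesis by (simp only:)
qed

text \<open>A transfer from a larger to a smaller entry is a convex combination of \<open>y\<close> and \<open>y\<close> with
  the two entries exchanged.\<close>

lemma gauge_transfer:
  assumes sym: "symmetric_gauge q \<Phi>" and conv: "strictly_convex_gauge q \<Phi>"
    and ij: "i < q" "j < q" "i \<noteq> j" and y: "\<And>l. l < q \<Longrightarrow> 0 \<le> y l"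
    and \<delta>: "0 < \<delta>" "\<delta> < y i - y j"
  shows "gauge \<Phi> q (y(i := y i - \<delta>, j := y j + \<delta>)) < gauge \<Phi> q y"
proof -
  define z where "z l = y (transpose i j l)" for l
  have p: "transpose i j permutes {..<q}"
    by (rule permutes_swap_id) (use ij in auto)
  have "gauge \<Phi> q z = gauge \<Phi> q (\<lambda>l. \<bar>y (transpose i j l)\<bar>)"
    using permutes_in_image[OF p] y by (intro gauge_cong) (auto simp: z_def)
  then have z: "gauge \<Phi> q z = gauge \<Phi> q y" using gauge_perm[OF sym p, of y] by simp
  define t where "t = \<delta> / (y i - y j)"
  have t: "t * (y i - y j) = \<delta>" using \<delta> by (simp add: t_def)
  have "gauge \<Phi> q (\<lambda>l. t * z l + (1 - t) * y l) < gauge \<Phi> q y"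
    by (rule gauge_convex_less[OF sym conv z ij(1)]) (use \<delta> in \<open>auto simp: z_def t_def\<close>)
  moreover have "(\<lambda>l. t * z l + (1 - t) * y l) = y(i := y i - \<delta>, j := y j + \<delta>)"
    using t ij(3) by (auto simp: z_def transpose_def algebra_simps)
  ultimately show ?thesis by (simp only:)
qed

text \<open>Induction on the number of positions at which \<open>x\<close> and \<open>y\<close> differ: a decrease of one entry or a
  transfer moves \<open>y\<close> towards \<open>x\<close>, makes at least one more entry agree, and strictly decreases the gauge.\<close>

lemma gauge_weak_majorization_sorted:
  assumes sym: "symmetric_gauge q \<Phi>" and conv: "strictly_convex_gauge q \<Phi>"
    and x: "\<And>i. i < q \<Longrightarrow> 0 \<le> x i" "\<And>i j. i \<le> j \<Longrightarrow> j < q \<Longrightarrow> x j \<le> x i"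
    and "\<And>i. i < q \<Longrightarrow> 0 \<le> y i" "\<And>l. l \<le> q \<Longrightarrow> (\<Sum>i<l. x i) \<le> (\<Sum>i<l. y i)"
  shows "(\<forall>i<q. x i = y i) \<or> gauge \<Phi> q x < gauge \<Phi> q y"
  using assms(5,6)
proof (induction "card {i. i < q \<and> x i \<noteq> y i}" arbitrary: y rule: less_induct)
  case less
  note y = less.prems(1) and maj = less.prems(2)
  let ?N = "\<lambda>y. {i. i < q \<and> x i \<noteq> y i}"
  show ?case
  proof (cases "\<forall>i<q. x i = y i")
    case False
    have step: "gauge \<Phi> q x < gauge \<Phi> q y"
      if y': "gauge \<Phi> q y' < gauge \<Phi> q y" "?N y' \<subset> ?N y" "\<And>i. i < q \<Longrightarrow> 0 \<le> y' i"
        "\<And>l. l \<le> q \<Longrightarrow> (\<Sum>i<l. x i) \<le> (\<Sum>i<l. y' i)" for y'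
    proof -
      have "card (?N y') < card (?N y)" by (rule psubset_card_mono[OF _ y'(2)]) simp
      from less.hyps[OF this y'(3,4)] have "gauge \<Phi> q x \<le> gauge \<Phi> q y'"
        using gauge_cong[of q x y' \<Phi>] by (auto simp: le_less)
      with y'(1) show ?thesis by simp
    qed
    show ?thesis
    proof (cases "\<forall>i<q. x i \<le> y i")
      case True
      obtain i where "i < q" "x i \<noteq> y i" using False by blast
      with True have i: "i < q" "x i < y i" by (auto simp: order_less_le)
      have "(\<Sum>j<l. x j) \<le> (\<Sum>j<l. (y(i := x i)) j)" if "l \<le> q" for l
        using True that by (intro sum_mono) auto
      moreover have "?N (y(i := x i)) \<subset> ?N y"
      proof
        show "?N (y(i := x i)) \<subseteq> ?N y" by auto
        have "i \<in> ?N y" "i \<notin> ?N (y(i := x i))" using i by auto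
        then show "?N (y(i := x i)) \<noteq> ?N y" by blast
      qed
      ultimately show ?thesis
        using i x(1) y by (intro disjI2 step[of "y(i := x i)"] gauge_decrease_coordinate[OF sym conv]) auto
    next
      case False
      \<comment> \<open>A surplus of \<open>x\<close> at \<open>j\<close> must be preceded by a deficit at some \<open>i\<close>, since the partial sums of \<open>y\<close> dominate.\<close>
      define j where "j = (LEAST j. j < q \<and> y j < x j)"
      have j: "j < q" "y j < x j"
        using LeastI_ex[of "\<lambda>j. j < q \<and> y j < x j"] False by (auto simp: j_def not_le)
      have before: "x l \<le> y l" if "l < j" for l
        using not_less_Least[of l "\<lambda>j. j < q \<and> y j < x j"] that j by (auto simp: j_def)
      have "\<exists>i<j. x i < y i"
      proof (rule ccontr)
        assume "\<not> (\<exists>i<j. x i < y i)"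
        then have "(\<Sum>i<j. x i) = (\<Sum>i<j. y i)" using before by (intro sum.cong) force+
        then show False using maj[of "Suc j"] j by simp
      qed
      then obtain i where i: "i < j" "x i < y i" by blast
      \<comment> \<open>The largest transfer that overshoots \<open>x\<close> neither at \<open>i\<close> nor at \<open>j\<close>; it reaches \<open>x\<close> at one of them.\<close>
      define \<delta> where "\<delta> = min (y i - x i) (x j - y j)"
      have \<delta>: "0 < \<delta>" "\<delta> \<le> y i - x i" "\<delta> \<le> x j - y j" using i j by (auto simp: \<delta>_def)
      define y' where "y' = y(i := y i - \<delta>, j := y j + \<delta>)"
      have "x j \<le> x i" using x(2)[of i j] i j by simp
      then have g: "gauge \<Phi> q y' < gauge \<Phi> q y"
        unfolding y'_def using i j \<delta> y by (intro gauge_transfer[OF sym conv]) auto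
      have N: "?N y' \<subset> ?N y"
      proof
        show "?N y' \<subseteq> ?N y" using i j by (auto simp: y'_def split: if_splits)
        have "x i = y' i \<or> x j = y' j" using i by (auto simp: y'_def \<delta>_def min_def)
        then have "i \<notin> ?N y' \<or> j \<notin> ?N y'" by simp
        moreover have "i \<in> ?N y" "j \<in> ?N y" using i j by auto
        ultimately show "?N y' \<noteq> ?N y" by blast
      qed
      have nonneg: "0 \<le> y' l" if "l < q" for l
        using x(1)[of i] y[OF that] y[of j] \<delta> i j that by (auto simp: y'_def)
      have sums: "(\<Sum>a<l. x a) \<le> (\<Sum>a<l. y' a)" if "l \<le> q" for l
      proof -
        have "(\<Sum>a<l. y' a) = (\<Sum>a<l. y a + ((if a = j then \<delta> else 0) - (if a = i then \<delta> else 0)))"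
          using i by (intro sum.cong) (auto simp: y'_def)
        also have "\<dots> = (\<Sum>a<l. y a) + ((if j < l then \<delta> else 0) - (if i < l then \<delta> else 0))"
          by (simp add: sum.distrib sum_subtractf)
        finally have s: "(\<Sum>a<l. y' a) = (\<Sum>a<l. y a) + ((if j < l then \<delta> else 0) - (if i < l then \<delta> else 0))" .
        show ?thesis
        proof (cases "i < l \<and> l \<le> j")
          case True
          have "\<delta> \<le> y i - x i" by (rule \<delta>(2))
          also have "\<dots> \<le> (\<Sum>a<l. y a - x a)"
            using True before by (intro member_le_sum) auto
          finally show ?thesis using s True by (simp add: sum_subtractf)
        next
          case False
          then show ?thesis using s maj[OF that] i \<delta> by auto
        qed
      qed
      show ?thesis using step[OF g N nonneg sums] by simp
    qed
  qed simp
qed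

text \<open>Sorting \<open>x\<close> changes neither its gauge nor its sum of squares, and the hypothesis for all index
  sets \<open>J\<close> contains the partial sums of the sorted sequence.\<close>

lemma gauge_weak_majorization:
  assumes sym: "symmetric_gauge q \<Phi>" and conv: "strictly_convex_gauge q \<Phi>"
    and x: "\<And>i. i < q \<Longrightarrow> 0 \<le> x i" and y: "\<And>i. i < q \<Longrightarrow> 0 \<le> y i"
    and maj: "\<And>J. J \<subseteq> {..<q} \<Longrightarrow> (\<Sum>i\<in>J. x i) \<le> (\<Sum>i<card J. y i)"
  shows "gauge \<Phi> q x \<le> gauge \<Phi> q y"
    and "gauge \<Phi> q x = gauge \<Phi> q y \<Longrightarrow> (\<Sum>i<q. (x i)\<^sup>2) = (\<Sum>i<q. (y i)\<^sup>2)"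
proof -
  obtain p where p: "p permutes {..<q}" and dec: "\<And>i j. i \<le> j \<Longrightarrow> j < q \<Longrightarrow> x (p j) \<le> x (p i)"
    by (rule sorting_permutation[of q x], rule that)
  have pq: "p i < q" if "i < q" for i using permutes_in_image[OF p, of i] that by simp
  have "(\<Sum>i<l. x (p i)) \<le> (\<Sum>i<l. y i)" if "l \<le> q" for l
  proof -
    have inj: "inj_on p {..<l}" by (rule inj_on_subset[OF permutes_inj[OF p]]) simp
    have "(\<Sum>i<l. x (p i)) = (\<Sum>i\<in>p ` {..<l}. x i)" using inj by (simp add: sum.reindex)
    also have "\<dots> \<le> (\<Sum>i<card (p ` {..<l}). y i)"
      by (rule maj) (use pq that in auto)
    also have "card (p ` {..<l}) = l" using card_image[OF inj] by simp
    finally show ?thesis .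
  qed
  then have alt: "(\<forall>i<q. x (p i) = y i) \<or> gauge \<Phi> q (\<lambda>i. x (p i)) < gauge \<Phi> q y"
    using x y pq dec by (intro gauge_weak_majorization_sorted[OF sym conv]) auto
  have "gauge \<Phi> q (\<lambda>i. x (p i)) = gauge \<Phi> q (\<lambda>i. \<bar>x (p i)\<bar>)"
    using x pq by (intro gauge_cong) auto
  then have gx: "gauge \<Phi> q (\<lambda>i. x (p i)) = gauge \<Phi> q x" using gauge_perm[OF sym p, of x] by simp
  have "gauge \<Phi> q (\<lambda>i. x (p i)) \<le> gauge \<Phi> q y"
    using alt
  proof
    assume "\<forall>i<q. x (p i) = y i"
    then have "gauge \<Phi> q (\<lambda>i. x (p i)) = gauge \<Phi> q y" by (intro gauge_cong) simp
    then show ?thesis by simp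
  qed simp
  then show "gauge \<Phi> q x \<le> gauge \<Phi> q y" by (simp add: gx)
  assume "gauge \<Phi> q x = gauge \<Phi> q y"
  then have "\<forall>i<q. x (p i) = y i" using alt gx by auto
  then have "(\<Sum>i<q. (y i)\<^sup>2) = (\<Sum>i<q. (x (p i))\<^sup>2)" by (intro sum.cong) auto
  also have "\<dots> = (\<Sum>i<q. (x i)\<^sup>2)" using sum.permute[OF p, of "\<lambda>i. (x i)\<^sup>2"] by (simp add: o_def)
  finally show "(\<Sum>i<q. (x i)\<^sup>2) = (\<Sum>i<q. (y i)\<^sup>2)" by simp
qed

section \<open>The distance to the partial isometries of rank \<open>k\<close>\<close>

lemma gauge_norm_sv:
  assumes "A \<in> carrier_mat m n"
  shows "gauge_norm \<Phi> A = gauge \<Phi> (min m n) (sv A)"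
proof -
  have "gauge \<Phi> (min m n) (sv A) = gauge \<Phi> (min m n) (\<lambda>i. sing_val A (Suc i))"
    by (rule gauge_cong) (simp add: sv_def carrier_matD[OF assms])
  then show ?thesis by (simp add: gauge_norm_def gauge_def carrier_matD[OF assms])
qed

lemma sv_partial_isometry:
  assumes "X \<in> partial_isometries m n k"
  shows "sv X i = (if i < k then 1 else 0)"
proof -
  have X: "X \<in> carrier_mat m n" "partial_isometry X" "mat_rank X = k"
    using assms by (auto simp: partial_isometries_def)
  show ?thesis
    using partial_isometry_sv[OF X(1,2), of i] sv_nonzero_iff[OF X(1), of i] X(3) by auto
qed

lemma trace_adjoint_minus:
  assumes F: "F \<in> carrier_mat m n" and X: "X \<in> carrier_mat m n"
  shows "(\<Sum>i<n. (adj (F - X) * (F - X)) $$ (i, i)) =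
    (\<Sum>i<n. (adj F * F) $$ (i, i)) + (\<Sum>i<n. (adj X * X) $$ (i, i)) -
    complex_of_real (2 * Re (\<Sum>i<n. (adj X * F) $$ (i, i)))"
proof -
  have entry: "(adj A * B) $$ (i, i) = (\<Sum>a<m. cnj (A $$ (a, i)) * B $$ (a, i))"
    if "A \<in> carrier_mat m n" "B \<in> carrier_mat m n" "i < n" for A B i
    using that by (auto simp: scalar_prod_def atLeast0LessThan intro!: sum.cong)
  have FX: "F - X \<in> carrier_mat m n" using X by auto
  have "(adj (F - X) * (F - X)) $$ (i, i) =
      (adj F * F) $$ (i, i) + (adj X * X) $$ (i, i) -
      ((adj X * F) $$ (i, i) + cnj ((adj X * F) $$ (i, i)))" if i: "i < n" for i
  proof -
    have "(adj (F - X) * (F - X)) $$ (i, i) =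
      (\<Sum>a<m. cnj (F $$ (a, i)) * F $$ (a, i) + cnj (X $$ (a, i)) * X $$ (a, i) -
        (cnj (X $$ (a, i)) * F $$ (a, i) + cnj (cnj (X $$ (a, i)) * F $$ (a, i))))"
      unfolding entry[OF FX FX i] using F X i
      by (intro sum.cong refl) (simp add: algebra_simps)
    then show ?thesis
      unfolding entry[OF F F i] entry[OF X X i] entry[OF X F i]
      by (simp add: sum.distrib sum_subtractf)
  qed
  then have "(\<Sum>i<n. (adj (F - X) * (F - X)) $$ (i, i)) =
      (\<Sum>i<n. (adj F * F) $$ (i, i)) + (\<Sum>i<n. (adj X * X) $$ (i, i)) -
      ((\<Sum>i<n. (adj X * F) $$ (i, i)) + cnj (\<Sum>i<n. (adj X * F) $$ (i, i)))"
    by (simp add: sum.distrib sum_subtractf del: index_mult_mat)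
  then show ?thesis unfolding complex_add_cnj by simp
qed

text \<open>The gauge of the differences \<open>s\<^sub>i(F) - s\<^sub>i(X)\<close> is a lower bound. Equality forces equality of the
  sums of squares, hence of the Frobenius norms, which is a linear condition on \<open>X\<close>.\<close>

lemma gauge_norm_lower_bound:
  assumes sym: "symmetric_gauge (min m n) \<Phi>" and conv: "strictly_convex_gauge (min m n) \<Phi>"
    and F: "F \<in> carrier_mat m n" and X: "X \<in> partial_isometries m n k" and k: "k \<le> min m n"
  defines "d \<equiv> \<lambda>i. sv F i - (if i < k then 1 else 0)"
  shows "gauge \<Phi> (min m n) d \<le> gauge_norm \<Phi> (F - X)"
    and "gauge \<Phi> (min m n) d = gauge_norm \<Phi> (F - X) \<Longrightarrow>
      Re (\<Sum>i<n. (adj X * F) $$ (i, i)) = (\<Sum>i<k. sv F i)"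
proof -
  let ?q = "min m n"
  have Xc: "X \<in> carrier_mat m n" using X by (simp add: partial_isometries_def)
  have FX: "F - X \<in> carrier_mat m n" using Xc by auto
  have dX: "d i = sv F i - sv X i" for i by (simp add: d_def sv_partial_isometry[OF X])
  have g: "gauge \<Phi> ?q d = gauge \<Phi> ?q (\<lambda>i. \<bar>d i\<bar>)" using gauge_abs[OF sym, of d] by simp
  have maj: "(\<Sum>i\<in>J. \<bar>d i\<bar>) \<le> (\<Sum>i<card J. sv (F - X) i)" if "J \<subseteq> {..<?q}" for J
    unfolding dX by (rule singular_value_perturbation[OF F Xc that])
  note wm = gauge_weak_majorization[OF sym conv, of "\<lambda>i. \<bar>d i\<bar>" "sv (F - X)", OF _ sv_nonneg[OF FX] maj]
  show "gauge \<Phi> ?q d \<le> gauge_norm \<Phi> (F - X)"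
    unfolding g gauge_norm_sv[OF FX] by (rule wm(1)) simp_all
  assume "gauge \<Phi> ?q d = gauge_norm \<Phi> (F - X)"
  then have "(\<Sum>i<?q. \<bar>d i\<bar>\<^sup>2) = (\<Sum>i<?q. (sv (F - X) i)\<^sup>2)"
    unfolding g gauge_norm_sv[OF FX] by (intro wm(2)) simp_all
  then have "complex_of_real (\<Sum>i<?q. (d i)\<^sup>2) = (\<Sum>i<n. (adj (F - X) * (F - X)) $$ (i, i))"
    using sum_sv_squares[OF FX] by simp
  also have "\<dots> = complex_of_real ((\<Sum>i<?q. (sv F i)\<^sup>2) + (\<Sum>i<?q. (sv X i)\<^sup>2) -
      2 * Re (\<Sum>i<n. (adj X * F) $$ (i, i)))"
    unfolding trace_adjoint_minus[OF F Xc] sum_sv_squares[OF F, symmetric] sum_sv_squares[OF Xc, symmetric]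
    by (simp del: index_mult_mat)
  finally have "(\<Sum>i<?q. (d i)\<^sup>2) = (\<Sum>i<?q. (sv F i)\<^sup>2) + (\<Sum>i<?q. (sv X i)\<^sup>2) -
      2 * Re (\<Sum>i<n. (adj X * F) $$ (i, i))" by (simp only: of_real_eq_iff)
  moreover have "(\<Sum>i<?q. (d i)\<^sup>2) = (\<Sum>i<?q. (sv F i)\<^sup>2) + (\<Sum>i<?q. (sv X i)\<^sup>2) -
      2 * (\<Sum>i<?q. sv F i * sv X i)"
    unfolding dX by (simp add: power2_diff sum.distrib sum_subtractf sum_distrib_left mult_ac)
  moreover have "(\<Sum>i<?q. sv F i * sv X i) = (\<Sum>i<k. sv F i)"
    using k by (intro sum.mono_neutral_cong_right) (auto simp: sv_partial_isometry[OF X])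
  ultimately show "Re (\<Sum>i<n. (adj X * F) $$ (i, i)) = (\<Sum>i<k. sv F i)" by linarith
qed

text \<open>The diagonal entries \<open>s\<^sub>i - 1\<close> may be negative or out of order, to which \<open>\<Phi>\<close> is insensitive.\<close>

lemma gauge_norm_aligned:
  assumes sym: "symmetric_gauge (min m n) \<Phi>"
    and V: "unitary_mat m V" and W: "unitary_mat n W" and F: "F = V * rdiag m n s * adj W"
  shows "gauge_norm \<Phi> (F - V * pid m n k * adj W) =
    gauge \<Phi> (min m n) (\<lambda>i. s i - (if i < k then 1 else 0))"
proof -
  note uV = unitaryD[OF V] and uW = unitaryD[OF W]
  define d where "d i = s i - (if i < k then 1 else 0)" for i
  have eq: "F - V * pid m n k * adj W = V * rdiag m n d * adj W"
    unfolding F d_def rdiag_minus[symmetric] pid_def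
    using uV uW by (simp add: mult_minus_dim)
  obtain p where p: "p permutes {..<min m n}"
    "\<And>i. i < min m n \<Longrightarrow> sing_val (F - V * pid m n k * adj W) (Suc i) = \<bar>d (p i)\<bar>"
    by (rule sing_val_perm[OF V W eq], rule that)
  have c: "V * rdiag m n d * adj W \<in> carrier_mat m n" by (rule conj_rdiag_carrier[OF V W])
  have "gauge_norm \<Phi> (F - V * pid m n k * adj W) = gauge \<Phi> (min m n) (\<lambda>i. \<bar>d (p i)\<bar>)"
    using p(2) unfolding eq gauge_norm_def gauge_def carrier_matD[OF c]
    by (intro arg_cong[where f = \<Phi>]) auto
  also have "\<dots> = gauge \<Phi> (min m n) d" by (rule gauge_perm[OF sym p(1)])
  finally show ?thesis by (simp add: d_def[abs_def])
qed

lemma aligned_minimizer: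
  assumes sym: "symmetric_gauge (min m n) \<Phi>" and conv: "strictly_convex_gauge (min m n) \<Phi>"
    and k: "k \<le> min m n" and Fc: "F \<in> carrier_mat m n"
    and V: "unitary_mat m V" and W: "unitary_mat n W" and F: "F = V * rdiag m n (sv F) * adj W"
  shows "V * pid m n k * adj W \<in> minimizers \<Phi> m n k F"
  unfolding minimizers_def is_arg_min_def
proof (intro CollectI conjI notI)
  show "V * pid m n k * adj W \<in> partial_isometries m n k"
    by (rule partial_isometriesI[OF V W k])
  assume "\<exists>Y. Y \<in> partial_isometries m n k \<and>
    gauge_norm \<Phi> (F - Y) < gauge_norm \<Phi> (F - V * pid m n k * adj W)"
  then obtain Y where "Y \<in> partial_isometries m n k"
    "gauge_norm \<Phi> (F - Y) < gauge_norm \<Phi> (F - V * pid m n k * adj W)" by blast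
  then show False
    using gauge_norm_lower_bound(1)[OF sym conv Fc _ k, of Y] gauge_norm_aligned[OF sym V W F, of k] by simp
qed

text \<open>The freedom in the choice of the decomposition is what produces the families of minimizers:
  unitary changes \<open>T\<^sub>1\<close>, \<open>T\<^sub>2\<close> of the singular bases that preserve the matrix of singular values.\<close>

lemma rotated_minimizer:
  assumes sym: "symmetric_gauge (min m n) \<Phi>" and conv: "strictly_convex_gauge (min m n) \<Phi>"
    and k: "k \<le> min m n" and F: "F \<in> carrier_mat m n"
    and V: "unitary_mat m V" and W: "unitary_mat n W" and svd: "F = V * rdiag m n (sv F) * adj W"
    and T: "unitary_mat m T1" "unitary_mat n T2"
    and inv: "T1 * rdiag m n (sv F) * adj T2 = rdiag m n (sv F)"
  shows "V * (T1 * pid m n k * adj T2) * adj W \<in> minimizers \<Phi> m n k F"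
proof -
  note u = unitaryD[OF V] unitaryD[OF W] unitaryD[OF T(1)] unitaryD[OF T(2)]
  have "F = V * (T1 * rdiag m n (sv F) * adj T2) * adj W" unfolding inv by (rule svd)
  also have "\<dots> = (V * T1) * rdiag m n (sv F) * adj (W * T2)"
    using u by (simp add: adjoint_mult mult_assoc_dim)
  finally have svd': "F = (V * T1) * rdiag m n (sv F) * adj (W * T2)" .
  have "V * (T1 * pid m n k * adj T2) * adj W = (V * T1) * pid m n k * adj (W * T2)"
    using u by (simp add: adjoint_mult mult_assoc_dim)
  then show ?thesis
    using aligned_minimizer[OF sym conv k F unitary_mult[OF V T(1)] unitary_mult[OF W T(2)] svd'] by simp
qed

text \<open>The lower bound is attained by an aligned \<open>X\<close>, hence by every minimizer.\<close>

lemma minimizer_trace: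
  assumes sym: "symmetric_gauge (min m n) \<Phi>" and conv: "strictly_convex_gauge (min m n) \<Phi>"
    and k: "k \<le> min m n" and F: "F \<in> carrier_mat m n" and X: "X \<in> minimizers \<Phi> m n k F"
  shows "X \<in> partial_isometries m n k"
    and "Re (\<Sum>i<n. (adj X * F) $$ (i, i)) = (\<Sum>i<k. sv F i)"
proof -
  show XP: "X \<in> partial_isometries m n k" using X by (simp add: minimizers_def is_arg_min_def)
  obtain V W where svd: "unitary_mat m V" "unitary_mat n W" "F = V * rdiag m n (sv F) * adj W"
    by (rule svd_sv[OF F], rule that)
  have "\<not> gauge_norm \<Phi> (F - V * pid m n k * adj W) < gauge_norm \<Phi> (F - X)"
    using X partial_isometriesI[OF svd(1,2) k] unfolding minimizers_def is_arg_min_def by blast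
  then show "Re (\<Sum>i<n. (adj X * F) $$ (i, i)) = (\<Sum>i<k. sv F i)"
    using gauge_norm_lower_bound[OF sym conv F XP k] gauge_norm_aligned[OF sym svd, of k] by simp
qed

section \<open>The equality case of the trace inequality\<close>

text \<open>If weights \<open>t\<^sub>i \<in> [0, 1]\<close> of total mass at most \<open>k\<close> reach the sum of the \<open>k\<close> largest entries of \<open>s\<close>,
  they are \<open>1\<close> above the \<open>k\<close>-th entry and \<open>0\<close> below it. The deficit of the weighted sum is a sum of
  three nonnegative terms, each of which has to vanish. The penalties \<open>e\<^sub>i\<close> vanish for the same reason
  where \<open>s\<^sub>i > 0\<close>.\<close>

lemma optimal_weights:
  fixes s t e :: "nat \<Rightarrow> real"
  assumes s: "decseq s" "\<And>i. 0 \<le> s i" and k: "1 \<le> k" "k \<le> q"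
    and t: "\<And>i. i < q \<Longrightarrow> 0 \<le> t i" "\<And>i. i < q \<Longrightarrow> t i \<le> 1" "(\<Sum>i<q. t i) \<le> real k"
    and e: "\<And>i. i < q \<Longrightarrow> 0 \<le> e i"
    and le: "(\<Sum>i<k. s i) \<le> (\<Sum>i<q. s i * (t i - e i))"
  shows "\<And>i. i < q \<Longrightarrow> s (k - 1) < s i \<Longrightarrow> t i = 1"
    and "\<And>i. i < q \<Longrightarrow> s i < s (k - 1) \<Longrightarrow> t i = 0"
    and "\<And>i. i < q \<Longrightarrow> 0 < s i \<Longrightarrow> e i = 0"
    and "0 < s (k - 1) \<Longrightarrow> (\<Sum>i<q. t i) = real k"
proof -
  define c where "c = s (k - 1)"
  define u where "u i = (s i - c) * ((if i < k then 1 else 0) - t i)" for i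
  have sc: "c \<le> s i" if "i < k" for i using decseqD[OF s(1), of i "k - 1"] that by (simp add: c_def)
  have cs: "s i \<le> c" if "k \<le> i" for i using decseqD[OF s(1), of "k - 1" i] that by (simp add: c_def)
  have u: "0 \<le> u i" if "i < q" for i
    using sc[of i] cs[of i] t(1,2)[OF that] by (auto simp: u_def mult_le_0_iff zero_le_mult_iff)
  have c: "0 \<le> c" using s(2) by (simp add: c_def)
  have "(\<Sum>i<q. u i) = (\<Sum>i<q. (s i - c) * (if i < k then 1 else 0)) - (\<Sum>i<q. s i * t i) + c * (\<Sum>i<q. t i)"
    by (simp add: u_def algebra_simps sum.distrib sum_subtractf sum_distrib_left)
  also have "(\<Sum>i<q. (s i - c) * (if i < k then 1 else 0)) = (\<Sum>i<k. s i - c)"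
    using k by (intro sum.mono_neutral_cong_right) auto
  also have "\<dots> = (\<Sum>i<k. s i) - real k * c" by (simp add: sum_subtractf)
  finally have id: "(\<Sum>i<q. u i) + (\<Sum>i<q. s i * e i) + c * (real k - (\<Sum>i<q. t i)) =
      (\<Sum>i<k. s i) - (\<Sum>i<q. s i * (t i - e i))"
    by (simp add: algebra_simps sum.distrib sum_subtractf)
  have "0 \<le> (\<Sum>i<q. u i)" using u by (intro sum_nonneg) auto
  moreover have "0 \<le> (\<Sum>i<q. s i * e i)" using s(2) e by (intro sum_nonneg) auto
  moreover have "0 \<le> c * (real k - (\<Sum>i<q. t i))" using c t(3) by simp
  ultimately have z: "(\<Sum>i<q. u i) = 0" "(\<Sum>i<q. s i * e i) = 0" "c * (real k - (\<Sum>i<q. t i)) = 0"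
    using id le by linarith+
  have "u i = 0" if "i < q" for i
    using z(1) u that by (subst (asm) sum_nonneg_eq_0_iff) auto
  then have "(s i - c) * ((if i < k then 1 else 0) - t i) = 0" if "i < q" for i
    using that by (simp add: u_def)
  then show "t i = 1" if "i < q" "s (k - 1) < s i" for i
    using that cs[of i] by (fastforce simp: c_def)
  show "t i = 0" if "i < q" "s i < s (k - 1)" for i
    using \<open>\<And>i. i < q \<Longrightarrow> (s i - c) * ((if i < k then 1 else 0) - t i) = 0\<close>[of i] that sc[of i]
    by (fastforce simp: c_def)
  have "s i * e i = 0" if "i < q" for i
    using z(2) s(2) e that by (subst (asm) sum_nonneg_eq_0_iff) auto
  then show "e i = 0" if "i < q" "0 < s i" for i using that by fastforce
  show "(\<Sum>i<q. t i) = real k" if "0 < s (k - 1)" using z(3) that by (simp add: c_def)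
qed

lemma sqn_minus:
  assumes "dim_vec a = dim_vec b"
  shows "sqn (a - b) = sqn a + sqn b - 2 * Re (a \<bullet>c b)"
proof -
  have "(cmod (x - y))\<^sup>2 = (cmod x)\<^sup>2 + (cmod y)\<^sup>2 - 2 * Re (x * cnj y)" for x y
    unfolding cmod_power2 by (simp add: power2_eq_square algebra_simps)
  then show ?thesis
    using assms by (simp add: sqn_def cscalar_sum sum.distrib sum_subtractf sum_distrib_left)
qed

text \<open>As \<open>Q = Q\<^sup>* Q\<close>, a diagonal entry \<open>p\<close> is the squared norm of its column. It is one of the entries of
  this column, so \<open>p\<^sup>2 \<le> p\<close>, and \<open>p = 1\<close> leaves no room for the others.\<close>

lemma projection_diagonal:
  assumes Q: "Q \<in> carrier_mat n n" "adj Q = Q" "Q * Q = Q" and i: "i < n"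
  shows "Q $$ (i, i) = complex_of_real (sqn (col Q i))" "sqn (col Q i) \<le> 1"
    and "sqn (col Q i) = 1 \<Longrightarrow> col Q i = unit_vec n i"
proof -
  let ?p = "sqn (col Q i)"
  have "(adj Q * Q) $$ (i, i) = complex_of_real ?p"
    by (rule entry_mult_adjoint_self) (use Q i in auto)
  then show e: "Q $$ (i, i) = complex_of_real ?p" by (simp only: Q(2,3))
  have split: "?p = (cmod (Q $$ (i, i)))\<^sup>2 + (\<Sum>j\<in>{..<n} - {i}. (cmod (Q $$ (j, i)))\<^sup>2)"
    using Q(1) i unfolding sqn_def by (simp add: sum.remove[of "{..<n}" i])
  then have p: "?p = ?p\<^sup>2 + (\<Sum>j\<in>{..<n} - {i}. (cmod (Q $$ (j, i)))\<^sup>2)"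
    unfolding e by simp
  have "0 \<le> (\<Sum>j\<in>{..<n} - {i}. (cmod (Q $$ (j, i)))\<^sup>2)" by (rule sum_nonneg) simp
  then have "?p * (1 - ?p) \<ge> 0" using p by (simp add: power2_eq_square algebra_simps)
  then show "?p \<le> 1" using sqn_nonneg[of "col Q i"] by (auto simp: zero_le_mult_iff)
  assume 1: "?p = 1"
  then have "(\<Sum>j\<in>{..<n} - {i}. (cmod (Q $$ (j, i)))\<^sup>2) = 0" using p by simp
  then have "Q $$ (j, i) = 0" if "j < n" "j \<noteq> i" for j
    using that by (subst (asm) sum_nonneg_eq_0_iff) auto
  then show "col Q i = unit_vec n i"
    using Q(1) i e 1 by (intro eq_vecI) auto
qed

lemma partial_isometry_conj:
  assumes X: "X \<in> partial_isometries m n k" and V: "unitary_mat m V" and W: "unitary_mat n W"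
  shows "V * X * adj W \<in> partial_isometries m n k"
proof -
  obtain A B where AB: "unitary_mat m A" "unitary_mat n B" "X = A * pid m n k * adj B" "k \<le> min m n"
    by (rule partial_isometriesE[OF X])
  have "V * X * adj W = (V * A) * pid m n k * adj (W * B)"
    unfolding AB(3) using unitaryD[OF V] unitaryD[OF W] unitaryD[OF AB(1)] unitaryD[OF AB(2)]
    by (simp add: adjoint_mult mult_assoc_dim)
  then show ?thesis
    using partial_isometriesI[OF unitary_mult[OF V AB(1)] unitary_mult[OF W AB(2)] AB(4)] by simp
qed

text \<open>With \<open>Q = Y\<^sup>* Y\<close> and \<open>R = Y Y\<^sup>*\<close> one has \<open>2 Re Y\<^sub>i\<^sub>i = Q\<^sub>i\<^sub>i + R\<^sub>i\<^sub>i - \<parallel>Y e\<^sub>i - R e\<^sub>i\<parallel>\<^sup>2\<close>: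
  expand the square and use \<open>\<langle>Y e\<^sub>i, R e\<^sub>i\<rangle> = \<langle>R Y e\<^sub>i, e\<^sub>i\<rangle>\<close> and \<open>R Y = Y\<close>.\<close>

lemma partial_isometry_projections:
  assumes Y: "Y \<in> partial_isometries m n k"
  defines "Q \<equiv> adj Y * Y" and "R \<equiv> Y * adj Y"
  shows "Q \<in> carrier_mat n n" "adj Q = Q" "Q * Q = Q"
    and "R \<in> carrier_mat m m" "adj R = R" "R * R = R"
    and "(\<Sum>i<n. sqn (col Q i)) = real k" "(\<Sum>i<m. sqn (col R i)) = real k"
    and "\<And>i. i < m \<Longrightarrow> i < n \<Longrightarrow>
      2 * Re (Y $$ (i, i)) = sqn (col Q i) + sqn (col R i) - sqn (col Y i - col R i)"
proof -
  have Yc: "Y \<in> carrier_mat m n" using Y by (simp add: partial_isometries_def)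
  have YQ: "Y * (adj Y * Y) = Y" by (rule partial_isometries_absorb[OF Y])
  show Q: "Q \<in> carrier_mat n n" "adj Q = Q"
    using Yc by (auto simp: Q_def adjoint_mult)
  show R: "R \<in> carrier_mat m m" "adj R = R"
    using Yc by (auto simp: R_def adjoint_mult)
  have RY: "R * Y = Y" using Yc YQ by (simp add: R_def mult_assoc_dim)
  show QQ: "Q * Q = Q" using Yc YQ by (simp add: Q_def mult_assoc_dim)
  have "R * R = (R * Y) * adj Y" using Yc R by (simp add: R_def mult_assoc_dim)
  then show RR: "R * R = R" by (simp only: RY) (simp add: R_def)
  obtain A B where A: "unitary_mat m A" and B: "unitary_mat n B"
    and YAB: "Y = A * pid m n k * adj B" and k: "k \<le> min m n"
    by (rule partial_isometriesE[OF Y])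
  note uA = unitaryD[OF A] and uB = unitaryD[OF B]
  have "Q = B * (rdiag n m (\<lambda>i. if i < k then 1 else 0) * rdiag m n (\<lambda>i. if i < k then 1 else 0)) * adj B"
    unfolding Q_def YAB pid_def using uA uB by (simp add: adjoint_mult mult_assoc_dim)
  also have "rdiag n m (\<lambda>i. if i < k then 1 else 0) * rdiag m n (\<lambda>i. if i < k then 1 else 0) =
      rdiag n n (\<lambda>i. if i < k then 1 else 0)"
    unfolding rdiag_mult by (rule rdiag_cong) (use k in auto)
  finally have "(\<Sum>i<n. Q $$ (i, i)) = complex_of_real (\<Sum>i<n. if i < k then 1 else 0)"
    by (simp only: trace_conj_rdiag[OF B])
  also have "(\<Sum>i<n. if i < k then 1 else 0 :: real) = real k" using k by (intro sum_zero_one) simp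
  finally have trQ: "(\<Sum>i<n. Q $$ (i, i)) = complex_of_real (real k)" .
  have trR: "(\<Sum>i<m. R $$ (i, i)) = complex_of_real (real k)"
    using trace_mult_comm[of Y m n "adj Y"] Yc trQ unfolding Q_def R_def by simp
  have "complex_of_real (\<Sum>i<n. sqn (col Q i)) = (\<Sum>i<n. Q $$ (i, i))"
    using projection_diagonal(1)[OF Q QQ] by simp
  then show "(\<Sum>i<n. sqn (col Q i)) = real k" unfolding trQ by (simp only: of_real_eq_iff)
  have "complex_of_real (\<Sum>i<m. sqn (col R i)) = (\<Sum>i<m. R $$ (i, i))"
    using projection_diagonal(1)[OF R RR] by simp
  then show "(\<Sum>i<m. sqn (col R i)) = real k" unfolding trR by (simp only: of_real_eq_iff)
  fix i assume i: "i < m" "i < n"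
  have "complex_of_real (sqn (col Y i)) = Q $$ (i, i)"
    unfolding Q_def by (rule entry_mult_adjoint_self[symmetric]) (use Yc i in auto)
  also have "\<dots> = complex_of_real (sqn (col Q i))" by (rule projection_diagonal(1)[OF Q QQ i(2)])
  finally have "sqn (col Y i) = sqn (col Q i)" by (simp only: of_real_eq_iff)
  moreover have "col Y i \<bullet>c col R i = (adj R * Y) $$ (i, i)"
    by (rule entry_adjoint_mult[symmetric]) (use Yc R i in auto)
  then have "col Y i \<bullet>c col R i = Y $$ (i, i)" by (simp only: R RY)
  ultimately show "2 * Re (Y $$ (i, i)) = sqn (col Q i) + sqn (col R i) - sqn (col Y i - col R i)"
    using sqn_minus[of "col Y i" "col R i"] Yc R by simp
qed

lemma partial_isometries_adjoint:
  assumes "Y \<in> partial_isometries m n k"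
  shows "adj Y \<in> partial_isometries n m k"
proof -
  obtain A B where AB: "unitary_mat m A" "unitary_mat n B" "Y = A * pid m n k * adj B" "k \<le> min m n"
    by (rule partial_isometriesE[OF assms])
  have "adj Y = B * pid n m k * adj A"
    unfolding AB(3) using unitaryD[OF AB(1)] unitaryD[OF AB(2)]
    by (simp add: adjoint_mult mult_assoc_dim pid_def)
  then show ?thesis using partial_isometriesI[OF AB(2,1), of k] AB(4) by (simp add: min.commute)
qed

text \<open>The weights are \<open>t\<^sub>i = (Q\<^sub>i\<^sub>i + R\<^sub>i\<^sub>i) / 2\<close> and the penalties are \<open>e\<^sub>i = \<parallel>Y e\<^sub>i - R e\<^sub>i\<parallel>\<^sup>2 / 2\<close>. In the last claim
  the columns beyond \<open>min m n\<close> are included: the first \<open>min m n\<close> diagonal entries of \<open>Q\<close> already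
  exhaust its trace.\<close>

lemma optimal_columns:
  assumes Y: "Y \<in> partial_isometries m n k" and k: "1 \<le> k" "k \<le> min m n"
    and s: "decseq s" "\<And>i. 0 \<le> s i"
    and opt: "(\<Sum>i<min m n. s i * Re (Y $$ (i, i))) = (\<Sum>i<k. s i)"
  shows "\<And>i. i < min m n \<Longrightarrow> s (k - 1) < s i \<Longrightarrow> col Y i = unit_vec m i"
    and "\<And>i. i < min m n \<Longrightarrow> 0 < s i \<Longrightarrow> col Y i = col (Y * adj Y) i"
    and "\<And>i. 0 < s (k - 1) \<Longrightarrow> i < n \<Longrightarrow> i < min m n \<longrightarrow> s i < s (k - 1) \<Longrightarrow> col Y i = 0\<^sub>v m"
proof -
  let ?q = "min m n"
  define Q where "Q = adj Y * Y"
  define R where "R = Y * adj Y"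
  have Yc: "Y \<in> carrier_mat m n" using Y by (simp add: partial_isometries_def)
  note pr = partial_isometry_projections[OF Y, folded Q_def R_def]
  note Q = pr(1-3) and R = pr(4-6) and sums = pr(7,8) and diag = pr(9)
  define t where "t i = (sqn (col Q i) + sqn (col R i)) / 2" for i
  define e where "e i = sqn (col Y i - col R i) / 2" for i
  have sum_le: "(\<Sum>i<?q. sqn (col Q i)) \<le> real k" "(\<Sum>i<?q. sqn (col R i)) \<le> real k"
  proof -
    have "(\<Sum>i<?q. sqn (col Q i)) \<le> (\<Sum>i<n. sqn (col Q i))" by (rule sum_mono2) auto
    then show "(\<Sum>i<?q. sqn (col Q i)) \<le> real k" unfolding sums(1) .
    have "(\<Sum>i<?q. sqn (col R i)) \<le> (\<Sum>i<m. sqn (col R i))" by (rule sum_mono2) auto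
    then show "(\<Sum>i<?q. sqn (col R i)) \<le> real k" unfolding sums(2) .
  qed
  have sum_t: "(\<Sum>i<?q. t i) = ((\<Sum>i<?q. sqn (col Q i)) + (\<Sum>i<?q. sqn (col R i))) / 2"
    by (simp add: t_def sum.distrib sum_divide_distrib[symmetric])
  have t0: "0 \<le> t i" "t i \<le> 1" if "i < ?q" for i
    using projection_diagonal(2)[OF Q, of i] projection_diagonal(2)[OF R, of i] that by (auto simp: t_def)
  have tk: "(\<Sum>i<?q. t i) \<le> real k" using sum_le sum_t by simp
  have e0: "0 \<le> e i" for i by (simp add: e_def)
  have "(\<Sum>i<?q. s i * Re (Y $$ (i, i))) = (\<Sum>i<?q. s i * (t i - e i))"
  proof (rule sum.cong)
    fix i assume "i \<in> {..<?q}"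
    then have "Re (Y $$ (i, i)) = t i - e i" using diag[of i] by (simp add: t_def e_def field_simps)
    then show "s i * Re (Y $$ (i, i)) = s i * (t i - e i)" by simp
  qed simp
  then have le: "(\<Sum>i<k. s i) \<le> (\<Sum>i<?q. s i * (t i - e i))" using opt by simp
  note ow = optimal_weights[OF s k t0 tk e0 le]
  have colYR: "col Y i = col R i" if "i < ?q" "0 < s i" for i
  proof -
    have "e i = 0" by (rule ow(3)) (use that in auto)
    then have "sqn (col Y i - col R i) = 0" by (simp add: e_def)
    then have z: "col Y i - col R i = 0\<^sub>v m" using Yc R(1) by (subst (asm) sqn_eq_0) simp
    show ?thesis
    proof (rule eq_vecI)
      fix a assume "a < dim_vec (col R i)"
      then have "a < m" using R(1) by simp
      then have "(col Y i - col R i) $ a = 0" unfolding z by simp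
      then show "col Y i $ a = col R i $ a" using \<open>a < m\<close> R(1) by simp
    qed (use Yc R(1) in simp)
  qed
  then show "col Y i = col (Y * adj Y) i" if "i < ?q" "0 < s i" for i
    using that by (simp add: R_def)
  show "col Y i = unit_vec m i" if i: "i < ?q" "s (k - 1) < s i" for i
  proof -
    have "t i = 1" by (rule ow(1)) (use i in auto)
    then have "sqn (col R i) = 1"
      using projection_diagonal(2)[OF Q, of i] projection_diagonal(2)[OF R, of i] i(1) by (simp add: t_def)
    then have "col R i = unit_vec m i" using projection_diagonal(3)[OF R, of i] i(1) by simp
    moreover have "0 < s i" using s(2)[of "k - 1"] i(2) by linarith
    ultimately show ?thesis using colYR[OF i(1)] by simp
  qed
  show "col Y i = 0\<^sub>v m" if c: "0 < s (k - 1)" and i: "i < n" "i < ?q \<longrightarrow> s i < s (k - 1)" for i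
  proof -
    have "sqn (col Q i) = 0"
    proof (cases "i < ?q")
      case True
      then have "t i = 0" using i(2) by (intro ow(2)) auto
      then show ?thesis by (simp add: t_def add_nonneg_eq_0_iff)
    next
      case False
      have "(\<Sum>i<?q. t i) = real k" by (rule ow(4)) (use c in auto)
      moreover have "a = c" if "a \<le> c" "b \<le> c" "(a + b) / 2 = c" for a b c :: real using that by simp
      ultimately have "(\<Sum>i<?q. sqn (col Q i)) = real k" using sum_le sum_t by metis
      moreover have "(\<Sum>i<n. sqn (col Q i)) = (\<Sum>i<?q. sqn (col Q i)) + (\<Sum>i\<in>{..<n} - {..<?q}. sqn (col Q i))"
        by (subst add.commute, rule sum.subset_diff) auto
      ultimately have "(\<Sum>i\<in>{..<n} - {..<?q}. sqn (col Q i)) = 0" using sums(1) by simp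
      then show ?thesis using i(1) False by (subst (asm) sum_nonneg_eq_0_iff) auto
    qed
    moreover have "complex_of_real (sqn (col Y i)) = complex_of_real (sqn (col Q i))"
      using entry_mult_adjoint_self[of i Y] projection_diagonal(1)[OF Q i(1)] Yc i(1)
      by (simp add: Q_def del: index_mult_mat(1))
    ultimately have "sqn (col Y i) = 0" by simp
    then show ?thesis using Yc by (subst (asm) sqn_eq_0) simp
  qed
qed

text \<open>The same conclusions for rows, by passing to the adjoint.\<close>

lemma optimal_entries:
  assumes Y: "Y \<in> partial_isometries m n k" and k: "1 \<le> k" "k \<le> min m n"
    and s: "decseq s" "\<And>i. 0 \<le> s i"
    and opt: "(\<Sum>i<min m n. s i * Re (Y $$ (i, i))) = (\<Sum>i<k. s i)"
    and ij: "i < m" "j < n"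
  shows "i < n \<and> s (k - 1) < s i \<or> j < m \<and> s (k - 1) < s j \<Longrightarrow> Y $$ (i, j) = (if i = j then 1 else 0)"
    and "0 < s (k - 1) \<Longrightarrow> (i < n \<longrightarrow> s i < s (k - 1)) \<or> (j < m \<longrightarrow> s j < s (k - 1)) \<Longrightarrow> Y $$ (i, j) = 0"
    and "j < m \<Longrightarrow> l < m \<Longrightarrow> 0 < s j \<Longrightarrow> Y $$ (l, j) = (Y * adj Y) $$ (l, j)"
proof -
  have Yc: "Y \<in> carrier_mat m n" using Y by (simp add: partial_isometries_def)
  have k': "k \<le> min n m" using k by simp
  have opt': "(\<Sum>i<min n m. s i * Re (adj Y $$ (i, i))) = (\<Sum>i<k. s i)"
    unfolding opt[symmetric] min.commute[of n m] using Yc by (intro sum.cong) auto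
  note C = optimal_columns[OF Y k s opt]
  note R = optimal_columns[OF partial_isometries_adjoint[OF Y] k(1) k' s opt']
  have row: "Y $$ (i, j) = cnj (col (adj Y) i $ j)" using Yc ij by simp
  have col: "Y $$ (i, j) = col Y j $ i" using Yc ij by simp
  show "Y $$ (i, j) = (if i = j then 1 else 0)"
    if a: "i < n \<and> s (k - 1) < s i \<or> j < m \<and> s (k - 1) < s j"
    using a
  proof
    assume "i < n \<and> s (k - 1) < s i"
    then have "col (adj Y) i = unit_vec n i" using ij by (intro R(1)) auto
    then show ?thesis unfolding row using ij by (simp add: unit_vec_def)
  next
    assume "j < m \<and> s (k - 1) < s j"
    then have "col Y j = unit_vec m j" using ij by (intro C(1)) auto
    then show ?thesis unfolding col using ij by (simp add: unit_vec_def)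
  qed
  show "Y $$ (i, j) = 0" if c: "0 < s (k - 1)"
    and a: "(i < n \<longrightarrow> s i < s (k - 1)) \<or> (j < m \<longrightarrow> s j < s (k - 1))"
    using a
  proof
    assume "i < n \<longrightarrow> s i < s (k - 1)"
    then have "col (adj Y) i = 0\<^sub>v n" using ij c by (intro R(3)) auto
    then show ?thesis unfolding row using ij by simp
  next
    assume "j < m \<longrightarrow> s j < s (k - 1)"
    then have "col Y j = 0\<^sub>v m" using ij c by (intro C(3)) auto
    then show ?thesis unfolding col using ij by simp
  qed
  show "Y $$ (l, j) = (Y * adj Y) $$ (l, j)" if "j < m" "l < m" "0 < s j"
  proof -
    have "col Y j = col (Y * adj Y) j" using ij that by (intro C(2)) auto
    then have "col Y j $ l = col (Y * adj Y) j $ l" by simp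
    then show ?thesis using Yc ij that by (simp del: index_mult_mat(1))
  qed
qed

section \<open>Block forms of the minimizers\<close>

text \<open>The free block \<open>P\<close> sits on the \<open>e\<close> indices whose singular value ties with the \<open>k\<close>-th one, after the
  \<open>l\<close> indices with a larger singular value.\<close>

definition tie_block :: "nat \<Rightarrow> nat \<Rightarrow> nat \<Rightarrow> nat \<Rightarrow> complex mat \<Rightarrow> complex mat" where
  "tie_block m n l e P = bdiag (1\<^sub>m l) (bdiag P (0\<^sub>m (m - l - e) (n - l - e)))"

lemma projection_diagonalization:
  assumes P: "P \<in> carrier_mat e e" "P * P = P" "adj P = P"
  obtains T j where "unitary_mat e T" "j \<le> e" "P = T * pid e e j * adj T"
proof -
  obtain T d where T: "unitary_mat e T" "P = T * rdiag e e d * adj T"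
    and dec: "\<And>i j. i \<le> j \<Longrightarrow> j < e \<Longrightarrow> d j \<le> d i"
    using hermitian_diagonalization[OF P(1,3)] by blast
  note uT = unitaryD[OF T(1)]
  have "P * P = T * (rdiag e e d * rdiag e e d) * adj T"
    unfolding T(2) using uT by (simp add: mult_assoc_dim)
  also have "rdiag e e d * rdiag e e d = rdiag e e (\<lambda>i. d i * d i)"
    unfolding rdiag_mult by (rule rdiag_cong) auto
  finally have "T * rdiag e e (\<lambda>i. d i * d i) * adj T = T * rdiag e e d * adj T"
    using P(2) T(2) by simp
  then have dd: "d i * d i = d i" if "i < e" for i
    using conj_rdiag_inject[OF T(1) T(1)] that by blast
  obtain j where j: "j \<le> e" "\<And>i. i < e \<Longrightarrow> d i = (if i < j then 1 else 0)"
  proof (rule decreasing_zero_one[of e d])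
    show "d j \<le> d i" if "i \<le> j" "j < e" for i j using dec[OF that] .
    show "d i = 0 \<or> d i = 1" if "i < e" for i using dd[OF that] by (metis mult_cancel_right1)
  qed blast
  have "rdiag e e d = pid e e j" unfolding pid_def by (rule rdiag_cong) (use j in auto)
  then show thesis using that[OF T(1) j(1)] T(2) by simp
qed

lemma orth_projectionsI:
  assumes T: "unitary_mat e T" and j: "j \<le> e"
  shows "T * pid e e j * adj T \<in> orth_projections e j"
proof -
  let ?P = "T * pid e e j * adj T"
  note uT = unitaryD[OF T]
  have pp: "pid e e j * (pid e e j * X) = pid e e j * X" if "dim_row X = e" for X
  proof -
    have "pid e e j * pid e e j = pid e e j"
      unfolding pid_def rdiag_mult by (rule rdiag_cong) auto
    then show ?thesis using that by (simp add: mult_assoc_dim[symmetric])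
  qed
  have "?P * ?P = ?P" using uT by (simp add: mult_assoc_dim pp)
  moreover have "adj ?P = ?P" unfolding pid_def by (rule conj_rdiag_hermitian[OF T])
  moreover have "mat_rank ?P = j"
    unfolding pid_def by (rule mat_rank_rdiag[OF T T]) (use j in auto)
  moreover have "?P \<in> carrier_mat e e" unfolding pid_def by (rule conj_rdiag_carrier[OF T T])
  ultimately show ?thesis by (simp add: orth_projections_def)
qed

lemma orth_projectionsE:
  assumes "P \<in> orth_projections e j"
  obtains T where "unitary_mat e T" "j \<le> e" "P = T * pid e e j * adj T"
proof -
  have P: "P \<in> carrier_mat e e" "P * P = P" "adj P = P" "mat_rank P = j"
    using assms by (auto simp: orth_projections_def)
  from projection_diagonalization[OF P(1-3)] obtain T i where T: "unitary_mat e T" "i \<le> e"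
    "P = T * pid e e i * adj T" .
  have "i = j" using orth_projectionsI[OF T(1,2)] T(3) P(4) by (simp add: orth_projections_def)
  then show thesis using that T by blast
qed

text \<open>\<open>\<Sigma>\<close> is scalar on the tied indices, so it commutes with the unitary \<open>T\<close> that diagonalizes the
  projection in this block.\<close>

lemma tie_block_diag:
  assumes le: "l + e \<le> min m n" "j \<le> e" and T: "unitary_mat e T"
  defines "T1 \<equiv> bdiag (1\<^sub>m l) (bdiag T (1\<^sub>m (m - l - e)))"
    and "T2 \<equiv> bdiag (1\<^sub>m l) (bdiag T (1\<^sub>m (n - l - e)))"
  shows "unitary_mat m T1" "unitary_mat n T2"
    and "tie_block m n l e (T * pid e e j * adj T) = T1 * pid m n (l + j) * adj T2"
    and "\<And>s c. (\<And>i. l \<le> i \<Longrightarrow> i < l + e \<Longrightarrow> s i = c) \<Longrightarrow>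
      T1 * rdiag m n s * adj T2 = rdiag m n s"
proof -
  note uT = unitaryD[OF T]
  define a b where "a = m - l - e" and "b = n - l - e"
  have mn: "l + (e + a) = m" "l + (e + b) = n" using le by (auto simp: a_def b_def)
  note ab = a_def[symmetric] b_def[symmetric]
  show "unitary_mat m T1" "unitary_mat n T2"
    using bdiag_unitary[OF unitary_one[of l] bdiag_unitary[OF T unitary_one[of a]]]
      bdiag_unitary[OF unitary_one[of l] bdiag_unitary[OF T unitary_one[of b]]]
    unfolding T1_def T2_def ab mn .
  have "pid m n (l + j) = bdiag (1\<^sub>m l) (bdiag (pid e e j) (0\<^sub>m a b))"
    unfolding mn[symmetric] by (rule eq_matI) (use le(2) in \<open>auto simp: pid_def index_bdiag\<close>)
  then show "tie_block m n l e (T * pid e e j * adj T) = T1 * pid m n (l + j) * adj T2"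
    unfolding T1_def T2_def tie_block_def ab using uT by (simp add: bdiag_adjoint bdiag_mult)
  fix s :: "nat \<Rightarrow> real" and c assume c: "\<And>i. l \<le> i \<Longrightarrow> i < l + e \<Longrightarrow> s i = c"
  have split: "rdiag m n s = bdiag (rdiag l l s) (bdiag (complex_of_real c \<cdot>\<^sub>m 1\<^sub>m e)
      (rdiag a b (\<lambda>i. s (l + e + i))))"
    unfolding mn[symmetric] by (rule eq_matI) (use c in \<open>auto simp: index_bdiag\<close>)
  have "T * (complex_of_real c \<cdot>\<^sub>m 1\<^sub>m e) * adj T = complex_of_real c \<cdot>\<^sub>m 1\<^sub>m e"
    using uT by (simp add: mult_smult_distrib[of _ e e _ e] mult_smult_assoc_mat[of _ e e _ e])
  then show "T1 * rdiag m n s * adj T2 = rdiag m n s"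
    unfolding split T1_def T2_def ab using uT by (simp add: bdiag_adjoint bdiag_mult)
qed

text \<open>On the tied indices the columns of \<open>Y\<close> agree with those of \<open>Y Y\<^sup>*\<close>, so the middle block satisfies
  \<open>P = P P\<^sup>*\<close> and is a projection. Its rank is forced by the rank of \<open>Y\<close>.\<close>

lemma tie_block_form:
  assumes Y: "Y \<in> partial_isometries m n k" and k: "1 \<le> k" "k \<le> min m n"
    and s: "decseq s" "\<And>i. 0 \<le> s i"
    and opt: "(\<Sum>i<min m n. s i * Re (Y $$ (i, i))) = (\<Sum>i<k. s i)"
    and c: "0 < s (k - 1)" and le: "l + e \<le> min m n"
    and gt: "\<And>i. i < min m n \<Longrightarrow> s (k - 1) < s i \<longleftrightarrow> i < l"
    and lt: "\<And>i. i < min m n \<Longrightarrow> s i < s (k - 1) \<longleftrightarrow> l + e \<le> i"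
  obtains P where "P \<in> orth_projections e (k - l)" "Y = tie_block m n l e P"
proof -
  have Yc: "Y \<in> carrier_mat m n" using Y by (simp add: partial_isometries_def)
  note entries = optimal_entries[OF Y k s opt]
  define P where "P = mat e e (\<lambda>(a, b). Y $$ (l + a, l + b))"
  have P: "P \<in> carrier_mat e e" by (simp add: P_def)
  have form: "Y = tie_block m n l e P"
  proof (rule eq_matI)
    fix i j assume "i < dim_row (tie_block m n l e P)" "j < dim_col (tie_block m n l e P)"
    then have ij: "i < m" "j < n" using le by (auto simp: tie_block_def P_def)
    have 1: "Y $$ (i, j) = (if i = j then 1 else 0)" if "i < l \<or> j < l"
      by (rule entries(1)[OF ij]) (use that gt[of i] gt[of j] le ij in auto)
    have 0: "Y $$ (i, j) = 0" if "l + e \<le> i \<or> l + e \<le> j"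
      by (rule entries(2)[OF ij c]) (use that lt[of i] lt[of j] ij in auto)
    have sub: "i - l < e \<longleftrightarrow> i < l + e" if "\<not> i < l" for i using that by linarith
    show "Y $$ (i, j) = tie_block m n l e P $$ (i, j)"
      using 1 0 ij le sub[of i] sub[of j] by (auto simp: tie_block_def index_bdiag P_def not_less)
  qed (use Yc le in \<open>auto simp: tie_block_def P_def\<close>)
  have YY: "Y * adj Y = bdiag (1\<^sub>m l) (bdiag (P * adj P) (0\<^sub>m (m - l - e) (m - l - e)))"
  proof -
    have "adj (0\<^sub>m (m - l - e) (n - l - e)) = (0\<^sub>m (n - l - e) (m - l - e) :: complex mat)"
      by (rule eq_matI) auto
    then show ?thesis
      unfolding form tie_block_def using P by (simp add: bdiag_adjoint bdiag_mult)
  qed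
  have PP: "P = P * adj P"
  proof (rule eq_matI)
    fix a b assume "a < dim_row (P * adj P)" "b < dim_col (P * adj P)"
    then have ab: "a < e" "b < e" using P by auto
    have "\<not> s (l + b) < s (k - 1)" using lt[of "l + b"] ab le by simp
    then have "0 < s (l + b)" using c by simp
    then have "Y $$ (l + a, l + b) = (Y * adj Y) $$ (l + a, l + b)"
      using ab le by (intro entries(3)[of "l + a" "l + b" "l + a"]) auto
    also have "\<dots> = (P * adj P) $$ (a, b)"
      unfolding YY using ab carrier_matD[OF P] trans_less_add1[OF ab(1)] trans_less_add1[OF ab(2)]
      by (simp add: index_bdiag del: index_mult_mat(1))
    finally show "P $$ (a, b) = (P * adj P) $$ (a, b)" using ab by (simp add: P_def)
  qed (use P in auto)
  have Ph: "adj P = P"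
  proof -
    have "adj (P * adj P) = P * adj P" using P by (simp add: adjoint_mult)
    then show ?thesis unfolding PP[symmetric] .
  qed
  then have "P * P = P" using PP by simp
  from projection_diagonalization[OF P this Ph] obtain T j where T: "unitary_mat e T" "j \<le> e"
    "P = T * pid e e j * adj T" .
  note D = tie_block_diag[OF le T(2,1)]
  have "Y \<in> partial_isometries m n (l + j)"
    unfolding form T(3) D(3) by (rule partial_isometriesI[OF D(1,2)]) (use le T(2) in auto)
  then have "l + j = k" using Y by (simp add: partial_isometries_def)
  then have "P \<in> orth_projections e (k - l)"
    using orth_projectionsI[OF T(1,2)] T(3) by auto
  then show thesis using form that by blast
qed

text \<open>\<open>\<Sigma>\<close> vanishes beyond the rank of \<open>F\<close>, where the left and right singular bases can be changed
  independently.\<close>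

lemma zero_block_diag:
  assumes r: "r \<le> min m n" and A: "unitary_mat (m - r) A" and B: "unitary_mat (n - r) B"
  shows "unitary_mat m (bdiag (1\<^sub>m r) A)" "unitary_mat n (bdiag (1\<^sub>m r) B)"
    and "bdiag (1\<^sub>m r) (A * pid (m - r) (n - r) j * adj B) =
      bdiag (1\<^sub>m r) A * pid m n (r + j) * adj (bdiag (1\<^sub>m r) B)"
    and "\<And>s. (\<And>i. r \<le> i \<Longrightarrow> s i = 0) \<Longrightarrow>
      bdiag (1\<^sub>m r) A * rdiag m n s * adj (bdiag (1\<^sub>m r) B) = rdiag m n s"
proof -
  note uA = unitaryD[OF A] and uB = unitaryD[OF B]
  have mn: "r + (m - r) = m" "r + (n - r) = n" using r by auto
  show "unitary_mat m (bdiag (1\<^sub>m r) A)" "unitary_mat n (bdiag (1\<^sub>m r) B)"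
    using bdiag_unitary[OF unitary_one[of r] A] bdiag_unitary[OF unitary_one[of r] B] unfolding mn .
  have "pid m n (r + j) = bdiag (1\<^sub>m r) (pid (m - r) (n - r) j)"
    by (rule eq_matI) (use mn in \<open>auto simp: pid_def index_bdiag\<close>)
  then show "bdiag (1\<^sub>m r) (A * pid (m - r) (n - r) j * adj B) =
      bdiag (1\<^sub>m r) A * pid m n (r + j) * adj (bdiag (1\<^sub>m r) B)"
    using uA uB by (simp add: bdiag_adjoint bdiag_mult)
  fix s :: "nat \<Rightarrow> real" assume s: "\<And>i. r \<le> i \<Longrightarrow> s i = 0"
  have split: "rdiag m n s = bdiag (rdiag r r s) (0\<^sub>m (m - r) (n - r))"
    by (rule eq_matI) (use mn s in \<open>auto simp: index_bdiag\<close>)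
  show "bdiag (1\<^sub>m r) A * rdiag m n s * adj (bdiag (1\<^sub>m r) B) = rdiag m n s"
    unfolding split using uA uB by (simp add: bdiag_adjoint bdiag_mult)
qed

text \<open>The equation \<open>Y Y\<^sup>* Y = Y\<close> holds blockwise, so the lower block is again a partial isometry.\<close>

lemma zero_block_form:
  assumes Y: "Y \<in> partial_isometries m n k" and k: "1 \<le> k" "k \<le> min m n"
    and s: "decseq s" "\<And>i. 0 \<le> s i"
    and opt: "(\<Sum>i<min m n. s i * Re (Y $$ (i, i))) = (\<Sum>i<k. s i)"
    and c: "s (k - 1) = 0" and r: "r \<le> min m n" and pos: "\<And>i. 0 < s i \<longleftrightarrow> i < r"
  obtains S where "S \<in> partial_isometries (m - r) (n - r) (k - r)" "Y = bdiag (1\<^sub>m r) S"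
proof -
  have Yc: "Y \<in> carrier_mat m n" using Y by (simp add: partial_isometries_def)
  note entries = optimal_entries[OF Y k s opt]
  define S where "S = mat (m - r) (n - r) (\<lambda>(a, b). Y $$ (r + a, r + b))"
  have S: "S \<in> carrier_mat (m - r) (n - r)" by (simp add: S_def)
  have form: "Y = bdiag (1\<^sub>m r) S"
  proof (rule eq_matI)
    fix i j assume "i < dim_row (bdiag (1\<^sub>m r) S)" "j < dim_col (bdiag (1\<^sub>m r) S)"
    then have ij: "i < m" "j < n" using r by (auto simp: S_def)
    have 1: "Y $$ (i, j) = (if i = j then 1 else 0)" if "i < r \<or> j < r"
      by (rule entries(1)[OF ij]) (use that pos[of i] pos[of j] r ij c in auto)
    show "Y $$ (i, j) = bdiag (1\<^sub>m r) S $$ (i, j)"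
      using 1 ij r by (auto simp: index_bdiag S_def)
  qed (use Yc r in \<open>auto simp: S_def\<close>)
  have "bdiag (1\<^sub>m r) (S * (adj S * S)) = bdiag (1\<^sub>m r) S"
    using partial_isometries_absorb[OF Y] unfolding form using S by (simp add: bdiag_adjoint bdiag_mult)
  then have "S * (adj S * S) = S" by (rule bdiag_inject(2)) (use S in auto)
  then have "partial_isometry S" by (rule partial_isometryI[OF S])
  then have SP: "S \<in> partial_isometries (m - r) (n - r) (mat_rank S)"
    using S by (simp add: partial_isometries_def)
  obtain A B where A: "unitary_mat (m - r) A" and B: "unitary_mat (n - r) B"
    and SAB: "S = A * pid (m - r) (n - r) (mat_rank S) * adj B"
    and j: "mat_rank S \<le> min (m - r) (n - r)"
    by (rule partial_isometriesE[OF SP])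
  note D = zero_block_diag[OF r A B]
  define j where "j = mat_rank S"
  have "bdiag (1\<^sub>m r) S = bdiag (1\<^sub>m r) (A * pid (m - r) (n - r) j * adj B)"
    using SAB by (simp add: j_def)
  also have "\<dots> = bdiag (1\<^sub>m r) A * pid m n (r + j) * adj (bdiag (1\<^sub>m r) B)"
    by (rule D(3))
  also have "\<dots> \<in> partial_isometries m n (r + j)"
    by (rule partial_isometriesI[OF D(1,2)]) (use j r in \<open>auto simp: j_def\<close>)
  finally have "r + j = k" using Y form by (simp add: partial_isometries_def)
  then have "S \<in> partial_isometries (m - r) (n - r) (k - r)" using SP j_def by auto
  then show thesis using form that by blast
qed

section \<open>The set of minimizers\<close>

lemma minimizer_coordinates:
  assumes sym: "symmetric_gauge (min m n) \<Phi>" and conv: "strictly_convex_gauge (min m n) \<Phi>"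
    and k: "k \<le> min m n" and F: "F \<in> carrier_mat m n"
    and V: "unitary_mat m V" and W: "unitary_mat n W" and svd: "F = V * rdiag m n (sv F) * adj W"
    and X: "X \<in> minimizers \<Phi> m n k F"
  obtains Y where "Y \<in> partial_isometries m n k" "X = V * Y * adj W"
    "(\<Sum>i<min m n. sv F i * Re (Y $$ (i, i))) = (\<Sum>i<k. sv F i)"
proof -
  note uV = unitaryD[OF V] and uW = unitaryD[OF W]
  note mt = minimizer_trace[OF sym conv k F X]
  define s where "s = sv F"
  have Fs: "F = V * rdiag m n s * adj W" using svd by (simp only: s_def)
  have Xc: "X \<in> carrier_mat m n" using mt(1) by (simp add: partial_isometries_def)
  define Y where "Y = adj V * X * W"
  have YP: "Y \<in> partial_isometries m n k"
    using partial_isometry_conj[OF mt(1) unitary_adjoint[OF V] unitary_adjoint[OF W]] by (simp add: Y_def)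
  then have Yc: "Y \<in> carrier_mat m n" by (simp add: partial_isometries_def)
  have XY: "X = V * Y * adj W" using uV uW Xc by (simp add: Y_def mult_assoc_dim)
  have "adj X * F = W * (adj Y * rdiag m n s * adj W)"
    unfolding XY Fs using uV uW Yc by (simp add: adjoint_mult mult_assoc_dim)
  then have "(\<Sum>i<n. (adj X * F) $$ (i, i)) =
      (\<Sum>i<n. (W * (adj Y * rdiag m n s * adj W)) $$ (i, i))" by (simp only:)
  also have "\<dots> = (\<Sum>i<n. (adj Y * rdiag m n s * adj W * W) $$ (i, i))"
    by (rule trace_mult_comm) (use uW Yc in \<open>auto intro: carrier_matI\<close>)
  also have "adj Y * rdiag m n s * adj W * W = adj Y * rdiag m n s"
    using uW Yc by (simp add: mult_assoc_dim)
  also have "(\<Sum>i<n. (adj Y * rdiag m n s) $$ (i, i)) =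
      (\<Sum>i<min m n. cnj (Y $$ (i, i)) * complex_of_real (s i))"
    by (rule sum.mono_neutral_cong_right) (use Yc in \<open>auto simp: mult_rdiag_index simp del: index_mult_mat(1)\<close>)
  finally have "(\<Sum>i<k. s i) = Re (\<Sum>i<min m n. cnj (Y $$ (i, i)) * complex_of_real (s i))"
    using mt(2) by (simp add: s_def)
  also have "\<dots> = (\<Sum>i<min m n. s i * Re (Y $$ (i, i)))"
    by (simp add: mult.commute)
  finally show thesis using that[OF YP XY] by (simp add: s_def)
qed

lemma minimizers_tie:
  assumes sym: "symmetric_gauge (min m n) \<Phi>" and conv: "strictly_convex_gauge (min m n) \<Phi>"
    and k: "1 \<le> k" "k \<le> min m n" and F: "F \<in> carrier_mat m n"
    and V: "unitary_mat m V" and W: "unitary_mat n W" and svd: "F = V * rdiag m n (sv F) * adj W"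
    and c: "0 < sv F (k - 1)" and le: "l + e \<le> min m n" "l \<le> k"
    and gt: "\<And>i. i < min m n \<Longrightarrow> sv F (k - 1) < sv F i \<longleftrightarrow> i < l"
    and lt: "\<And>i. i < min m n \<Longrightarrow> sv F i < sv F (k - 1) \<longleftrightarrow> l + e \<le> i"
  shows "minimizers \<Phi> m n k F =
    (\<lambda>P. V * tie_block m n l e P * adj W) ` orth_projections e (k - l)" (is "_ = ?R")
proof
  show "minimizers \<Phi> m n k F \<subseteq> ?R"
  proof
    fix X assume "X \<in> minimizers \<Phi> m n k F"
    then obtain Y where Y: "Y \<in> partial_isometries m n k" "X = V * Y * adj W"
      "(\<Sum>i<min m n. sv F i * Re (Y $$ (i, i))) = (\<Sum>i<k. sv F i)"
      by (rule minimizer_coordinates[OF sym conv k(2) F V W svd])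
    obtain P where "P \<in> orth_projections e (k - l)" "Y = tie_block m n l e P"
    proof (rule tie_block_form[OF Y(1) k decseq_sv[OF F] sv_nonneg[OF F] Y(3) c le(1)])
      show "sv F (k - 1) < sv F i \<longleftrightarrow> i < l" if "i < min m n" for i using gt[OF that] .
      show "sv F i < sv F (k - 1) \<longleftrightarrow> l + e \<le> i" if "i < min m n" for i using lt[OF that] .
    qed (rule that)
    then show "X \<in> ?R" using Y(2) by blast
  qed
  show "?R \<subseteq> minimizers \<Phi> m n k F"
  proof
    fix X assume "X \<in> ?R"
    then obtain P where P: "P \<in> orth_projections e (k - l)" and X: "X = V * tie_block m n l e P * adj W"
      by blast
    from orth_projectionsE[OF P] obtain T where T: "unitary_mat e T" "k - l \<le> e"
      "P = T * pid e e (k - l) * adj T" .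
    have j: "l + (k - l) = k" using le(2) by simp
    define T1 where "T1 = bdiag (1\<^sub>m l) (bdiag T (1\<^sub>m (m - l - e)))"
    define T2 where "T2 = bdiag (1\<^sub>m l) (bdiag T (1\<^sub>m (n - l - e)))"
    note D = tie_block_diag[OF le(1) T(2,1), folded T1_def T2_def]
    have "sv F i = sv F (k - 1)" if "l \<le> i" "i < l + e" for i
      using gt[of i] lt[of i] that le(1) by (auto simp: not_less intro: order.antisym)
    then have inv: "T1 * rdiag m n (sv F) * adj T2 = rdiag m n (sv F)" by (rule D(4))
    show "X \<in> minimizers \<Phi> m n k F"
      unfolding X T(3) D(3) j by (rule rotated_minimizer[OF sym conv k(2) F V W svd D(1,2) inv])
  qed
qed

lemma minimizers_zero:
  assumes sym: "symmetric_gauge (min m n) \<Phi>" and conv: "strictly_convex_gauge (min m n) \<Phi>"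
    and k: "mat_rank F < k" "k \<le> min m n" and F: "F \<in> carrier_mat m n"
    and V: "unitary_mat m V" and W: "unitary_mat n W" and svd: "F = V * rdiag m n (sv F) * adj W"
  defines "r \<equiv> mat_rank F"
  shows "minimizers \<Phi> m n k F =
    (\<lambda>S. V * bdiag (1\<^sub>m r) S * adj W) ` partial_isometries (m - r) (n - r) (k - r)" (is "_ = ?R")
proof
  have r: "r \<le> min m n" "r < k" using k by (auto simp: r_def)
  have z: "sv F i = 0" if "r \<le> i" for i using sv_nonzero_iff[OF F, of i] that by (auto simp: r_def)
  have pos: "0 < sv F i \<longleftrightarrow> i < r" for i
    using sv_nonzero_iff[OF F, of i] sv_nonneg[OF F, of i] by (auto simp: r_def)
  have k1: "1 \<le> k" using k by simp
  have c: "sv F (k - 1) = 0" by (rule z) (use r in simp)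
  show "minimizers \<Phi> m n k F \<subseteq> ?R"
  proof
    fix X assume "X \<in> minimizers \<Phi> m n k F"
    then obtain Y where Y: "Y \<in> partial_isometries m n k" "X = V * Y * adj W"
      "(\<Sum>i<min m n. sv F i * Re (Y $$ (i, i))) = (\<Sum>i<k. sv F i)"
      by (rule minimizer_coordinates[OF sym conv k(2) F V W svd])
    obtain S where "S \<in> partial_isometries (m - r) (n - r) (k - r)" "Y = bdiag (1\<^sub>m r) S"
      by (rule zero_block_form[OF Y(1) k1 k(2) decseq_sv[OF F] sv_nonneg[OF F] Y(3) c r(1) pos], rule that)
    then show "X \<in> ?R" using Y(2) by blast
  qed
  show "?R \<subseteq> minimizers \<Phi> m n k F"
  proof
    fix X assume "X \<in> ?R"
    then obtain S where S: "S \<in> partial_isometries (m - r) (n - r) (k - r)"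
      and X: "X = V * bdiag (1\<^sub>m r) S * adj W" by blast
    obtain A B where A: "unitary_mat (m - r) A" and B: "unitary_mat (n - r) B"
      and SAB: "S = A * pid (m - r) (n - r) (k - r) * adj B"
      by (rule partial_isometriesE[OF S])
    define T1 where "T1 = bdiag (1\<^sub>m r) A"
    define T2 where "T2 = bdiag (1\<^sub>m r) B"
    note D = zero_block_diag[OF r(1) A B, folded T1_def T2_def]
    have inv: "T1 * rdiag m n (sv F) * adj T2 = rdiag m n (sv F)" using z by (rule D(4))
    have rk: "r + (k - r) = k" using r by simp
    show "X \<in> minimizers \<Phi> m n k F"
      unfolding X SAB D(3) rk by (rule rotated_minimizer[OF sym conv k(2) F V W svd D(1,2) inv])
  qed
qed

lemma conj_inject:
  assumes V: "unitary_mat m V" and W: "unitary_mat n W"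
    and Y: "Y \<in> carrier_mat m n" "Y' \<in> carrier_mat m n"
    and eq: "V * Y * adj W = V * Y' * adj W"
  shows "Y = Y'"
proof -
  note u = unitaryD[OF V] unitaryD[OF W]
  have "adj V * (V * Y * adj W) * W = adj V * (V * Y' * adj W) * W"
    by (simp only: eq)
  then show ?thesis using u Y by (simp add: mult_assoc_dim)
qed

lemma tie_block_carrier:
  assumes "l + e \<le> min m n" "P \<in> carrier_mat e e"
  shows "tie_block m n l e P \<in> carrier_mat m n"
  unfolding tie_block_def using assms by (intro carrier_matI) auto

lemma tie_block_inj:
  assumes V: "unitary_mat m V" and W: "unitary_mat n W" and le: "l + e \<le> min m n"
  shows "inj_on (\<lambda>P. V * tie_block m n l e P * adj W) (orth_projections e j)"
proof (rule inj_onI)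
  fix P P' assume "P \<in> orth_projections e j" "P' \<in> orth_projections e j"
  then have P: "P \<in> carrier_mat e e" "P' \<in> carrier_mat e e" by (auto simp: orth_projections_def)
  assume "V * tie_block m n l e P * adj W = V * tie_block m n l e P' * adj W"
  then have "tie_block m n l e P = tie_block m n l e P'"
    by (rule conj_inject[OF V W tie_block_carrier[OF le P(1)] tie_block_carrier[OF le P(2)]])
  then have "bdiag P (0\<^sub>m (m - l - e) (n - l - e)) = bdiag P' (0\<^sub>m (m - l - e) (n - l - e))"
    unfolding tie_block_def by (rule bdiag_inject(2)) (use P in auto)
  then show "P = P'" by (rule bdiag_inject(1)) (use P in auto)
qed

lemma zero_block_inj:
  assumes V: "unitary_mat m V" and W: "unitary_mat n W" and r: "r \<le> min m n"
  shows "inj_on (\<lambda>S. V * bdiag (1\<^sub>m r) S * adj W) (partial_isometries (m - r) (n - r) j)"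
proof (rule inj_onI)
  fix S S' assume "S \<in> partial_isometries (m - r) (n - r) j" "S' \<in> partial_isometries (m - r) (n - r) j"
  then have S: "S \<in> carrier_mat (m - r) (n - r)" "S' \<in> carrier_mat (m - r) (n - r)"
    by (auto simp: partial_isometries_def)
  assume eq: "V * bdiag (1\<^sub>m r) S * adj W = V * bdiag (1\<^sub>m r) S' * adj W"
  have "bdiag (1\<^sub>m r) S = bdiag (1\<^sub>m r) S'"
    by (rule conj_inject[OF V W _ _ eq]) (use S r in \<open>auto intro!: carrier_matI\<close>)
  then show "S = S'" by (rule bdiag_inject(2)) (use S in auto)
qed

lemma infinite_injective_image:
  assumes "inj_on f A" "infinite A" "\<And>x. x \<in> A \<Longrightarrow> f x \<in> B"
  shows "infinite B"
proof
  assume "finite B"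
  then have "finite (f ` A)" by (rule rev_finite_subset) (use assms(3) in auto)
  then show False using finite_imageD[OF _ assms(1)] assms(2) by blast
qed

text \<open>Rotations in the plane of the basis vectors \<open>j - 1\<close> and \<open>j\<close>, between the range and the kernel of the
  coordinate projection, give a one-parameter family; the diagonal entry \<open>c\<^sup>2\<close> tells its members apart.\<close>

lemma infinite_orth_projections:
  assumes j: "0 < j" "j < e"
  shows "infinite (orth_projections e j)"
proof -
  define t where "t c a b = (if a = b then c else if a < b then - sqrt (1 - c\<^sup>2) else sqrt (1 - c\<^sup>2))"
    for c :: real and a b :: nat
  define T where "T c = mat 2 2 (\<lambda>(a, b). complex_of_real (t c a b))" for c :: real
  have sum2: "(\<Sum>l\<in>{0..<2}. f l) = f 0 + f 1" for f :: "nat \<Rightarrow> complex"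
    by (simp add: numeral_2_eq_2)
  have T: "unitary_mat 2 (T c)" if "c \<in> {0<..<1}" for c
  proof (rule unitaryI)
    have "c\<^sup>2 \<le> 1" using that by (simp add: power_le_one)
    then have c: "c * c + sqrt (1 - c\<^sup>2) * sqrt (1 - c\<^sup>2) = 1" by (simp add: power2_eq_square)
    show "adj (T c) * T c = 1\<^sub>m 2"
    proof (rule eq_matI)
      fix a b assume "a < dim_row (1\<^sub>m 2 :: complex mat)" "b < dim_col (1\<^sub>m 2 :: complex mat)"
      then have ab: "a < 2" "b < 2" by auto
      then have "(adj (T c) * T c) $$ (a, b) = complex_of_real (t c 0 a * t c 0 b + t c 1 a * t c 1 b)"
        by (simp add: T_def scalar_prod_def sum2)
      also have "t c 0 a * t c 0 b + t c 1 a * t c 1 b = (if a = b then 1 else 0)"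
        using c ab by (auto simp: t_def less_2_cases_iff add.commute)
      finally show "(adj (T c) * T c) $$ (a, b) = 1\<^sub>m 2 $$ (a, b)" using ab by simp
    qed (auto simp: T_def)
  qed (simp add: T_def)
  define P where "P c = tie_block e e (j - 1) 2 (T c * pid 2 2 1 * adj (T c))" for c
  have le: "j - 1 + 2 \<le> min e e" "1 \<le> (2::nat)" using j by auto
  have mem: "P c \<in> orth_projections e j" if c: "c \<in> {0<..<1}" for c
  proof -
    note D = tie_block_diag[OF le T[OF c]]
    have "j - 1 + 1 = j" using j by simp
    then show ?thesis
      unfolding P_def D(3) using orth_projectionsI[OF D(1), of j] j by simp
  qed
  have inj: "inj_on P {0<..<1}"
  proof (rule inj_onI)
    fix c c' :: real assume c: "c \<in> {0<..<1}" "c' \<in> {0<..<1}" and "P c = P c'"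
    have entry: "(T c * pid 2 2 1 * adj (T c)) $$ (0, 0) = complex_of_real (c\<^sup>2)" for c
    proof -
      have "(T c * pid 2 2 1) $$ (0, a) = (if a = 0 then complex_of_real c else 0)" if "a < 2" for a
        using that by (simp add: pid_def mult_rdiag_index T_def t_def del: index_mult_mat(1))
      then have "(T c * pid 2 2 1 * adj (T c)) $$ (0, 0) = (\<Sum>a\<in>{0..<2}. (if a = 0 then complex_of_real c else 0) * adj (T c) $$ (a, 0))"
        by (subst index_mult_sum) (auto simp: T_def simp del: index_mult_mat(1))
      also have "\<dots> = complex_of_real (c\<^sup>2)"
        by (simp add: sum2 T_def t_def power2_eq_square)
      finally show ?thesis .
    qed
    have Pc: "P c $$ (j - 1, j - 1) = complex_of_real (c\<^sup>2)" for c
      using entry[of c] j unfolding P_def tie_block_def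
      by (simp add: index_bdiag T_def del: index_mult_mat(1))
    have "complex_of_real (c\<^sup>2) = complex_of_real (c'\<^sup>2)"
      using Pc[of c] Pc[of c'] unfolding \<open>P c = P c'\<close> by simp
    then have "c\<^sup>2 = c'\<^sup>2" by (simp only: of_real_eq_iff)
    then show "c = c'" using c by (simp add: power2_eq_iff_nonneg)
  qed
  show ?thesis by (rule infinite_injective_image[OF inj _ mem]) (simp_all add: infinite_Ioo)
qed

text \<open>Multiples of one partial isometry by complex numbers of modulus \<open>1\<close>.\<close>

lemma infinite_partial_isometries:
  assumes k: "0 < k" "k \<le> min m n"
  shows "infinite (partial_isometries m n k)"
proof -
  define z where "z c = Complex c (sqrt (1 - c\<^sup>2))" for c
  define X where "X c = (z c \<cdot>\<^sub>m 1\<^sub>m m) * pid m n k * adj (1\<^sub>m n)" for c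
  have mem: "X c \<in> partial_isometries m n k" if c: "c \<in> {0<..<1}" for c
  proof -
    have "c\<^sup>2 \<le> 1" using c by (simp add: power_le_one)
    then have z: "cnj (z c) * z c = 1"
      by (simp add: z_def complex_eq_iff power2_eq_square)
    have "unitary_mat m (z c \<cdot>\<^sub>m 1\<^sub>m m)"
    proof (rule unitaryI)
      have "adj (z c \<cdot>\<^sub>m 1\<^sub>m m) = cnj (z c) \<cdot>\<^sub>m 1\<^sub>m m"
        by (rule eq_matI) auto
      then show "adj (z c \<cdot>\<^sub>m 1\<^sub>m m) * (z c \<cdot>\<^sub>m 1\<^sub>m m) = 1\<^sub>m m"
        using z by (simp add: mult_smult_distrib[of _ m m _ m] mult_smult_assoc_mat[of _ m m _ m])
          (intro eq_matI, auto simp: mult.commute)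
    qed simp
    then show ?thesis unfolding X_def by (rule partial_isometriesI[OF _ unitary_one k(2)])
  qed
  have inj: "inj_on X {0<..<1}"
  proof (rule inj_onI)
    fix c c' :: real assume "X c = X c'"
    have Xc: "X c $$ (0, 0) = z c" for c
    proof -
      have "X c = z c \<cdot>\<^sub>m pid m n k"
        unfolding X_def by (simp add: mult_smult_assoc_mat[of _ m m _ n] pid_def)
      then show ?thesis using k by (simp add: pid_def)
    qed
    have "z c = z c'" using Xc[of c] Xc[of c'] unfolding \<open>X c = X c'\<close> by simp
    then show "c = c'" by (simp add: z_def)
  qed
  show ?thesis by (rule infinite_injective_image[OF inj _ mem]) (simp_all add: infinite_Ioo)
qed

lemma orth_projections_full: "orth_projections e e = {1\<^sub>m e}"
proof
  show "orth_projections e e \<subseteq> {1\<^sub>m e}"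
  proof
    fix P assume "P \<in> orth_projections e e"
    from orth_projectionsE[OF this] obtain T where T: "unitary_mat e T" "P = T * pid e e e * adj T" .
    moreover have "pid e e e = 1\<^sub>m e" by (rule eq_matI) (auto simp: pid_def)
    ultimately show "P \<in> {1\<^sub>m e}" using unitaryD[OF T(1)] by simp
  qed
  have "1\<^sub>m e * pid e e e * adj (1\<^sub>m e) = (1\<^sub>m e :: complex mat)"
    by (rule eq_matI) (auto simp: pid_def)
  then show "{1\<^sub>m e} \<subseteq> orth_projections e e"
    using orth_projectionsI[OF unitary_one[of e], of e] by simp
qed

text \<open>A down-closed set of indices is an initial segment, so membership is comparison with its size. The
  indices of \<open>A\<close> start at \<open>0\<close>, those of the counted set at \<open>1\<close>.\<close>

lemma prefix_count:
  fixes q :: nat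
  assumes "\<And>i j. i \<le> j \<Longrightarrow> j < q \<Longrightarrow> A j \<Longrightarrow> A i" "i < q"
  shows "A i \<longleftrightarrow> i < card {j \<in> {1..q}. A (j - 1)}"
proof -
  define d where "d i = (if A i then 1 else 0 :: real)" for i
  obtain l where l: "l \<le> q" "\<And>i. i < q \<Longrightarrow> d i = (if i < l then 1 else 0)"
  proof (rule decreasing_zero_one[of q d])
    show "d j \<le> d i" if "i \<le> j" "j < q" for i j using assms(1)[OF that] by (auto simp: d_def)
    show "d i = 0 \<or> d i = 1" for i by (auto simp: d_def)
  qed blast
  have Al: "A i \<longleftrightarrow> i < l" if "i < q" for i using l(2)[OF that] by (auto simp: d_def split: if_splits)
  have "{j \<in> {1..q}. A (j - 1)} = {1..l}"
  proof (intro Set.set_eqI iffI)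
    fix j assume "j \<in> {j \<in> {1..q}. A (j - 1)}"
    then show "j \<in> {1..l}" using Al[of "j - 1"] by (cases j) auto
  next
    fix j assume "j \<in> {1..l}"
    then show "j \<in> {j \<in> {1..q}. A (j - 1)}" using Al[of "j - 1"] l(1) by auto
  qed
  then show ?thesis using Al[OF assms(2)] by simp
qed

lemma prefix_counts:
  fixes s :: "nat \<Rightarrow> real"
  assumes s: "decseq s" and k: "1 \<le> k" "k \<le> q"
  defines "l \<equiv> card {j \<in> {1..q}. s (k - 1) < s (j - 1)}"
    and "e \<equiv> card {j \<in> {1..q}. s (j - 1) = s (k - 1)}"
  shows "\<And>i. i < q \<Longrightarrow> s (k - 1) < s i \<longleftrightarrow> i < l" "\<And>i. i < q \<Longrightarrow> s i < s (k - 1) \<longleftrightarrow> l + e \<le> i"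
    and "l + e \<le> q" "l < k" "k \<le> l + e"
proof -
  show gt: "s (k - 1) < s i \<longleftrightarrow> i < l" if "i < q" for i
    unfolding l_def
  proof (rule prefix_count[of q "\<lambda>i. s (k - 1) < s i", OF _ that])
    fix i j assume "i \<le> j" "s (k - 1) < s j"
    then show "s (k - 1) < s i" using decseqD[OF s, of i j] by simp
  qed
  have un: "{j \<in> {1..q}. s (k - 1) \<le> s (j - 1)} =
      {j \<in> {1..q}. s (k - 1) < s (j - 1)} \<union> {j \<in> {1..q}. s (j - 1) = s (k - 1)}" by auto
  have disj: "{j \<in> {1..q}. s (k - 1) < s (j - 1)} \<inter> {j \<in> {1..q}. s (j - 1) = s (k - 1)} = {}"
  proof (rule equals0I)
    fix y assume "y \<in> {j \<in> {1..q}. s (k - 1) < s (j - 1)} \<inter> {j \<in> {1..q}. s (j - 1) = s (k - 1)}"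
    then have "s (k - 1) < s (y - 1)" "s (y - 1) = s (k - 1)" by blast+
    then show False by linarith
  qed
  have le: "card {j \<in> {1..q}. s (k - 1) \<le> s (j - 1)} = l + e"
    unfolding l_def e_def un by (rule card_Un_disjoint[OF _ _ disj]) simp_all
  have ge: "s (k - 1) \<le> s i \<longleftrightarrow> i < l + e" if "i < q" for i
    unfolding le[symmetric]
  proof (rule prefix_count[of q "\<lambda>i. s (k - 1) \<le> s i", OF _ that])
    fix i j assume "i \<le> j" "s (k - 1) \<le> s j"
    then show "s (k - 1) \<le> s i" using decseqD[OF s, of i j] by simp
  qed
  show "s i < s (k - 1) \<longleftrightarrow> l + e \<le> i" if "i < q" for i 
    using ge[OF that] by linarith
  have "card {j \<in> {1..q}. s (k - 1) \<le> s (j - 1)} \<le> card {1..q}" by (rule card_mono) auto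
  then show "l + e \<le> q" unfolding le by simp
  have k1: "k - 1 < q" using k by simp
  show "l < k" "k \<le> l + e" using gt[OF k1] ge[OF k1] k(1) by linarith+
qed

text \<open>Without a tie across the \<open>k\<close>-th place, the block \<open>P\<close> is a projection of full rank.\<close>

lemma minimizers_gap:
  assumes sym: "symmetric_gauge (min m n) \<Phi>" and conv: "strictly_convex_gauge (min m n) \<Phi>"
    and k: "1 \<le> k" "k \<le> min m n" and F: "F \<in> carrier_mat m n"
    and V: "unitary_mat m V" and W: "unitary_mat n W" and svd: "F = V * rdiag m n (sv F) * adj W"
    and gap: "sv F k < sv F (k - 1)"
  shows "minimizers \<Phi> m n k F = {V * pid m n k * adj W}"
proof -
  note C = prefix_counts[OF decseq_sv[OF F] k]
  define l where "l = card {j \<in> {1..min m n}. sv F (k - 1) < sv F (j - 1)}"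
  define e where "e = card {j \<in> {1..min m n}. sv F (j - 1) = sv F (k - 1)}"
  note C = C[folded l_def e_def]
  have c: "0 < sv F (k - 1)" using gap sv_nonneg[OF F, of k] by simp
  have "l + e \<le> k"
  proof (cases "k < min m n")
    case True
    then show ?thesis using C(2)[of k] gap by simp
  next
    case False
    with k(2) have "k = min m n" by linarith
    then show ?thesis using C(3) by simp
  qed
  then have le: "l + e = k" "k - l = e" using C(5) by auto
  have "tie_block m n l e (1\<^sub>m e) = pid m n k"
    by (rule eq_matI) (use le k in \<open>auto simp: tie_block_def pid_def index_bdiag\<close>)
  then show ?thesis
    using minimizers_tie[OF sym conv k F V W svd c C(3) _ C(1,2)] C(4) le(2) orth_projections_full[of e]
    by simp
qed

text \<open>\<open>F = U \<bar>F\<bar>\<close> determines \<open>U\<close> on the right singular vectors with nonzero singular value, and the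
  kernel condition on the others.\<close>

lemma canonical_polar_svd:
  assumes F: "F \<in> carrier_mat m n"
    and V: "unitary_mat m V" and W: "unitary_mat n W" and svd: "F = V * rdiag m n (sv F) * adj W"
    and U: "canonical_polar F U"
  shows "U = V * pid m n (mat_rank F) * adj W"
proof -
  note uV = unitaryD[OF V] and uW = unitaryD[OF W]
  define r where "r = mat_rank F"
  have r: "r \<le> min m n" using mat_rank_le[OF F] by (simp add: r_def)
  define s where "s = sv F"
  have s: "s i \<noteq> 0 \<longleftrightarrow> i < r" "0 \<le> s i" for i
    using sv_nonzero_iff[OF F, of i] sv_nonneg[OF F, of i] by (auto simp: s_def r_def)
  have Uc: "U \<in> carrier_mat m n" and ker: "mat_kernel U = mat_kernel F" and FU: "F = U * mat_abs F"
    using U F by (auto simp: canonical_polar_def)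
  have Fs: "F = V * rdiag m n s * adj W" using svd by (simp only: s_def)
  have "(\<lambda>i. if i < m then \<bar>s i\<bar> else 0) = s"
  proof
    fix i show "(if i < m then \<bar>s i\<bar> else 0) = s i" using s[of i] r by auto
  qed
  then have abs: "mat_abs F = W * rdiag n n s * adj W"
    using mat_abs_rdiag[OF V W Fs] by simp
  define Z where "Z = adj V * U * W"
  have Z: "Z \<in> carrier_mat m n" using uV uW Uc by (auto simp: Z_def intro: carrier_matI)
  have UZ: "U = V * Z * adj W" using uV uW Uc by (simp add: Z_def mult_assoc_dim)
  have "rdiag m n s = adj V * F * W"
    unfolding Fs using uV uW by (simp add: mult_assoc_dim)
  also have "\<dots> = adj V * (U * mat_abs F) * W" by (simp only: FU[symmetric])
  also have "\<dots> = Z * rdiag n n s"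
    unfolding abs Z_def using uV uW Uc by (simp add: mult_assoc_dim)
  finally have ZD: "rdiag m n s = Z * rdiag n n s" .
  have "Z = pid m n r"
  proof (rule eq_matI)
    fix i j assume "i < dim_row (pid m n r)" "j < dim_col (pid m n r)"
    then have ij: "i < m" "j < n" by auto
    show "Z $$ (i, j) = pid m n r $$ (i, j)"
    proof (cases "j < r")
      case True
      have "rdiag m n s $$ (i, j) = Z $$ (i, j) * complex_of_real (s j)"
        unfolding ZD using Z ij by (simp add: mult_rdiag_index del: index_mult_mat(1))
      then show ?thesis using s(1)[of j] True ij by (auto simp: pid_def split: if_splits)
    next
      case False
      have w: "col W j \<in> carrier_vec n" using uW by (auto intro: carrier_vecI)
      have "F * W = V * rdiag m n s" unfolding Fs using uV uW by (simp add: mult_assoc_dim)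
      then have "F *\<^sub>v col W j = col (V * rdiag m n s) j"
        using F uW(1) ij col_mult2[of F m n W n j] by simp
      also have "\<dots> = 0\<^sub>v m"
        by (rule eq_vecI) (use uV ij False s(1)[of j] in \<open>auto simp: mult_rdiag_index simp del: index_mult_mat(1)\<close>)
      finally have "col W j \<in> mat_kernel F" using F w by (intro mat_kernelI)
      then have "U *\<^sub>v col W j = 0\<^sub>v m" unfolding ker[symmetric] using mat_kernelD[OF Uc] by blast
      moreover have "Z = adj V * (U * W)" using uV uW Uc by (simp add: Z_def mult_assoc_dim)
      then have "col Z j = adj V *\<^sub>v (U *\<^sub>v col W j)"
        using uV uW Uc ij col_mult2[of "adj V" m m "U * W" n j] col_mult2[of U m n W n j] by simp
      ultimately have "col Z j = 0\<^sub>v m" using uV by (auto intro!: eq_vecI)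
      then have "Z $$ (i, j) = 0" using Z ij index_col[of i Z j] by simp
      then show ?thesis using False ij by (simp add: pid_def)
    qed
  qed (use Z in auto)
  then show ?thesis using UZ by (simp add: r_def)
qed

theorem theorem3p5:
  fixes m n q k r :: nat and F :: "complex mat" and \<Phi> :: "real vec \<Rightarrow> real"
  assumes "m \<ge> 1" and "n \<ge> 1" and "q = min m n" and "1 \<le> k" and "k \<le> q"
    and "F \<in> carrier_mat m n" and "r = mat_rank F"
    and "symmetric_gauge q \<Phi>" and "strictly_convex_gauge q \<Phi>"
  shows
    "(k < r \<longrightarrow>
        ((\<exists>!X. X \<in> minimizers \<Phi> m n k F) \<longleftrightarrow> sing_val F k \<noteq> sing_val F (k + 1)) \<and>
        (sing_val F k = sing_val F (k + 1) \<longrightarrow>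
           infinite (minimizers \<Phi> m n k F) \<and>
           (\<forall>l e V W.
              l = card {j \<in> {1..q}. sing_val F j > sing_val F k} \<longrightarrow>
              e = card {j \<in> {1..q}. sing_val F j = sing_val F k} \<longrightarrow>
              is_svd F V W \<longrightarrow>
              bij_betw
                (\<lambda>P. V * diag_block_mat [1\<^sub>m l, P, 0\<^sub>m (m - l - e) (n - l - e)] * mat_adjoint W)
                (orth_projections e (k - l))
                (minimizers \<Phi> m n k F))))
   \<and> (k = r \<longrightarrow>
        (\<forall>U. canonical_polar F U \<longrightarrow> minimizers \<Phi> m n k F = {U}))
   \<and> (r < k \<longrightarrow>
        infinite (minimizers \<Phi> m n k F) \<and>
        (\<forall>V W. is_svd F V W \<longrightarrow>
           minimizers \<Phi> m n k F =
             (\<lambda>S. V * diag_block_mat [1\<^sub>m r, S] * mat_adjoint W)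
               ` partial_isometries (m - r) (n - r) (k - r)))"
proof -
  note q = assms(3) and k = assms(4,5)[unfolded assms(3)] and F = assms(6) and r = assms(7)
  note sym = assms(8)[unfolded assms(3)] and conv = assms(9)[unfolded assms(3)]
  have rq: "r \<le> min m n" unfolding r by (rule mat_rank_le[OF F])
  have sv0: "sv F i \<noteq> 0 \<longleftrightarrow> i < r" for i unfolding r by (rule sv_nonzero_iff[OF F])
  have sing: "sing_val F j = sv F (j - 1)" if "j \<in> {1..q}" for j
    using that by (auto simp: sv_def carrier_matD[OF F] q)
  obtain V0 W0 where svd0: "unitary_mat m V0" "unitary_mat n W0" "F = V0 * rdiag m n (sv F) * adj W0"
    by (rule svd_sv[OF F], rule that)
  define l where "l = card {j \<in> {1..min m n}. sv F (k - 1) < sv F (j - 1)}"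
  define e where "e = card {j \<in> {1..min m n}. sv F (j - 1) = sv F (k - 1)}"
  note C = prefix_counts[OF decseq_sv[OF F] k, folded l_def e_def]
  have singk: "sing_val F k = sv F (k - 1)" using sing[of k] k q by simp
  have l_eq: "card {j \<in> {1..q}. sing_val F j > sing_val F k} = l"
    unfolding l_def q singk by (rule arg_cong[where f = card]) (use sing q in auto)
  have e_eq: "card {j \<in> {1..q}. sing_val F j = sing_val F k} = e"
    unfolding e_def q singk by (rule arg_cong[where f = card]) (use sing q in auto)
  have gap: "\<exists>!X. X \<in> minimizers \<Phi> m n k F" if "sv F k < sv F (k - 1)"
    unfolding minimizers_gap[OF sym conv k F svd0 that] by auto
  have blocks: "diag_block_mat [1\<^sub>m l, P, 0\<^sub>m (m - l - e) (n - l - e)] = tie_block m n l e P" for P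
    unfolding tie_block_def diag_block_mat_Cons[of "1\<^sub>m l" "[P, 0\<^sub>m (m - l - e) (n - l - e)]"]
      diag_block_mat_bdiag ..
  have bij: "bij_betw (\<lambda>P. V * tie_block m n l e P * adj W)
      (orth_projections e (k - l)) (minimizers \<Phi> m n k F)"
    if "k \<le> r" "unitary_mat m V" "unitary_mat n W" "F = V * rdiag m n (sv F) * adj W" for V W
  proof -
    have "k - 1 < r" using that(1) k(1) by linarith
    then have c: "0 < sv F (k - 1)" using sv0[of "k - 1"] sv_nonneg[OF F, of "k - 1"] by simp
    show ?thesis
      unfolding bij_betw_def
      using tie_block_inj[OF that(2,3) C(3), of "k - l"]
        minimizers_tie[OF sym conv k F that(2-4) c C(3) _ C(1,2)] C(4) by simp
  qed
  have part1: "((\<exists>!X. X \<in> minimizers \<Phi> m n k F) \<longleftrightarrow> sing_val F k \<noteq> sing_val F (k + 1)) \<and>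
      (sing_val F k = sing_val F (k + 1) \<longrightarrow> infinite (minimizers \<Phi> m n k F))" if kr: "k < r"
  proof -
    have sing1: "sing_val F (k + 1) = sv F k" using sing[of "k + 1"] kr rq q by simp
    have dec: "sv F k \<le> sv F (k - 1)" using decseqD[OF decseq_sv[OF F], of "k - 1" k] by simp
    have inf: "infinite (minimizers \<Phi> m n k F)" if "sv F (k - 1) = sv F k"
    proof -
      have "k < l + e" using C(2)[of k] kr rq that by auto
      then have "infinite (orth_projections e (k - l))"
        using C(4) by (intro infinite_orth_projections) auto
      then show ?thesis using bij_betw_finite[OF bij[OF _ svd0]] kr by simp
    qed
    have "\<not> (\<exists>!X. X \<in> minimizers \<Phi> m n k F)" if "sv F (k - 1) = sv F k"
    proof
      assume "\<exists>!X. X \<in> minimizers \<Phi> m n k F"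
      then obtain X where "minimizers \<Phi> m n k F = {X}" by blast
      then show False using inf[OF that] by simp
    qed
    then show ?thesis unfolding singk sing1 using inf gap dec by (auto simp: order_less_le)
  qed
  have part2: "minimizers \<Phi> m n k F = {U}" if "k = r" "canonical_polar F U" for U
  proof -
    have "sv F k < sv F (k - 1)"
      using sv0[of k] sv0[of "k - 1"] sv_nonneg[OF F, of "k - 1"] that(1) k by simp
    then show ?thesis
      using minimizers_gap[OF sym conv k F svd0] canonical_polar_svd[OF F svd0 that(2)] that(1) r by simp
  qed
  have part3: "minimizers \<Phi> m n k F = (\<lambda>S. V * bdiag (1\<^sub>m r) S * adj W) `
      partial_isometries (m - r) (n - r) (k - r)"
    if "r < k" "unitary_mat m V" "unitary_mat n W" "F = V * rdiag m n (sv F) * adj W" for V W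
    unfolding r by (rule minimizers_zero[OF sym conv _ k(2) F that(2-4)]) (use that(1) r in simp)
  have inf3: "infinite (minimizers \<Phi> m n k F)" if "r < k"
  proof -
    have "infinite (partial_isometries (m - r) (n - r) (k - r))"
      using that k by (intro infinite_partial_isometries) auto
    then show ?thesis
      unfolding part3[OF that svd0] using finite_imageD[OF _ zero_block_inj[OF svd0(1,2) rq]] by blast
  qed
  show ?thesis
  proof (intro conjI impI allI)
    fix l' e' :: nat and V W :: "complex mat"
    assume kr: "k < r" and "l' = card {j \<in> {1..q}. sing_val F j > sing_val F k}"
      "e' = card {j \<in> {1..q}. sing_val F j = sing_val F k}" and "is_svd F V W"
    then have "l' = l" "e' = e" and svd: "unitary_mat m V" "unitary_mat n W"
      "F = V * rdiag m n (sv F) * adj W"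
      unfolding l_eq e_eq is_svd_iff[OF F] by blast+
    show "bij_betw (\<lambda>P. V * diag_block_mat [1\<^sub>m l', P, 0\<^sub>m (m - l' - e') (n - l' - e')] * adj W)
        (orth_projections e' (k - l')) (minimizers \<Phi> m n k F)"
      unfolding \<open>l' = l\<close> \<open>e' = e\<close> blocks by (rule bij[OF less_imp_le[OF kr] svd])
  next
    fix V W assume "r < k" "is_svd F V W"
    then show "minimizers \<Phi> m n k F = (\<lambda>S. V * diag_block_mat [1\<^sub>m r, S] * adj W) `
        partial_isometries (m - r) (n - r) (k - r)"
      unfolding is_svd_iff[OF F] diag_block_mat_bdiag using part3 by blast
  qed (use part1 part2 inf3 in blast)+
qed

end
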